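(* Let $\mathbb{K}=\Bbbk[q,q^{-1}]$ with $q$ an indeterminate. (1) There is a graded $R_{\mathbb{K}}$-representation $\iota_R$ of $\Lambda_{\mathbb{K}}$ given by sending $\alpha_i\mapsto a_i$, $\overline{\alpha}_i\mapsto\bar a_i$ for $0\le i\le n$. This specialises to give a graded $R_q$-representation of $\Lambda_q$ for any $q\in\Bbbk^\times$. (2) $R_{\mathbb{K}}$ is universal for graded $A_{\mathbb{K}}$-representations of $\Lambda_{\mathbb{K}}$ in the following sense: given a graded $A_{\mathbb{K}}$-representation $\iota_A:\Lambda_{\mathbb{K}}\to M_{Q_0}(A_{\mathbb{K}})$ of $\Lambda_{\mathbb{K}}$, there is a unique $\mathbb{K}$-algebra homomorphism $\varphi:R_{\mathbb{K}}\to A_{\mathbb{K}}$ such that $M_{Q_0}(\varphi)\circ\iota_R=\iota_A$. (3) If $q\in\Bbbk^\times$ is not a root of unity, then $R_q$ is universal for graded $A_q$-representations of $\Lambda_q$: given a graded $A_q$-representation $\iota_A:\Lambda_q\to M_{Q_0}(A_q)$, there is a unique $\Bbbk$-algebra homomorphism $\varphi:R_q\to A_q$ such that $M_{Q_0}(\varphi)\circ\iota_R=\iota_A$.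
   Context: $\Bbbk$ is an algebraically closed field of characteristic $0$ and $n\ge2$ is a fixed integer. In what follows $\mathbb{F}$ is either $\mathbb{K}=\Bbbk[q,q^{-1}]$ with $q$ an indeterminate (giving $A_{\mathbb{K}},R_{\mathbb{K}},\Lambda_{\mathbb{K}}$) or $\Bbbk$ with $q\in\Bbbk^\times$ (giving $A_q,R_q,\Lambda_q$). $A$ is the $\mathbb{F}$-algebra $\mathbb{F}\langle u,v\rangle/\langle vu-quv\rangle$, graded with $\deg u=\deg v=1$. $R$ is the $\mathbb{F}$-algebra generated by $a_0,\dots,a_n,\bar a_0,\dots,\bar a_n$ with relations $a_ja_i=a_ia_j$, $\bar a_j\bar a_i=\bar a_i\bar a_j$, $\bar a_ja_i=qa_i\bar a_j$, $a_0\bar a_0=a_i\bar a_i$ for all $0\le i,j\le n$, graded with all generators in degree $1$. $Q$ is the quiver with vertex set $Q_0=\{0,\dots,n\}$ and arrows $\alpha_i:i\to i+1$, $\overline{\alpha}_i:i+1\to i$ for $0\le i\le n$ (indices mod $n+1$). $\Lambda$ is the path algebra $\mathbb{F}Q$ modulo the relations $\overline{\alpha}_i\alpha_i=q\alpha_{i+1}\overline{\alpha}_{i+1}$ for $0\le i\le n$, where arrows are composed from left to right; it is graded by path length, and $e_i$ is the idempotent at vertex $i$. For an $\mathbb{N}$-graded $\mathbb{F}$-algebra $\Gamma$, grade the matrix ring $M_{Q_0}(\Gamma)$ by giving matrix units degree $0$. A graded $\Gamma$-representation of $\Lambda$ is an $\mathbb{N}$-graded $\mathbb{F}$-algebra homomorphism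 $\iota:\Lambda\to M_{Q_0}(\Gamma)$ which sends each vertex idempotent $e_i$ to the matrix unit $e_{ii}$ and does not send any arrow to $0$. Then $\iota(e_i\Lambda e_j)\subseteq e_{ij}\Gamma$, which is identified with $\Gamma$; thus "$\alpha_i\mapsto a_i$, $\overline{\alpha}_i\mapsto\bar a_i$" means $\alpha_i\mapsto e_{i,i+1}a_i$, $\overline{\alpha}_i\mapsto e_{i+1,i}\bar a_i$. $M_{Q_0}(\varphi)$ denotes applying $\varphi$ entrywise. *)

theory Defs
  imports
    "HOL-Computational_Algebra.Polynomial"
    "HOL-Library.Poly_Mapping"
    "Graph_Theory.Arc_Walk"
    "HOL-Algebra.QuotRing"
    "HOL-Algebra.Module"
begin

section \<open>Graded algebras and their homomorphisms\<close>

text \<open>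
  The ground ring is a type \<open>'f\<close>; it will be either a field \<open>'k\<close> or the Laurent polynomial ring
  over it. An algebra is a ring record with scalar multiplication, not assumed commutative;
  \<open>hcomp \<Gamma> d\<close> is the homogeneous component of degree \<open>d\<close>.
\<close>

record ('f, 'a) galgebra = "('f, 'a) module" +
  hcomp :: "nat \<Rightarrow> 'a set"

definition alg_hom :: "('f, 'a) galgebra \<Rightarrow> ('f, 'b) galgebra \<Rightarrow> ('a \<Rightarrow> 'b) set" where
  "alg_hom \<Gamma> \<Delta> =
    {h \<in> ring_hom \<Gamma> \<Delta>. \<forall>c. \<forall>x \<in> carrier \<Gamma>. h (c \<odot>\<^bsub>\<Gamma>\<^esub> x) = c \<odot>\<^bsub>\<Delta>\<^esub> h x}"

definition graded_alg_hom :: "('f, 'a) galgebra \<Rightarrow> ('f, 'b) galgebra \<Rightarrow> ('a \<Rightarrow> 'b) set" where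
  "graded_alg_hom \<Gamma> \<Delta> = {h \<in> alg_hom \<Gamma> \<Delta>. \<forall>d. h ` hcomp \<Gamma> d \<subseteq> hcomp \<Delta> d}"

text \<open>
  The quotient by the two-sided ideal generated by \<open>S\<close>. Ring ideals of a unital algebra are closed
  under scalars, so this is also the algebra ideal. The union defining the scalar multiple of a
  coset is a union of equal cosets. The grading is the image grading; in all uses below \<open>S\<close>
  consists of homogeneous elements.
\<close>

definition quot_galgebra :: "('f, 'a) galgebra \<Rightarrow> 'a set \<Rightarrow> ('f, 'a set) galgebra" where
  "quot_galgebra \<Gamma> S = (let I = Idl\<^bsub>\<Gamma>\<^esub> S in
    \<lparr>carrier = carrier (\<Gamma> Quot I), mult = mult (\<Gamma> Quot I), one = one (\<Gamma> Quot I),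
     zero = zero (\<Gamma> Quot I), add = add (\<Gamma> Quot I),
     smult = (\<lambda>c Y. \<Union>x\<in>Y. I +>\<^bsub>\<Gamma>\<^esub> (c \<odot>\<^bsub>\<Gamma>\<^esub> x)),
     hcomp = (\<lambda>d. (\<lambda>x. I +>\<^bsub>\<Gamma>\<^esub> x) ` hcomp \<Gamma> d)\<rparr>)"

definition quot_class :: "('f, 'a) galgebra \<Rightarrow> 'a set \<Rightarrow> 'a \<Rightarrow> 'a set" where
  "quot_class \<Gamma> S x = (Idl\<^bsub>\<Gamma>\<^esub> S) +>\<^bsub>\<Gamma>\<^esub> x"


section \<open>Free algebras and path algebras\<close>

text \<open>
  The free module on \<open>B\<close>, as finitely supported functions, with the bilinear multiplication given
  on basis elements by a partial operation (\<open>None\<close> means that the product is zero), the unit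
  element \<open>e\<close>, and the grading in which \<open>b \<in> B\<close> is homogeneous of degree \<open>dg b\<close>.
\<close>

definition basis_galgebra ::
  "'b set \<Rightarrow> ('b \<Rightarrow> 'b \<Rightarrow> 'b option) \<Rightarrow> ('b \<Rightarrow>\<^sub>0 'f::comm_ring_1) \<Rightarrow> ('b \<Rightarrow> nat)
    \<Rightarrow> ('f, 'b \<Rightarrow>\<^sub>0 'f) galgebra" where
  "basis_galgebra B p e dg =
    \<lparr>carrier = {x. Poly_Mapping.keys x \<subseteq> B},
     mult = (\<lambda>x y. \<Sum>b\<in>Poly_Mapping.keys x. \<Sum>c\<in>Poly_Mapping.keys y.
               (case p b c of None \<Rightarrow> 0
                | Some d \<Rightarrow> Poly_Mapping.single d (Poly_Mapping.lookup x b * Poly_Mapping.lookup y c))),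
     one = e, zero = 0, add = (+),
     smult = (\<lambda>c. Poly_Mapping.map ((*) c)),
     hcomp = (\<lambda>d. {x. Poly_Mapping.keys x \<subseteq> {b \<in> B. dg b = d}})\<rparr>"

definition free_galgebra :: "'x set \<Rightarrow> ('f::comm_ring_1, 'x list \<Rightarrow>\<^sub>0 'f) galgebra" where
  "free_galgebra G =
    basis_galgebra (lists G) (\<lambda>v w. Some (v @ w)) (Poly_Mapping.single [] 1) length"

text \<open>
  Quivers are directed multigraphs. A path is a triple of source, list of arrows and target, and
  paths are composed from left to right.
\<close>

fun path_comp :: "'v \<times> 'e list \<times> 'v \<Rightarrow> 'v \<times> 'e list \<times> 'v \<Rightarrow> ('v \<times> 'e list \<times> 'v) option" where
  "path_comp (u, p, v) (v', p', w) = (if v = v' then Some (u, p @ p', w) else None)"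

definition path_galgebra ::
  "('v, 'e) pre_digraph \<Rightarrow> ('f::comm_ring_1, ('v \<times> 'e list \<times> 'v) \<Rightarrow>\<^sub>0 'f) galgebra" where
  "path_galgebra Q =
    basis_galgebra {(u, p, v). pre_digraph.awalk Q u p v} path_comp
      (\<Sum>v\<in>verts Q. Poly_Mapping.single (v, [], v) 1) (\<lambda>(u, p, v). length p)"


section \<open>Matrix algebras\<close>

text \<open>Matrices indexed by a finite set \<open>J\<close>; entries outside \<open>J \<times> J\<close> are zero.\<close>

definition mat_galgebra :: "'i set \<Rightarrow> ('f, 'a) galgebra \<Rightarrow> ('f, 'i \<Rightarrow> 'i \<Rightarrow> 'a) galgebra" where
  "mat_galgebra J \<Gamma> = (let C = {M. \<forall>i j. if i \<in> J \<and> j \<in> J then M i j \<in> carrier \<Gamma> else M i j = \<zero>\<^bsub>\<Gamma>\<^esub>} in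
    \<lparr>carrier = C,
     mult = (\<lambda>M N i j. \<Oplus>\<^bsub>\<Gamma>\<^esub>l\<in>J. M i l \<otimes>\<^bsub>\<Gamma>\<^esub> N l j),
     one = (\<lambda>i j. if i \<in> J \<and> i = j then \<one>\<^bsub>\<Gamma>\<^esub> else \<zero>\<^bsub>\<Gamma>\<^esub>),
     zero = (\<lambda>i j. \<zero>\<^bsub>\<Gamma>\<^esub>),
     add = (\<lambda>M N i j. M i j \<oplus>\<^bsub>\<Gamma>\<^esub> N i j),
     smult = (\<lambda>c M i j. c \<odot>\<^bsub>\<Gamma>\<^esub> M i j),
     hcomp = (\<lambda>d. {M \<in> C. \<forall>i\<in>J. \<forall>j\<in>J. M i j \<in> hcomp \<Gamma> d})\<rparr>)"

definition mat_elem :: "('f, 'a) galgebra \<Rightarrow> 'i \<Rightarrow> 'i \<Rightarrow> 'a \<Rightarrow> 'i \<Rightarrow> 'i \<Rightarrow> 'a" where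
  "mat_elem \<Gamma> i j x = (\<lambda>k l. if k = i \<and> l = j then x else \<zero>\<^bsub>\<Gamma>\<^esub>)"

definition mat_map :: "('a \<Rightarrow> 'b) \<Rightarrow> ('i \<Rightarrow> 'i \<Rightarrow> 'a) \<Rightarrow> 'i \<Rightarrow> 'i \<Rightarrow> 'b" where
  "mat_map \<phi> M = (\<lambda>i j. \<phi> (M i j))"


section \<open>The algebras \<open>A\<close>, \<open>R\<close> and \<open>\<Lambda>\<close>\<close>

datatype agen = GenU | GenV

type_synonym 'f A_elt = "(agen list \<Rightarrow>\<^sub>0 'f) set"

definition A_alg :: "'f::comm_ring_1 \<Rightarrow> ('f, 'f A_elt) galgebra" where
  "A_alg q = quot_galgebra (free_galgebra UNIV)
    {Poly_Mapping.single [GenV, GenU] 1 - Poly_Mapping.single [GenU, GenV] q}"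

text \<open>\<open>GenA i\<close> and \<open>GenABar i\<close> stand for \<open>a\<close> and \<open>a\<close>-bar with index \<open>i\<close>.\<close>

datatype rgen = GenA nat | GenABar nat

type_synonym 'f R_elt = "(rgen list \<Rightarrow>\<^sub>0 'f) set"

definition R_gens :: "nat \<Rightarrow> rgen set" where
  "R_gens n = GenA ` {0..n} \<union> GenABar ` {0..n}"

definition R_rels :: "nat \<Rightarrow> 'f::comm_ring_1 \<Rightarrow> (rgen list \<Rightarrow>\<^sub>0 'f) set" where
  "R_rels n q = (\<Union>i\<in>{0..n}. \<Union>j\<in>{0..n}.
    {Poly_Mapping.single [GenA j, GenA i] 1 - Poly_Mapping.single [GenA i, GenA j] 1,
     Poly_Mapping.single [GenABar j, GenABar i] 1 - Poly_Mapping.single [GenABar i, GenABar j] 1,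
     Poly_Mapping.single [GenABar j, GenA i] 1 - Poly_Mapping.single [GenA i, GenABar j] q,
     Poly_Mapping.single [GenA 0, GenABar 0] 1 - Poly_Mapping.single [GenA i, GenABar i] 1})"

definition R_alg :: "nat \<Rightarrow> 'f::comm_ring_1 \<Rightarrow> ('f, 'f R_elt) galgebra" where
  "R_alg n q = quot_galgebra (free_galgebra (R_gens n)) (R_rels n q)"

definition R_gen :: "nat \<Rightarrow> 'f::comm_ring_1 \<Rightarrow> rgen \<Rightarrow> 'f R_elt" where
  "R_gen n q x = quot_class (free_galgebra (R_gens n)) (R_rels n q) (Poly_Mapping.single [x] 1)"

text \<open>
  \<open>Alpha i : i \<rightarrow> i+1\<close> and \<open>AlphaBar i : i+1 \<rightarrow> i\<close>, with \<open>i+1\<close> taken modulo \<open>n+1\<close>.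
\<close>

datatype arrow = Alpha nat | AlphaBar nat

definition cyc_succ :: "nat \<Rightarrow> nat \<Rightarrow> nat" where
  "cyc_succ n i = (i + 1) mod (n + 1)"

fun arrow_tail :: "nat \<Rightarrow> arrow \<Rightarrow> nat" where
  "arrow_tail n (Alpha i) = i"
| "arrow_tail n (AlphaBar i) = cyc_succ n i"

fun arrow_head :: "nat \<Rightarrow> arrow \<Rightarrow> nat" where
  "arrow_head n (Alpha i) = cyc_succ n i"
| "arrow_head n (AlphaBar i) = i"

definition quiver :: "nat \<Rightarrow> (nat, arrow) pre_digraph" where
  "quiver n = \<lparr>verts = {0..n}, arcs = Alpha ` {0..n} \<union> AlphaBar ` {0..n},
     tail = arrow_tail n, head = arrow_head n\<rparr>"

type_synonym 'f Lam_elt = "((nat \<times> arrow list \<times> nat) \<Rightarrow>\<^sub>0 'f) set"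

definition Lam_rels :: "nat \<Rightarrow> 'f::comm_ring_1 \<Rightarrow> ((nat \<times> arrow list \<times> nat) \<Rightarrow>\<^sub>0 'f) set" where
  "Lam_rels n q = (\<lambda>i. let j = cyc_succ n i in
     Poly_Mapping.single (j, [AlphaBar i, Alpha i], j) 1
     - Poly_Mapping.single (j, [Alpha j, AlphaBar j], j) q) ` {0..n}"

definition Lam_alg :: "nat \<Rightarrow> 'f::comm_ring_1 \<Rightarrow> ('f, 'f Lam_elt) galgebra" where
  "Lam_alg n q = quot_galgebra (path_galgebra (quiver n)) (Lam_rels n q)"

definition Lam_vertex :: "nat \<Rightarrow> 'f::comm_ring_1 \<Rightarrow> nat \<Rightarrow> 'f Lam_elt" where
  "Lam_vertex n q i =
    quot_class (path_galgebra (quiver n)) (Lam_rels n q) (Poly_Mapping.single (i, [], i) 1)"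

definition Lam_arrow :: "nat \<Rightarrow> 'f::comm_ring_1 \<Rightarrow> arrow \<Rightarrow> 'f Lam_elt" where
  "Lam_arrow n q x =
    quot_class (path_galgebra (quiver n)) (Lam_rels n q)
      (Poly_Mapping.single (arrow_tail n x, [x], arrow_head n x) 1)"


section \<open>Graded representations\<close>

definition graded_rep ::
  "nat \<Rightarrow> 'f::comm_ring_1 \<Rightarrow> ('f, 'a) galgebra \<Rightarrow> ('f Lam_elt \<Rightarrow> nat \<Rightarrow> nat \<Rightarrow> 'a) \<Rightarrow> bool" where
  "graded_rep n q \<Gamma> \<iota> \<longleftrightarrow>
    \<iota> \<in> graded_alg_hom (Lam_alg n q) (mat_galgebra {0..n} \<Gamma>) \<and>
    (\<forall>i\<in>{0..n}. \<iota> (Lam_vertex n q i) = mat_elem \<Gamma> i i \<one>\<^bsub>\<Gamma>\<^esub>) \<and>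
    (\<forall>x\<in>arcs (quiver n). \<iota> (Lam_arrow n q x) \<noteq> \<zero>\<^bsub>mat_galgebra {0..n} \<Gamma>\<^esub>)"

text \<open>The graded \<open>R\<close>-representation with \<open>\<alpha>\<^sub>i \<mapsto> a\<^sub>i\<close>, and likewise for the barred generators.\<close>

definition is_iota_R ::
  "nat \<Rightarrow> 'f::comm_ring_1 \<Rightarrow> ('f Lam_elt \<Rightarrow> nat \<Rightarrow> nat \<Rightarrow> 'f R_elt) \<Rightarrow> bool" where
  "is_iota_R n q \<iota> \<longleftrightarrow> graded_rep n q (R_alg n q) \<iota> \<and>
    (\<forall>i\<in>{0..n}.
      \<iota> (Lam_arrow n q (Alpha i)) =
        mat_elem (R_alg n q) i (cyc_succ n i) (R_gen n q (GenA i)) \<and>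
      \<iota> (Lam_arrow n q (AlphaBar i)) =
        mat_elem (R_alg n q) (cyc_succ n i) i (R_gen n q (GenABar i)))"

text \<open>
  Algebra homomorphisms are only determined on the carrier, hence \<open>extensional\<close> in the uniqueness
  statement. The homomorphism \<open>\<phi>\<close> is not required to be graded.
\<close>

definition universal_for_A ::
  "nat \<Rightarrow> 'f::comm_ring_1 \<Rightarrow> ('f Lam_elt \<Rightarrow> nat \<Rightarrow> nat \<Rightarrow> 'f R_elt) \<Rightarrow> bool" where
  "universal_for_A n q \<iota>R \<longleftrightarrow>
    (\<forall>\<iota>A. graded_rep n q (A_alg q) \<iota>A \<longrightarrow>
      (\<exists>!\<phi>. \<phi> \<in> alg_hom (R_alg n q) (A_alg q) \<and> \<phi> \<in> extensional (carrier (R_alg n q)) \<and>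
        (\<forall>x\<in>carrier (Lam_alg n q). mat_map \<phi> (\<iota>R x) = \<iota>A x)))"


section \<open>Laurent polynomials and specialisation\<close>

text \<open>Laurent polynomials are the group algebra of \<open>\<int>\<close>; the product is convolution.\<close>

type_synonym 'k laurent = "int \<Rightarrow>\<^sub>0 'k"

definition qvar :: "'k::field laurent" where
  "qvar = Poly_Mapping.single 1 1"

definition laurent_eval :: "'k::field \<Rightarrow> 'k laurent \<Rightarrow> 'k" where
  "laurent_eval t c = (\<Sum>m\<in>Poly_Mapping.keys c. Poly_Mapping.lookup c m * t powi m)"

text \<open>
  Maps \<open>\<Gamma> \<rightarrow> \<Delta>\<close> exhibiting \<open>\<Delta>\<close> as the specialisation of \<open>\<Gamma>\<close> at \<open>q = t\<close>, i.e. as the base change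
  \<open>\<Gamma> / (q - t)\<Gamma>\<close> along evaluation at \<open>t\<close>.
\<close>

definition specialisation ::
  "'k::field \<Rightarrow> ('k laurent, 'a) galgebra \<Rightarrow> ('k, 'b) galgebra \<Rightarrow> ('a \<Rightarrow> 'b) set" where
  "specialisation t \<Gamma> \<Delta> = {s \<in> ring_hom \<Gamma> \<Delta>.
    (\<forall>c. \<forall>x\<in>carrier \<Gamma>. s (c \<odot>\<^bsub>\<Gamma>\<^esub> x) = laurent_eval t c \<odot>\<^bsub>\<Delta>\<^esub> s x) \<and>
    s ` carrier \<Gamma> = carrier \<Delta> \<and>
    (\<forall>d. s ` hcomp \<Gamma> d = hcomp \<Delta> d) \<and>
    a_kernel \<Gamma> \<Delta> s = (\<lambda>x. (qvar - Poly_Mapping.single 0 t) \<odot>\<^bsub>\<Gamma>\<^esub> x) ` carrier \<Gamma>}"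

text \<open>
  \<open>\<iota>'\<close> is the specialisation of \<open>\<iota>\<close> at \<open>q = t\<close>: it is induced by \<open>\<iota>\<close> via the specialisation maps
  of \<open>\<Lambda>\<close> and \<open>R\<close> sending generators to the generators of the same name.
\<close>

definition specialises_to ::
  "nat \<Rightarrow> 'k::field \<Rightarrow> ('k laurent Lam_elt \<Rightarrow> nat \<Rightarrow> nat \<Rightarrow> 'k laurent R_elt)
    \<Rightarrow> ('k Lam_elt \<Rightarrow> nat \<Rightarrow> nat \<Rightarrow> 'k R_elt) \<Rightarrow> bool" where
  "specialises_to n t \<iota> \<iota>' \<longleftrightarrow>
    (\<exists>s \<in> specialisation t (Lam_alg n qvar) (Lam_alg n t).
     \<exists>r \<in> specialisation t (R_alg n qvar) (R_alg n t).
      (\<forall>i\<in>{0..n}. s (Lam_vertex n qvar i) = Lam_vertex n t i) \<and>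
      (\<forall>x\<in>arcs (quiver n). s (Lam_arrow n qvar x) = Lam_arrow n t x) \<and>
      (\<forall>x\<in>R_gens n. r (R_gen n qvar x) = R_gen n t x) \<and>
      (\<forall>x\<in>carrier (Lam_alg n qvar). \<iota>' (s x) = mat_map r (\<iota> x)))"

end

theory Submission
  imports Defs
begin

text \<open>
  The representation over \<open>R\<close> sends a path from \<open>i\<close> to \<open>j\<close> to the matrix unit at \<open>(i, j)\<close> times the word
  in the generators of \<open>R\<close> spelled by its arrows. This is multiplicative since paths and matrix units
  compose in the same way (\<open>path_entry_mult\<close>). It respects the relations of \<open>\<Lambda>\<close> because \<open>a\<^sub>i\<close>-bar
  times \<open>a\<^sub>i\<close> equals \<open>q a\<^sub>i a\<^sub>i\<close>-bar in \<open>R\<close>, and \<open>a\<^sub>i a\<^sub>i\<close>-bar is the same element for all \<open>i\<close>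
  (\<open>R_arrow_relation\<close>). No arrow becomes zero as the relations of \<open>R\<close> are quadratic
  (\<open>additive_kills_quadratic_ideal\<close>).

  All algebras involved are quotients of algebras with a basis whose structure constants do not
  involve \<open>q\<close>; only the relations do. Specialisation at \<open>t\<close> therefore is evaluation of coefficients. Its
  kernel on the free level consists of the multiples of \<open>q - t\<close>, and this passes to the quotients since
  the ideal of relations over \<open>K\<close> is mapped onto the ideal of relations over the field
  (\<open>specialisation_quotient\<close>).

  For universality let \<open>x\<^sub>i = a\<^sub>i u + b\<^sub>i v\<close> and \<open>y\<^sub>i = c\<^sub>i u + d\<^sub>i v\<close> be the linear forms to which a graded
  representation over \<open>A\<close> sends the arrows. The relations of \<open>\<Lambda>\<close> say that \<open>y\<^sub>i x\<^sub>i = q x\<^sub>j y\<^sub>j\<close> for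
  \<open>j = i + 1\<close>. The coefficients at \<open>u\<^sup>2\<close> and \<open>v\<^sup>2\<close> give \<open>a\<^sub>i c\<^sub>i = q a\<^sub>j c\<^sub>j\<close> and \<open>b\<^sub>i d\<^sub>i = q b\<^sub>j d\<^sub>j\<close>, and
  following these around the cycle all of these products vanish, because \<open>q\<close> is not a root of unity. So
  each pair \<open>(x\<^sub>i, y\<^sub>i)\<close> consists of multiples of \<open>(u, v)\<close> or of \<open>(v, u)\<close>. The coefficient at \<open>u v\<close>
  picks up a factor \<open>q\<^sup>2\<close> at each pair of the second kind, so, again around the cycle, there is no such
  pair, and \<open>a\<^sub>i d\<^sub>i\<close> does not depend on \<open>i\<close> (\<open>cyclic_system_solution\<close>). These are exactly the
  conditions under which sending the generators of \<open>R\<close> to the multiples \<open>a\<^sub>i u\<close> and \<open>d\<^sub>i v\<close> defines a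
  homomorphism to \<open>A\<close> (\<open>substitution_alg_hom\<close>). It is unique since \<open>R\<close> is generated by the entries of
  the images of the arrows. The argument works over any integral domain in which \<open>q\<close> is nonzero and not
  a root of unity; the Laurent polynomials with their indeterminate are one instance, and the field
  with suitable \<open>q\<close> is the other.
\<close>

section \<open>Additive maps on finitely supported functions\<close>

text \<open>
  Instead of a bilinear or linear structure, the maps below are only required to be additive in each
  coefficient: this also covers coefficientwise evaluation of Laurent polynomials, which is not
  linear over a single ground ring.
\<close>

definition lin_ext :: "('b \<Rightarrow> 'f::zero \<Rightarrow> 'm::comm_monoid_add) \<Rightarrow> ('b \<Rightarrow>\<^sub>0 'f) \<Rightarrow> 'm" where
  "lin_ext G x = (\<Sum>b\<in>Poly_Mapping.keys x. G b (Poly_Mapping.lookup x b))"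

lemma lin_ext_superset:
  assumes "\<And>b. G b 0 = 0" "finite K" "Poly_Mapping.keys x \<subseteq> K"
  shows "lin_ext G x = (\<Sum>b\<in>K. G b (Poly_Mapping.lookup x b))"
  unfolding lin_ext_def
  by (rule sum.mono_neutral_left) (use assms in \<open>auto simp: in_keys_iff\<close>)

lemma additive_lin_ext:
  assumes "\<And>b. additive (G b)"
  shows "additive (lin_ext G)"
proof
  fix x y :: "'a \<Rightarrow>\<^sub>0 'b"
  let ?K = "Poly_Mapping.keys x \<union> Poly_Mapping.keys y"
  have G0: "\<And>b. G b 0 = 0" by (rule additive.zero[OF assms])
  have "Poly_Mapping.keys (x + y) \<subseteq> ?K" by (rule Poly_Mapping.keys_add)
  then show "lin_ext G (x + y) = lin_ext G x + lin_ext G y"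
    by (simp add: lin_ext_superset[of G ?K] G0 lookup_add additive.add[OF assms] sum.distrib)
qed

lemma lin_ext_single: "G b 0 = 0 \<Longrightarrow> lin_ext G (Poly_Mapping.single b c) = G b c"
  by (cases "c = 0") (simp_all add: lin_ext_def)

lemma poly_mapping_sum_singles:
  "(x :: 'b \<Rightarrow>\<^sub>0 'f::comm_monoid_add) = (\<Sum>b\<in>Poly_Mapping.keys x. Poly_Mapping.single b (Poly_Mapping.lookup x b))"
  by (rule poly_mapping_eqI)
    (simp add: lookup_sum lookup_single when_def in_keys_iff sum.delta)

lemma keys_subset_induct [consumes 1, case_names zero single add]:
  fixes x :: "'b \<Rightarrow>\<^sub>0 'f::comm_monoid_add"
  assumes "Poly_Mapping.keys x \<subseteq> B"
    and "P 0" and "\<And>b c. b \<in> B \<Longrightarrow> P (Poly_Mapping.single b c)"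
    and add: "\<And>x y. Poly_Mapping.keys x \<subseteq> B \<Longrightarrow> Poly_Mapping.keys y \<subseteq> B \<Longrightarrow> P x \<Longrightarrow> P y \<Longrightarrow> P (x + y)"
  shows "P x"
proof -
  have "P (\<Sum>b\<in>K. Poly_Mapping.single b (Poly_Mapping.lookup x b)) \<and>
      Poly_Mapping.keys (\<Sum>b\<in>K. Poly_Mapping.single b (Poly_Mapping.lookup x b)) \<subseteq> B"
    if "finite K" "K \<subseteq> B" for K
    using that
  proof (induction K)
    case (insert b K)
    let ?s = "\<lambda>b. Poly_Mapping.single b (Poly_Mapping.lookup x b)"
    have "Poly_Mapping.keys (?s b) \<subseteq> B" using insert by simp
    moreover have "Poly_Mapping.keys (?s b + sum ?s K) \<subseteq> B"
      using Poly_Mapping.keys_add[of "?s b" "sum ?s K"] calculation insert by blast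
    ultimately show ?case using insert by (simp add: add assms(3))
  qed (simp add: assms(2))
  from this[of "Poly_Mapping.keys x"] show ?thesis
    using assms(1) poly_mapping_sum_singles[of x] by simp
qed

text \<open>
  Most identities between products, substitutions and evaluations are proved by this principle: both
  sides are additive, so it suffices to compare them on monomials.
\<close>

lemma additive_eq_on:
  assumes "additive f" "additive g" "Poly_Mapping.keys x \<subseteq> B"
    and "\<And>b c. b \<in> B \<Longrightarrow> f (Poly_Mapping.single b c) = g (Poly_Mapping.single b c)"
  shows "f x = g x"
  using assms(3)
  by (induction rule: keys_subset_induct)
    (simp_all add: assms additive.zero[OF assms(1)] additive.zero[OF assms(2)]
      additive.add[OF assms(1)] additive.add[OF assms(2)])

lemma additive_sum:
  assumes "\<And>k. k \<in> K \<Longrightarrow> additive (f k)"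
  shows "additive (\<lambda>x. \<Sum>k\<in>K. f k x)"
  by standard (simp add: additive.add[OF assms] sum.distrib)

section \<open>Algebras with a multiplicative basis\<close>

definition basis_term ::
  "('b \<Rightarrow> 'b \<Rightarrow> 'b option) \<Rightarrow> 'b \<Rightarrow> 'b \<Rightarrow> 'f::comm_ring_1 \<Rightarrow> ('b \<Rightarrow>\<^sub>0 'f)" where
  "basis_term p b c r = (case p b c of None \<Rightarrow> 0 | Some d \<Rightarrow> Poly_Mapping.single d r)"

text \<open>
  The product of \<^const>\<open>basis_galgebra\<close>, with its nested sums written as one linear extension for
  each factor, so that it inherits additivity in each of them.
\<close>

definition basis_mult ::
  "('b \<Rightarrow> 'b \<Rightarrow> 'b option) \<Rightarrow> ('b \<Rightarrow>\<^sub>0 'f::comm_ring_1) \<Rightarrow> ('b \<Rightarrow>\<^sub>0 'f) \<Rightarrow> ('b \<Rightarrow>\<^sub>0 'f)" where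
  "basis_mult p x y = lin_ext (\<lambda>b r. lin_ext (\<lambda>c s. basis_term p b c (r * s)) y) x"

lemma additive_basis_term: "additive (basis_term p b c)"
  by standard (simp add: basis_term_def single_add split: option.split)

lemma basis_term_0 [simp]: "basis_term p b c 0 = 0"
  by (rule additive.zero[OF additive_basis_term])

lemma additive_basis_mult_right: "additive (basis_mult p x)"
  unfolding basis_mult_def lin_ext_def[of _ x]
  by (intro additive_sum additive_lin_ext)
    (simp add: additive_def distrib_left additive.add[OF additive_basis_term])

lemma additive_basis_mult_left: "additive (\<lambda>x. basis_mult p x y)"
  unfolding basis_mult_def
  by (intro additive_lin_ext)
    (simp add: additive_def distrib_right additive.add[OF additive_basis_term] lin_ext_def sum.distrib)

lemma basis_mult_single:
  "basis_mult p (Poly_Mapping.single b r) (Poly_Mapping.single c s) = basis_term p b c (r * s)"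
  by (simp add: basis_mult_def lin_ext_single lin_ext_def[where x = 0])

lemmas basis_mult_simps =
  additive.zero[OF additive_basis_mult_left] additive.zero[OF additive_basis_mult_right]
  additive.add[OF additive_basis_mult_left] additive.add[OF additive_basis_mult_right]
  additive.diff[OF additive_basis_mult_left] additive.diff[OF additive_basis_mult_right]
  basis_mult_single

abbreviation coeff_map :: "('f \<Rightarrow> 'g) \<Rightarrow> ('b \<Rightarrow>\<^sub>0 'f::zero) \<Rightarrow> ('b \<Rightarrow>\<^sub>0 'g::zero)" where
  "coeff_map \<equiv> Poly_Mapping.map"

lemma lookup_coeff_map: "f 0 = 0 \<Longrightarrow> Poly_Mapping.lookup (coeff_map f x) b = f (Poly_Mapping.lookup x b)"
  by (simp add: Poly_Mapping.map.rep_eq when_def)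

lemma keys_coeff_map: "Poly_Mapping.keys (coeff_map f x) \<subseteq> Poly_Mapping.keys x"
  by (auto simp: in_keys_iff Poly_Mapping.map.rep_eq when_def)

lemma additive_coeff_map: "additive f \<Longrightarrow> additive (coeff_map f)"
  by standard (rule poly_mapping_eqI,
    simp add: lookup_coeff_map lookup_add additive.add additive.zero)

lemma additive_times: "additive ((*) (c :: 'f::comm_ring_1))"
  by standard (simp add: distrib_left)

lemmas additive_scale = additive_coeff_map[OF additive_times]

lemma basis_galgebra_simps:
  "carrier (basis_galgebra B p e dg) = {x. Poly_Mapping.keys x \<subseteq> B}"
  "mult (basis_galgebra B p e dg) = basis_mult p"
  "one (basis_galgebra B p e dg) = e"
  "zero (basis_galgebra B p e dg) = 0"
  "add (basis_galgebra B p e dg) = (+)"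
  "smult (basis_galgebra B p e dg) c = coeff_map ((*) c)"
  "hcomp (basis_galgebra B p e dg) d = {x. Poly_Mapping.keys x \<subseteq> {b \<in> B. dg b = d}}"
  by (simp_all add: basis_galgebra_def basis_mult_def lin_ext_def basis_term_def fun_eq_iff)

text \<open>
  Associativity is required for the partial product of basis elements, where the chains of
  \<^const>\<open>Option.bind\<close> express that a vanishing partial product annihilates the whole product on both
  sides. The unit need not be a basis element: for a path algebra it is a sum of trivial paths.
\<close>

locale basis_algebra =
  fixes B :: "'b set" and p :: "'b \<Rightarrow> 'b \<Rightarrow> 'b option" and e :: "'b \<Rightarrow>\<^sub>0 'f::comm_ring_1"
  assumes product_closed: "\<lbrakk>b \<in> B; c \<in> B; p b c = Some d\<rbrakk> \<Longrightarrow> d \<in> B"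
    and product_assoc: "\<lbrakk>b \<in> B; c \<in> B; d \<in> B\<rbrakk> \<Longrightarrow>
      Option.bind (p b c) (\<lambda>x. p x d) = Option.bind (p c d) (p b)"
    and keys_unit: "Poly_Mapping.keys e \<subseteq> B"
    and unit_left: "b \<in> B \<Longrightarrow> basis_mult p e (Poly_Mapping.single b r) = Poly_Mapping.single b r"
    and unit_right: "b \<in> B \<Longrightarrow> basis_mult p (Poly_Mapping.single b r) e = Poly_Mapping.single b r"
begin

lemma keys_basis_mult:
  assumes "Poly_Mapping.keys x \<subseteq> B" "Poly_Mapping.keys y \<subseteq> B"
  shows "Poly_Mapping.keys (basis_mult p x y) \<subseteq> B"
  using assms
proof (induction rule: keys_subset_induct)
  case (single b r)
  from single(2,1) show ?case
  proof (induction rule: keys_subset_induct)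
    case (single c s)
    then show ?case
      using product_closed[of b c] by (auto simp: basis_mult_simps basis_term_def split: option.split)
  next
    case (add x y)
    then show ?case
      using Poly_Mapping.keys_add[of "basis_mult p (Poly_Mapping.single b r) x"
        "basis_mult p (Poly_Mapping.single b r) y"]
      unfolding basis_mult_simps by blast
  qed (simp add: basis_mult_simps)
next
  case (add x x')
  then show ?case
    using Poly_Mapping.keys_add[of "basis_mult p x y" "basis_mult p x' y"]
    unfolding basis_mult_simps by blast
qed (simp add: basis_mult_simps)

lemma basis_mult_assoc:
  assumes "Poly_Mapping.keys x \<subseteq> B" "Poly_Mapping.keys y \<subseteq> B" "Poly_Mapping.keys z \<subseteq> B"
  shows "basis_mult p (basis_mult p x y) z = basis_mult p x (basis_mult p y z)"
proof (rule additive_eq_on[OF _ _ assms(1)])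
  fix b r assume b: "b \<in> B"
  show "basis_mult p (basis_mult p (Poly_Mapping.single b r) y) z =
      basis_mult p (Poly_Mapping.single b r) (basis_mult p y z)"
  proof (rule additive_eq_on[OF _ _ assms(2)])
    fix c s assume c: "c \<in> B"
    show "basis_mult p (basis_mult p (Poly_Mapping.single b r) (Poly_Mapping.single c s)) z =
        basis_mult p (Poly_Mapping.single b r) (basis_mult p (Poly_Mapping.single c s) z)"
    proof (rule additive_eq_on[OF _ _ assms(3)])
      fix d t assume "d \<in> B"
      with product_assoc[OF b c this]
      show "basis_mult p (basis_mult p (Poly_Mapping.single b r) (Poly_Mapping.single c s)) (Poly_Mapping.single d t) =
        basis_mult p (Poly_Mapping.single b r) (basis_mult p (Poly_Mapping.single c s) (Poly_Mapping.single d t))"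
        by (cases "p b c"; cases "p c d")
          (simp_all add: basis_mult_simps basis_term_def mult.assoc split: option.split)
    qed (simp_all add: additive_def basis_mult_simps)
  qed (simp_all add: additive_def basis_mult_simps)
qed (simp_all add: additive_def basis_mult_simps)

lemma basis_mult_unit:
  assumes "Poly_Mapping.keys x \<subseteq> B"
  shows "basis_mult p e x = x" "basis_mult p x e = x"
  using assms
  by (rule additive_eq_on[where g = "\<lambda>x. x", rotated 2];
      simp add: additive_def basis_mult_simps unit_left unit_right)+

end

lemma keys_add_subset:
  "Poly_Mapping.keys x \<subseteq> B \<Longrightarrow> Poly_Mapping.keys y \<subseteq> B \<Longrightarrow> Poly_Mapping.keys (x + y) \<subseteq> B"
  using Poly_Mapping.keys_add[of x y] by blast

lemma keys_uminus [simp]: "Poly_Mapping.keys (- x) = Poly_Mapping.keys (x :: 'b \<Rightarrow>\<^sub>0 'f::ab_group_add)"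
  by (simp add: set_eq_iff in_keys_iff)

lemma keys_diff_subset:
  fixes x y :: "'b \<Rightarrow>\<^sub>0 'f::ab_group_add"
  shows "Poly_Mapping.keys x \<subseteq> B \<Longrightarrow> Poly_Mapping.keys y \<subseteq> B \<Longrightarrow> Poly_Mapping.keys (x - y) \<subseteq> B"
  using keys_add_subset[of x B "- y"] by (simp add: keys_uminus)

lemma scale_single: "coeff_map ((*) (c :: 'f::comm_ring_1)) (Poly_Mapping.single b d) = Poly_Mapping.single b (c * d)"
  by (rule poly_mapping_eqI) (simp add: lookup_coeff_map lookup_single when_def)

lemma scale_basis_mult:
  "coeff_map ((*) c) (basis_mult p x y) = basis_mult p (coeff_map ((*) c) x) y"
  "coeff_map ((*) c) (basis_mult p x y) = basis_mult p x (coeff_map ((*) c) y)"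
proof -
  note s = additive.add[OF additive_scale]
  have t: "coeff_map ((*) c) (basis_term p b d r) = basis_term p b d (c * r)" for b d r
    by (simp add: basis_term_def scale_single additive.zero[OF additive_scale] split: option.split)
  show "coeff_map ((*) c) (basis_mult p x y) = basis_mult p (coeff_map ((*) c) x) y"
  proof (rule additive_eq_on[where x = x and B = UNIV])
    fix b r
    show "coeff_map ((*) c) (basis_mult p (Poly_Mapping.single b r) y) = basis_mult p (coeff_map ((*) c) (Poly_Mapping.single b r)) y"
      by (rule additive_eq_on[where x = y and B = UNIV])
        (simp_all add: additive_def basis_mult_simps s scale_single t mult.assoc mult.left_commute)
  qed (simp_all add: additive_def basis_mult_simps s)
  show "coeff_map ((*) c) (basis_mult p x y) = basis_mult p x (coeff_map ((*) c) y)"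
  proof (rule additive_eq_on[where x = x and B = UNIV])
    fix b r
    show "coeff_map ((*) c) (basis_mult p (Poly_Mapping.single b r) y) = basis_mult p (Poly_Mapping.single b r) (coeff_map ((*) c) y)"
      by (rule additive_eq_on[where x = y and B = UNIV])
        (simp_all add: additive_def basis_mult_simps s scale_single t mult.assoc mult.left_commute)
  qed (simp_all add: additive_def basis_mult_simps s)
qed

text \<open>
  An associative unital algebra over a commutative ring. Compatibility of scalars with both sides
  of the product makes every two-sided ring ideal stable under scalars.
\<close>

locale ground_algebra = ring \<Gamma> for \<Gamma> :: "('f::comm_ring_1, 'a) galgebra" (structure) +
  assumes smult_closed [intro, simp]: "x \<in> carrier \<Gamma> \<Longrightarrow> c \<odot> x \<in> carrier \<Gamma>"
    and smult_add: "\<lbrakk>x \<in> carrier \<Gamma>; y \<in> carrier \<Gamma>\<rbrakk> \<Longrightarrow> c \<odot> (x \<oplus> y) = c \<odot> x \<oplus> c \<odot> y"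
    and smult_mult_left: "\<lbrakk>x \<in> carrier \<Gamma>; y \<in> carrier \<Gamma>\<rbrakk> \<Longrightarrow> c \<odot> (x \<otimes> y) = (c \<odot> x) \<otimes> y"
    and smult_mult_right: "\<lbrakk>x \<in> carrier \<Gamma>; y \<in> carrier \<Gamma>\<rbrakk> \<Longrightarrow> c \<odot> (x \<otimes> y) = x \<otimes> (c \<odot> y)"
begin

lemma smult_zero [simp]: "c \<odot> \<zero> = \<zero>"
  using smult_mult_left[of \<zero> \<zero> c] by simp

end

lemma (in basis_algebra) ground_algebra: "ground_algebra (basis_galgebra B p e dg)"
proof -
  let ?G = "basis_galgebra B p e dg"
  have "ring ?G"
  proof (rule ringI)
    show "abelian_group ?G"
    proof (rule abelian_groupI)
      fix x assume "x \<in> carrier ?G"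
      then have "- x \<in> carrier ?G"
        by (auto simp: basis_galgebra_simps in_keys_iff)
      then show "\<exists>y\<in>carrier ?G. y \<oplus>\<^bsub>?G\<^esub> x = \<zero>\<^bsub>?G\<^esub>"
        by (intro bexI[of _ "- x"]) (simp_all add: basis_galgebra_simps)
    qed (simp_all add: basis_galgebra_simps keys_add_subset add_ac)
    show "Group.monoid ?G"
      by (rule monoidI)
        (simp_all add: basis_galgebra_simps keys_basis_mult basis_mult_assoc basis_mult_unit keys_unit)
  qed (simp_all add: basis_galgebra_simps basis_mult_simps)
  moreover have "ground_algebra_axioms ?G"
    by standard (simp_all add: basis_galgebra_simps additive.add[OF additive_scale]
        flip: scale_basis_mult, meson keys_coeff_map order_trans)
  ultimately show ?thesis by (rule ground_algebra.intro)
qed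

section \<open>Quotients by relations\<close>

locale presented_algebra = ground_algebra \<Gamma> for \<Gamma> :: "('f::comm_ring_1, 'a) galgebra" (structure) +
  fixes S :: "'a set"
  assumes relations_closed: "S \<subseteq> carrier \<Gamma>"
begin

abbreviation quot where "quot \<equiv> quot_galgebra \<Gamma> S"
abbreviation cls where "cls \<equiv> quot_class \<Gamma> S"

lemma ideal_relations: "ideal (Idl S) \<Gamma>"
  by (rule genideal_ideal[OF relations_closed])

sublocale I: ideal "Idl S" \<Gamma>
  by (rule ideal_relations)

lemma ideal_smult: "x \<in> Idl S \<Longrightarrow> c \<odot> x \<in> Idl S"
  using smult_mult_left[of \<one> x c] I.Icarr I.I_l_closed by auto

lemma cls_eq_iff:
  assumes "x \<in> carrier \<Gamma>" "y \<in> carrier \<Gamma>"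
  shows "cls x = cls y \<longleftrightarrow> x \<ominus> y \<in> Idl S"
proof
  assume "cls x = cls y"
  then have "x \<in> Idl S +> y"
    using I.a_rcos_self[OF assms(1)] by (simp add: quot_class_def)
  then show "x \<ominus> y \<in> Idl S"
    using I.a_rcos_module[OF assms(2,1)] by (simp add: a_minus_def)
next
  assume "x \<ominus> y \<in> Idl S"
  then have "x \<in> Idl S +> y"
    using I.a_rcos_module[OF assms(2,1)] by (simp add: a_minus_def)
  then show "cls x = cls y"
    unfolding quot_class_def using assms by (metis I.a_repr_independence')
qed

lemma cls_self: "x \<in> carrier \<Gamma> \<Longrightarrow> x \<in> cls x"
  unfolding quot_class_def by (rule I.a_rcos_self)

lemma in_cls_iff: "x \<in> carrier \<Gamma> \<Longrightarrow> y \<in> cls x \<longleftrightarrow> y \<in> carrier \<Gamma> \<and> cls y = cls x"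
  unfolding quot_class_def
  using I.a_rcos_self I.a_repr_independence' I.a_elemrcos_carrier by blast

lemma quot_simps:
  shows carrier_quot: "carrier quot = cls ` carrier \<Gamma>"
    and one_quot: "\<one>\<^bsub>quot\<^esub> = cls \<one>"
    and zero_quot: "\<zero>\<^bsub>quot\<^esub> = cls \<zero>"
    and hcomp_quot: "hcomp quot d = cls ` hcomp \<Gamma> d"
    and add_quot: "\<lbrakk>x \<in> carrier \<Gamma>; y \<in> carrier \<Gamma>\<rbrakk> \<Longrightarrow> cls x \<oplus>\<^bsub>quot\<^esub> cls y = cls (x \<oplus> y)"
    and mult_quot: "\<lbrakk>x \<in> carrier \<Gamma>; y \<in> carrier \<Gamma>\<rbrakk> \<Longrightarrow> cls x \<otimes>\<^bsub>quot\<^esub> cls y = cls (x \<otimes> y)"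
  using I.a_rcos_const[OF I.zero_closed]
  by (auto simp: quot_galgebra_def quot_class_def Let_def FactRing_def A_RCOSETS_def'
      I.a_rcos_sum I.rcoset_mult_add)

lemma cls_eq_zero_iff: "x \<in> carrier \<Gamma> \<Longrightarrow> cls x = \<zero>\<^bsub>quot\<^esub> \<longleftrightarrow> x \<in> Idl S"
  by (simp add: zero_quot cls_eq_iff a_minus_def)

lemma smult_quot:
  assumes "x \<in> carrier \<Gamma>"
  shows "c \<odot>\<^bsub>quot\<^esub> cls x = cls (c \<odot> x)"
proof -
  have "cls (c \<odot> y) = cls (c \<odot> x)" if "y \<in> cls x" for y
  proof -
    have y: "y \<in> carrier \<Gamma>" "y \<ominus> x \<in> Idl S"
      using that assms by (auto simp: in_cls_iff cls_eq_iff)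
    have "c \<odot> \<ominus> x = \<ominus> (c \<odot> x)"
      using assms smult_add[of "\<ominus> x" x c] by (intro minus_equality[symmetric]) (simp_all add: l_neg)
    then have "c \<odot> (y \<ominus> x) = c \<odot> y \<ominus> c \<odot> x"
      using assms y by (simp add: a_minus_def smult_add)
    then show ?thesis
      using ideal_smult[OF y(2), of c] y assms by (simp add: cls_eq_iff)
  qed
  then have "(\<Union>y\<in>cls x. cls (c \<odot> y)) = cls (c \<odot> x)"
    using cls_self[OF assms] by blast
  then show ?thesis
    by (simp add: quot_galgebra_def quot_class_def Let_def)
qed

lemma ring_quot: "ring quot"
proof (rule ringI)
  show "abelian_group quot"
  proof (rule abelian_groupI)
    fix X assume "X \<in> carrier quot"
    then obtain x where x: "x \<in> carrier \<Gamma>" "X = cls x" by (auto simp: carrier_quot)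
    then show "\<exists>Y\<in>carrier quot. Y \<oplus>\<^bsub>quot\<^esub> X = \<zero>\<^bsub>quot\<^esub>"
      by (intro bexI[of _ "cls (\<ominus> x)"]) (simp_all add: quot_simps l_neg)
  qed (auto simp: quot_simps a_ac)
  show "Group.monoid quot"
    by (rule monoidI) (auto simp: quot_simps m_assoc)
qed (auto simp: quot_simps l_distr r_distr)

sublocale Q: ground_algebra quot
proof (intro ground_algebra.intro ring_quot, unfold_locales)
  fix X Y c assume "X \<in> carrier quot" "Y \<in> carrier quot"
  then obtain x y where xy: "x \<in> carrier \<Gamma>" "y \<in> carrier \<Gamma>" "X = cls x" "Y = cls y"
    by (auto simp: carrier_quot)
  show "c \<odot>\<^bsub>quot\<^esub> (X \<oplus>\<^bsub>quot\<^esub> Y) = c \<odot>\<^bsub>quot\<^esub> X \<oplus>\<^bsub>quot\<^esub> c \<odot>\<^bsub>quot\<^esub> Y"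
    using xy by (simp add: add_quot smult_quot smult_add)
  show "c \<odot>\<^bsub>quot\<^esub> (X \<otimes>\<^bsub>quot\<^esub> Y) = c \<odot>\<^bsub>quot\<^esub> X \<otimes>\<^bsub>quot\<^esub> Y"
    using xy by (simp add: mult_quot smult_quot smult_mult_left)
  show "c \<odot>\<^bsub>quot\<^esub> (X \<otimes>\<^bsub>quot\<^esub> Y) = X \<otimes>\<^bsub>quot\<^esub> (c \<odot>\<^bsub>quot\<^esub> Y)"
    using xy by (simp add: mult_quot smult_quot smult_mult_right)
qed (auto simp: carrier_quot smult_quot)

lemma cls_closed [simp, intro]: "x \<in> carrier \<Gamma> \<Longrightarrow> cls x \<in> carrier quot"
  by (simp add: carrier_quot)

lemma cls_hom: "cls \<in> alg_hom \<Gamma> quot"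
  by (auto simp: alg_hom_def quot_simps smult_quot intro!: ring_hom_memI)

end

text \<open>
  If \<open>f\<close> is constant on a coset, then its image of that coset is a singleton, whose element is the
  value of the induced map.
\<close>

definition quot_lift :: "('a \<Rightarrow> 'c) \<Rightarrow> 'a set \<Rightarrow> 'c" where
  "quot_lift f Y = the_elem (f ` Y)"

text \<open>
  The kernel of \<open>f\<close> is an ideal that contains the relations, hence contains the ideal generated by
  them; so \<open>f\<close> does not depend on the representative of a class.
\<close>

lemma (in presented_algebra) quot_lift_cls:
  assumes \<Delta>: "ring \<Delta>" and f: "f \<in> ring_hom \<Gamma> \<Delta>" and S: "\<And>s. s \<in> S \<Longrightarrow> f s = \<zero>\<^bsub>\<Delta>\<^esub>"
    and x: "x \<in> carrier \<Gamma>"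
  shows "quot_lift f (cls x) = f x"
proof -
  interpret f: ring_hom_ring \<Gamma> \<Delta> f
    by (rule ring_hom_ringI2[OF ring_axioms \<Delta> f])
  have kernel: "a_kernel \<Gamma> \<Delta> f = {x \<in> carrier \<Gamma>. f x = \<zero>\<^bsub>\<Delta>\<^esub>}"
    by (rule a_kernel_def')
  have ker: "Idl S \<subseteq> a_kernel \<Gamma> \<Delta> f"
    by (rule genideal_minimal[OF f.kernel_is_ideal]) (use S relations_closed kernel in blast)
  have "f y = f x" if "y \<in> cls x" for y
  proof -
    from that have "\<exists>z\<in>Idl S. y = z \<oplus> x"
      unfolding quot_class_def a_r_coset_def' by auto
    then obtain z where z: "z \<in> carrier \<Gamma>" "f z = \<zero>\<^bsub>\<Delta>\<^esub>" "y = z \<oplus> x"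
      using ker kernel by blast
    then show ?thesis using x by simp
  qed
  then have "f ` cls x = {f x}" using cls_self[OF x] by blast
  then show ?thesis by (simp add: quot_lift_def)
qed

lemma (in presented_algebra) quot_lift_hom:
  assumes \<Delta>: "ring \<Delta>" and f: "f \<in> ring_hom \<Gamma> \<Delta>" and S: "\<And>s. s \<in> S \<Longrightarrow> f s = \<zero>\<^bsub>\<Delta>\<^esub>"
  shows "quot_lift f \<in> ring_hom quot \<Delta>"
proof -
  have *: "quot_lift f (cls x) = f x" if "x \<in> carrier \<Gamma>" for x
    using quot_lift_cls[OF \<Delta> f S that] .
  have hom: "quot_lift f (cls x \<otimes>\<^bsub>quot\<^esub> cls y) = quot_lift f (cls x) \<otimes>\<^bsub>\<Delta>\<^esub> quot_lift f (cls y)"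
    "quot_lift f (cls x \<oplus>\<^bsub>quot\<^esub> cls y) = quot_lift f (cls x) \<oplus>\<^bsub>\<Delta>\<^esub> quot_lift f (cls y)"
    "quot_lift f (cls x) \<in> carrier \<Delta>"
    if "x \<in> carrier \<Gamma>" "y \<in> carrier \<Gamma>" for x y
    using that ring_hom_mult[OF f] ring_hom_add[OF f] ring_hom_closed[OF f]
    by (simp_all add: * mult_quot add_quot)
  have "quot_lift f \<one>\<^bsub>quot\<^esub> = \<one>\<^bsub>\<Delta>\<^esub>"
    using ring_hom_one[OF f] by (simp add: * one_quot)
  then show ?thesis
    unfolding ring_hom_def carrier_quot using hom by blast
qed

section \<open>Matrices\<close>

lemma ring_hom_finsum:
  assumes "ring \<Gamma>" "ring \<Delta>" "h \<in> ring_hom \<Gamma> \<Delta>" "f \<in> A \<rightarrow> carrier \<Gamma>"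
  shows "h (\<Oplus>\<^bsub>\<Gamma>\<^esub>x\<in>A. f x) = (\<Oplus>\<^bsub>\<Delta>\<^esub>x\<in>A. h (f x))"
proof -
  interpret h: ring_hom_ring \<Gamma> \<Delta> h
    by (rule ring_hom_ringI2[OF assms(1-3)])
  show ?thesis using assms(4)
    by (induction A rule: infinite_finite_induct)
      (simp_all add: Pi_def h.R.finsum_insert h.S.finsum_insert h.R.finsum_infinite h.S.finsum_infinite)
qed

lemma (in abelian_monoid) finsum_swap:
  assumes "finite A" "finite B" "\<And>x y. x \<in> A \<Longrightarrow> y \<in> B \<Longrightarrow> f x y \<in> carrier G"
  shows "(\<Oplus>x\<in>A. \<Oplus>y\<in>B. f x y) = (\<Oplus>y\<in>B. \<Oplus>x\<in>A. f x y)"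
  using assms(1,3)
proof (induction A)
  case empty
  then show ?case by simp
next
  case (insert a A)
  then show ?case
    by (simp add: finsum_closed Pi_def finsum_addf cong: finsum_cong)
qed

lemma (in abelian_monoid) finsum_single:
  assumes "k \<in> A" "finite A" "\<And>l. l \<in> A \<Longrightarrow> l \<noteq> k \<Longrightarrow> f l = \<zero>" "f k \<in> carrier G"
  shows "(\<Oplus>l\<in>A. f l) = f k"
proof -
  have "(\<Oplus>l\<in>A. f l) = (\<Oplus>l\<in>A. if k = l then f k else \<zero>)"
    by (rule finsum_cong') (use assms in auto)
  then show ?thesis
    using finsum_singleton[of k A "\<lambda>_. f k"] assms by simp
qed

lemma mat_galgebra_simps:
  "carrier (mat_galgebra J \<Gamma>) =
    {M. \<forall>i j. if i \<in> J \<and> j \<in> J then M i j \<in> carrier \<Gamma> else M i j = \<zero>\<^bsub>\<Gamma>\<^esub>}"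
  "mult (mat_galgebra J \<Gamma>) = (\<lambda>M N i j. \<Oplus>\<^bsub>\<Gamma>\<^esub>l\<in>J. M i l \<otimes>\<^bsub>\<Gamma>\<^esub> N l j)"
  "one (mat_galgebra J \<Gamma>) = (\<lambda>i j. if i \<in> J \<and> i = j then \<one>\<^bsub>\<Gamma>\<^esub> else \<zero>\<^bsub>\<Gamma>\<^esub>)"
  "zero (mat_galgebra J \<Gamma>) = (\<lambda>i j. \<zero>\<^bsub>\<Gamma>\<^esub>)"
  "add (mat_galgebra J \<Gamma>) = (\<lambda>M N i j. M i j \<oplus>\<^bsub>\<Gamma>\<^esub> N i j)"
  "smult (mat_galgebra J \<Gamma>) = (\<lambda>c M i j. c \<odot>\<^bsub>\<Gamma>\<^esub> M i j)"
  "hcomp (mat_galgebra J \<Gamma>) d =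
    {M \<in> carrier (mat_galgebra J \<Gamma>). \<forall>i\<in>J. \<forall>j\<in>J. M i j \<in> hcomp \<Gamma> d}"
  by (simp_all add: mat_galgebra_def Let_def)

text \<open>
  Matrix entries are elements of a ring given by a carrier, so associativity rests on interchanging
  two finite sums there. The point of this lemma is that kernels of homomorphisms to matrix
  rings are ideals.
\<close>

lemma ring_mat_galgebra:
  fixes \<Gamma> :: "('f, 'a) galgebra"
  assumes "ring \<Gamma>" and J: "finite J"
  shows "ring (mat_galgebra J \<Gamma>)" (is "ring ?M")
proof -
  interpret ring \<Gamma> by fact
  have mem: "M \<in> carrier ?M \<longleftrightarrow>
      (\<forall>i j. M i j \<in> carrier \<Gamma>) \<and> (\<forall>i j. i \<notin> J \<or> j \<notin> J \<longrightarrow> M i j = \<zero>\<^bsub>\<Gamma>\<^esub>)" for M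
    by (simp add: mat_galgebra_simps) (metis zero_closed)
  have closed: "(\<Oplus>\<^bsub>\<Gamma>\<^esub>l\<in>J. M i l \<otimes>\<^bsub>\<Gamma>\<^esub> N l j) \<in> carrier \<Gamma>"
    if "M \<in> carrier ?M" "N \<in> carrier ?M" for M N i j
    using that by (intro finsum_closed) (auto simp: mem)
  show ?thesis
  proof (rule ringI)
    show "abelian_group ?M"
    proof (rule abelian_groupI)
      fix M assume "M \<in> carrier ?M"
      then show "\<exists>N\<in>carrier ?M. N \<oplus>\<^bsub>?M\<^esub> M = \<zero>\<^bsub>?M\<^esub>"
        by (intro bexI[of _ "\<lambda>i j. \<ominus>\<^bsub>\<Gamma>\<^esub> M i j"]) (auto simp: mem mat_galgebra_simps(4,5) l_neg)
    qed (simp_all add: mem mat_galgebra_simps(4,5) a_ac)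
    show "Group.monoid ?M"
    proof (rule monoidI)
      fix M N assume MN: "M \<in> carrier ?M" "N \<in> carrier ?M"
      have "(\<Oplus>\<^bsub>\<Gamma>\<^esub>l\<in>J. M i l \<otimes>\<^bsub>\<Gamma>\<^esub> N l j) = \<zero>\<^bsub>\<Gamma>\<^esub>" if "i \<notin> J \<or> j \<notin> J" for i j
        using MN that by (intro add.finprod_one_eqI) (auto simp: mem)
      with closed[OF MN] show "M \<otimes>\<^bsub>?M\<^esub> N \<in> carrier ?M"
        by (simp add: mem mat_galgebra_simps(2))
      fix P assume P: "P \<in> carrier ?M"
      have "(\<Oplus>\<^bsub>\<Gamma>\<^esub>m\<in>J. (\<Oplus>\<^bsub>\<Gamma>\<^esub>l\<in>J. M i l \<otimes>\<^bsub>\<Gamma>\<^esub> N l m) \<otimes>\<^bsub>\<Gamma>\<^esub> P m j)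
          = (\<Oplus>\<^bsub>\<Gamma>\<^esub>l\<in>J. M i l \<otimes>\<^bsub>\<Gamma>\<^esub> (\<Oplus>\<^bsub>\<Gamma>\<^esub>m\<in>J. N l m \<otimes>\<^bsub>\<Gamma>\<^esub> P m j))" for i j
      proof -
        have e: "M i l \<in> carrier \<Gamma>" "N i l \<in> carrier \<Gamma>" "P i l \<in> carrier \<Gamma>" for i l
          using MN P by (simp_all add: mem)
        have "(\<Oplus>\<^bsub>\<Gamma>\<^esub>m\<in>J. (\<Oplus>\<^bsub>\<Gamma>\<^esub>l\<in>J. M i l \<otimes>\<^bsub>\<Gamma>\<^esub> N l m) \<otimes>\<^bsub>\<Gamma>\<^esub> P m j)
          = (\<Oplus>\<^bsub>\<Gamma>\<^esub>m\<in>J. \<Oplus>\<^bsub>\<Gamma>\<^esub>l\<in>J. M i l \<otimes>\<^bsub>\<Gamma>\<^esub> (N l m \<otimes>\<^bsub>\<Gamma>\<^esub> P m j))"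
          by (intro finsum_cong') (auto simp: e J finsum_ldistr m_assoc intro!: finsum_closed)
        also have "\<dots> = (\<Oplus>\<^bsub>\<Gamma>\<^esub>l\<in>J. \<Oplus>\<^bsub>\<Gamma>\<^esub>m\<in>J. M i l \<otimes>\<^bsub>\<Gamma>\<^esub> (N l m \<otimes>\<^bsub>\<Gamma>\<^esub> P m j))"
          by (rule finsum_swap[OF J J]) (simp add: e)
        also have "\<dots> = (\<Oplus>\<^bsub>\<Gamma>\<^esub>l\<in>J. M i l \<otimes>\<^bsub>\<Gamma>\<^esub> (\<Oplus>\<^bsub>\<Gamma>\<^esub>m\<in>J. N l m \<otimes>\<^bsub>\<Gamma>\<^esub> P m j))"
          by (intro finsum_cong') (auto simp: e J finsum_rdistr intro!: finsum_closed)
        finally show ?thesis .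
      qed
      then show "M \<otimes>\<^bsub>?M\<^esub> N \<otimes>\<^bsub>?M\<^esub> P = M \<otimes>\<^bsub>?M\<^esub> (N \<otimes>\<^bsub>?M\<^esub> P)"
        by (simp add: mat_galgebra_simps(2))
    next
      fix M assume M: "M \<in> carrier ?M"
      have "(\<Oplus>\<^bsub>\<Gamma>\<^esub>l\<in>J. (if i \<in> J \<and> i = l then \<one>\<^bsub>\<Gamma>\<^esub> else \<zero>\<^bsub>\<Gamma>\<^esub>) \<otimes>\<^bsub>\<Gamma>\<^esub> M l j) = M i j" for i j
      proof (cases "i \<in> J")
        case True
        then show ?thesis using M J by (subst finsum_single[of i]) (auto simp: mem)
      next
        case False
        then show ?thesis using M by (subst add.finprod_one_eqI) (auto simp: mem)
      qed
      then show "\<one>\<^bsub>?M\<^esub> \<otimes>\<^bsub>?M\<^esub> M = M" by (simp add: mat_galgebra_simps(2,3))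
      have "(\<Oplus>\<^bsub>\<Gamma>\<^esub>l\<in>J. M i l \<otimes>\<^bsub>\<Gamma>\<^esub> (if l \<in> J \<and> l = j then \<one>\<^bsub>\<Gamma>\<^esub> else \<zero>\<^bsub>\<Gamma>\<^esub>)) = M i j" for i j
      proof (cases "j \<in> J")
        case True
        then show ?thesis using M J by (subst finsum_single[of j]) (auto simp: mem)
      next
        case False
        then show ?thesis using M by (subst add.finprod_one_eqI) (auto simp: mem)
      qed
      then show "M \<otimes>\<^bsub>?M\<^esub> \<one>\<^bsub>?M\<^esub> = M" by (simp add: mat_galgebra_simps(2,3))
    qed (auto simp: mem mat_galgebra_simps(3))
  next
    fix M N P assume MNP: "M \<in> carrier ?M" "N \<in> carrier ?M" "P \<in> carrier ?M"
    then have e: "M i l \<in> carrier \<Gamma>" "N i l \<in> carrier \<Gamma>" "P i l \<in> carrier \<Gamma>" for i l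
      by (simp_all add: mem)
    show "(M \<oplus>\<^bsub>?M\<^esub> N) \<otimes>\<^bsub>?M\<^esub> P = M \<otimes>\<^bsub>?M\<^esub> P \<oplus>\<^bsub>?M\<^esub> N \<otimes>\<^bsub>?M\<^esub> P"
      by (simp add: mat_galgebra_simps(2,5) e l_distr finsum_addf Pi_def)
    show "P \<otimes>\<^bsub>?M\<^esub> (M \<oplus>\<^bsub>?M\<^esub> N) = P \<otimes>\<^bsub>?M\<^esub> M \<oplus>\<^bsub>?M\<^esub> P \<otimes>\<^bsub>?M\<^esub> N"
      by (simp add: mat_galgebra_simps(2,5) e r_distr finsum_addf Pi_def)
  qed
qed

section \<open>Words and paths\<close>

abbreviation word_mult :: "('x list \<Rightarrow>\<^sub>0 'f::comm_ring_1) \<Rightarrow> ('x list \<Rightarrow>\<^sub>0 'f) \<Rightarrow> ('x list \<Rightarrow>\<^sub>0 'f)" where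
  "word_mult \<equiv> basis_mult (\<lambda>v w. Some (v @ w))"

lemma word_mult_single:
  "word_mult (Poly_Mapping.single v r) (Poly_Mapping.single w s) = Poly_Mapping.single (v @ w) (r * s)"
  by (simp add: basis_mult_single basis_term_def)

lemma basis_algebra_words:
  "basis_algebra (lists G) (\<lambda>v w. Some (v @ w)) (Poly_Mapping.single [] (1::'f::comm_ring_1))"
  by standard (auto simp: word_mult_single)

lemma free_galgebra_simps:
  "carrier (free_galgebra G) = {x. Poly_Mapping.keys x \<subseteq> lists G}"
  "mult (free_galgebra G) = basis_mult (\<lambda>v w. Some (v @ w))"
  "one (free_galgebra G) = Poly_Mapping.single [] 1"
  "zero (free_galgebra G) = 0"
  "add (free_galgebra G) = (+)"
  "smult (free_galgebra G) c = coeff_map ((*) c)"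
  "hcomp (free_galgebra G) d = {x. Poly_Mapping.keys x \<subseteq> {b \<in> lists G. length b = d}}"
  by (simp_all add: free_galgebra_def basis_galgebra_simps)

definition paths :: "nat \<Rightarrow> (nat \<times> arrow list \<times> nat) set" where
  "paths n = {(u, p, v). pre_digraph.awalk (quiver n) u p v}"

lemma cyc_succ_le [simp]: "cyc_succ n i \<le> n"
  using mod_less_divisor[of "n + 1" "i + 1"] by (simp add: cyc_succ_def del: mod_less_divisor)

lemma arrow_ends:
  assumes "x \<in> arcs (quiver n)"
  shows "arrow_tail n x \<le> n" "arrow_head n x \<le> n"
  using assms by (auto simp: quiver_def)

lemma cas_quiver:
  "pre_digraph.cas (quiver n) u [] v \<longleftrightarrow> u = v"
  "pre_digraph.cas (quiver n) u (x # p) v \<longleftrightarrow> arrow_tail n x = u \<and> pre_digraph.cas (quiver n) (arrow_head n x) p v"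
  by (simp_all add: pre_digraph.cas.simps quiver_def)

lemma mem_paths:
  "(u, [], v) \<in> paths n \<longleftrightarrow> u \<le> n \<and> u = v"
  "(u, x # p, v) \<in> paths n \<longleftrightarrow> x \<in> arcs (quiver n) \<and> arrow_tail n x = u \<and> (arrow_head n x, p, v) \<in> paths n"
  using arrow_ends[of x n]
  by (auto simp: paths_def pre_digraph.awalk_def cas_quiver) (auto simp: quiver_def)

lemma paths_ends: "(u, p, v) \<in> paths n \<Longrightarrow> u \<le> n \<and> v \<le> n"
  by (induction p arbitrary: u) (auto simp: mem_paths dest: arrow_ends)

lemma paths_append: "(u, p, v) \<in> paths n \<Longrightarrow> (v, p', w) \<in> paths n \<Longrightarrow> (u, p @ p', w) \<in> paths n"
  by (induction p arbitrary: u) (auto simp: mem_paths)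

lemma paths_arcs: "(u, p, v) \<in> paths n \<Longrightarrow> set p \<subseteq> arcs (quiver n)"
  by (induction p arbitrary: u) (auto simp: mem_paths)

text \<open>
  A path is fixed by the trivial path at its source on the left and killed by all the others, so the
  sum of the trivial paths is a left unit, and likewise on the right.
\<close>

lemma basis_algebra_paths:
  "basis_algebra (paths n) path_comp (\<Sum>v\<in>verts (quiver n). Poly_Mapping.single (v, [], v) (1::'f::comm_ring_1))"
proof
  fix b c d :: "nat \<times> arrow list \<times> nat"
  assume "b \<in> paths n" "c \<in> paths n" "path_comp b c = Some d"
  then show "d \<in> paths n"
    by (cases b; cases c) (auto simp: paths_append split: if_splits)
next
  fix b c d :: "nat \<times> arrow list \<times> nat"
  show "Option.bind (path_comp b c) (\<lambda>x. path_comp x d) = Option.bind (path_comp c d) (path_comp b)"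
    by (cases b; cases c; cases d) simp
next
  show "Poly_Mapping.keys (\<Sum>v\<in>verts (quiver n). Poly_Mapping.single (v, [], v) (1::'f)) \<subseteq> paths n"
  proof
    fix b :: "nat \<times> arrow list \<times> nat"
    assume "b \<in> Poly_Mapping.keys (\<Sum>v\<in>verts (quiver n). Poly_Mapping.single (v, [], v) (1::'f))"
    then have "(\<Sum>v\<in>verts (quiver n). Poly_Mapping.lookup (Poly_Mapping.single (v, [], v) (1::'f)) b) \<noteq> 0"
      by (simp add: in_keys_iff lookup_sum)
    then obtain v where v: "v \<in> verts (quiver n)" "Poly_Mapping.lookup (Poly_Mapping.single (v, [], v) (1::'f)) b \<noteq> 0"
      by (rule sum.not_neutral_contains_not_neutral)
    from v(2) have "b = (v, [], v)" by (cases "b = (v, [], v)") (simp_all add: lookup_single)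
    with v(1) show "b \<in> paths n" by (simp add: mem_paths quiver_def)
  qed
next
  fix b :: "nat \<times> arrow list \<times> nat" and r
  assume b: "b \<in> paths n"
  obtain u p w where [simp]: "b = (u, p, w)" by (cases b)
  have v: "u \<in> verts (quiver n)" "w \<in> verts (quiver n)" "finite (verts (quiver n))"
    using paths_ends[of u p w n] b by (auto simp: quiver_def)
  have t: "basis_mult path_comp (Poly_Mapping.single (v, [], v) 1) (Poly_Mapping.single b r) =
      (if v = u then Poly_Mapping.single b r else 0)"
    "basis_mult path_comp (Poly_Mapping.single b r) (Poly_Mapping.single (v, [], v) 1) =
      (if w = v then Poly_Mapping.single b r else 0)" for v and r :: 'f
    by (simp_all add: basis_mult_single basis_term_def)
  show "basis_mult path_comp (\<Sum>v\<in>verts (quiver n). Poly_Mapping.single (v, [], v) 1) (Poly_Mapping.single b (r::'f)) = Poly_Mapping.single b r"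
    unfolding additive.sum[OF additive_basis_mult_left] t using v by (simp add: sum.delta)
  show "basis_mult path_comp (Poly_Mapping.single b (r::'f)) (\<Sum>v\<in>verts (quiver n). Poly_Mapping.single (v, [], v) 1) = Poly_Mapping.single b r"
    unfolding additive.sum[OF additive_basis_mult_right] t using v by (simp add: sum.delta)
qed

lemma path_galgebra_simps:
  "carrier (path_galgebra (quiver n)) = {x. Poly_Mapping.keys x \<subseteq> paths n}"
  "mult (path_galgebra (quiver n)) = basis_mult path_comp"
  "one (path_galgebra (quiver n)) = (\<Sum>v\<in>verts (quiver n). Poly_Mapping.single (v, [], v) 1)"
  "zero (path_galgebra (quiver n)) = 0"
  "add (path_galgebra (quiver n)) = (+)"
  "smult (path_galgebra (quiver n)) c = coeff_map ((*) c)"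
  "hcomp (path_galgebra (quiver n)) d = {x. Poly_Mapping.keys x \<subseteq> {b \<in> paths n. (case_prod (\<lambda>u. case_prod (\<lambda>p v. length p))) b = d}}"
  by (simp_all only: path_galgebra_def basis_galgebra_simps paths_def)

lemma ground_algebra_free: "ground_algebra (free_galgebra G :: ('f::comm_ring_1, _) galgebra)"
  unfolding free_galgebra_def by (rule basis_algebra.ground_algebra[OF basis_algebra_words])

lemma ground_algebra_path: "ground_algebra (path_galgebra (quiver n) :: ('f::comm_ring_1, _) galgebra)"
  unfolding path_galgebra_def paths_def[symmetric]
  by (rule basis_algebra.ground_algebra[OF basis_algebra_paths])

abbreviation A_rel :: "'f::comm_ring_1 \<Rightarrow> (agen list \<Rightarrow>\<^sub>0 'f)" where
  "A_rel q \<equiv> Poly_Mapping.single [GenV, GenU] 1 - Poly_Mapping.single [GenU, GenV] q"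

lemma presented_A: "presented_algebra (free_galgebra UNIV) {A_rel (q::'f::comm_ring_1)}"
  by (rule presented_algebra.intro[OF ground_algebra_free], standard) (simp add: free_galgebra_simps)

lemma keys_binomial: "Poly_Mapping.keys (Poly_Mapping.single b r - Poly_Mapping.single c (s::'f::ab_group_add)) \<subseteq> {b, c}"
  by (rule keys_diff_subset) simp_all

lemma R_rels_keys:
  assumes "x \<in> R_rels n (q::'f::comm_ring_1)"
  shows "Poly_Mapping.keys x \<subseteq> {w \<in> lists (R_gens n). length w = 2}"
proof -
  from assms obtain v w r s where x: "x = Poly_Mapping.single v r - Poly_Mapping.single w s"
    and "{v, w} \<subseteq> {w \<in> lists (R_gens n). length w = 2}"
    unfolding R_rels_def by (auto simp: R_gens_def)
  then show ?thesis using keys_binomial[of v r w s] by blast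
qed

lemma presented_R: "presented_algebra (free_galgebra (R_gens n)) (R_rels n (q::'f::comm_ring_1))"
  by (rule presented_algebra.intro[OF ground_algebra_free], standard)
    (use R_rels_keys[of _ n q] in \<open>auto simp: free_galgebra_simps\<close>)

lemma presented_Lam: "presented_algebra (path_galgebra (quiver n)) (Lam_rels n (q::'f::comm_ring_1))"
proof (rule presented_algebra.intro[OF ground_algebra_path], standard)
  show "Lam_rels n q \<subseteq> carrier (path_galgebra (quiver n))"
  proof
    fix x assume "x \<in> Lam_rels n q"
    then obtain v w r s where x: "x = Poly_Mapping.single v r - Poly_Mapping.single w s"
      and "{v, w} \<subseteq> paths n"
      unfolding Lam_rels_def Let_def
      by (auto simp: mem_paths quiver_def)
    then show "x \<in> carrier (path_galgebra (quiver n))"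
      using keys_binomial[of v r w s] by (auto simp: path_galgebra_simps)
  qed
qed

lemma keys_sum_subset:
  "(\<And>l. l \<in> A \<Longrightarrow> Poly_Mapping.keys (f l) \<subseteq> B) \<Longrightarrow> Poly_Mapping.keys (\<Sum>l\<in>A. f l) \<subseteq> B"
  by (induction A rule: infinite_finite_induct) (simp_all add: keys_add_subset)

section \<open>The representation of the path algebra over R\<close>

lemma verts_quiver: "verts (quiver n) = {0..n}"
  by (simp add: quiver_def)

fun arrow_gen :: "arrow \<Rightarrow> rgen" where
  "arrow_gen (Alpha i) = GenA i"
| "arrow_gen (AlphaBar i) = GenABar i"

text \<open>
  Entry \<open>(i, j)\<close> of the matrix of \<open>x\<close>, before passing to the quotient: only paths from \<open>i\<close> to \<open>j\<close>
  contribute, each by the word in the generators that is spelled by its arrows.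
\<close>

definition path_entry :: "nat \<Rightarrow> nat \<Rightarrow> (nat \<times> arrow list \<times> nat \<Rightarrow>\<^sub>0 'f::comm_ring_1) \<Rightarrow> (rgen list \<Rightarrow>\<^sub>0 'f)" where
  "path_entry i j = lin_ext (\<lambda>(u, p, v) c. if u = i \<and> v = j then Poly_Mapping.single (map arrow_gen p) c else 0)"

lemma additive_path_entry: "additive (path_entry i j)"
  unfolding path_entry_def by (rule additive_lin_ext) (auto simp: additive_def single_add split: prod.splits)

lemma path_entry_single:
  "path_entry i j (Poly_Mapping.single (u, p, v) c) =
    (if u = i \<and> v = j then Poly_Mapping.single (map arrow_gen p) c else 0)"
  by (simp add: path_entry_def lin_ext_single)

lemmas path_entry_simps = additive.zero[OF additive_path_entry] additive.add[OF additive_path_entry]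
  additive.diff[OF additive_path_entry] path_entry_single

lemma path_entry_scale:
  "path_entry i j (coeff_map ((*) c) x) = coeff_map ((*) c) (path_entry i j x)"
  by (rule additive_eq_on[where x = x and B = UNIV])
    (auto simp: additive_def path_entry_simps additive.add[OF additive_scale] scale_single
      additive.zero[OF additive_scale])

text \<open>
  The product of two paths is nonzero exactly when the end of the first is the start of the second,
  and this is also when the product of the corresponding matrix units is nonzero. In the sum over
  \<open>l\<close> only the common vertex survives.
\<close>

lemma path_entry_mult:
  assumes "Poly_Mapping.keys x \<subseteq> paths n" "Poly_Mapping.keys y \<subseteq> paths n"
  shows "path_entry i j (basis_mult path_comp x y) =
    (\<Sum>l\<in>{0..n}. word_mult (path_entry i l x) (path_entry l j y))"
proof (rule additive_eq_on[OF _ _ assms(1)])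
  fix b r assume b: "b \<in> paths n"
  show "path_entry i j (basis_mult path_comp (Poly_Mapping.single b r) y) =
    (\<Sum>l\<in>{0..n}. word_mult (path_entry i l (Poly_Mapping.single b r)) (path_entry l j y))"
  proof (rule additive_eq_on[OF _ _ assms(2)])
    fix c s assume "c \<in> paths n"
    obtain u p v u' p' v' where [simp]: "b = (u, p, v)" "c = (u', p', v')"
      by (cases b; cases c)
    have "v \<le> n" using paths_ends b by simp
    have "(\<Sum>l\<in>{0..n}. word_mult (path_entry i l (Poly_Mapping.single b r)) (path_entry l j (Poly_Mapping.single c s)))
        = (\<Sum>l\<in>{0..n}. if v = l then
            (if u = i \<and> u' = v \<and> v' = j then Poly_Mapping.single (map arrow_gen (p @ p')) (r * s) else 0) else 0)"
      by (rule sum.cong) (simp_all add: path_entry_simps basis_mult_simps basis_term_def)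
    also have "\<dots> = path_entry i j (basis_mult path_comp (Poly_Mapping.single b r) (Poly_Mapping.single c s))"
      using \<open>v \<le> n\<close> by (simp add: basis_mult_simps basis_term_def path_entry_simps)
    finally show "path_entry i j (basis_mult path_comp (Poly_Mapping.single b r) (Poly_Mapping.single c s)) =
      (\<Sum>l\<in>{0..n}. word_mult (path_entry i l (Poly_Mapping.single b r)) (path_entry l j (Poly_Mapping.single c s)))"
      by simp
  qed (simp_all add: additive_def basis_mult_simps path_entry_simps sum.distrib)
qed (simp_all add: additive_def basis_mult_simps path_entry_simps sum.distrib)

lemma path_entry_keys:
  assumes "Poly_Mapping.keys x \<subseteq> {(u, p, v). (u, p, v) \<in> paths n \<and> P (length p)}"
  shows "Poly_Mapping.keys (path_entry i j x) \<subseteq> {w \<in> lists (R_gens n). P (length w)}"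
  using assms
proof (induction rule: keys_subset_induct)
  case (single b c)
  obtain u p v where [simp]: "b = (u, p, v)" by (cases b)
  have "set p \<subseteq> arcs (quiver n)" using single paths_arcs[of u p v n] by simp
  then have "map arrow_gen p \<in> lists (R_gens n)"
    by (force simp: quiver_def R_gens_def)
  then show ?case using single by (simp add: path_entry_simps)
qed (simp_all add: path_entry_simps keys_add_subset)

lemma path_entry_outside:
  assumes "Poly_Mapping.keys x \<subseteq> paths n" "i > n \<or> j > n"
  shows "path_entry i j x = 0"
  using assms(1)
proof (induction rule: keys_subset_induct)
  case (single b c)
  then show ?case using assms(2) paths_ends by (cases b) (fastforce simp: path_entry_simps)
qed (simp_all add: path_entry_simps)

context
  fixes n :: nat and q :: "'f::comm_ring_1"
begin

interpretation R: presented_algebra "free_galgebra (R_gens n)" "R_rels n q"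
  by (rule presented_R)

lemma R_alg_eq: "R_alg n q = R.quot"
  by (simp add: R_alg_def)

lemma R_cls_sum:
  assumes "\<And>l. l \<in> A \<Longrightarrow> Poly_Mapping.keys (f l) \<subseteq> lists (R_gens n)"
  shows "R.cls (\<Sum>l\<in>A. f l) = (\<Oplus>\<^bsub>R.quot\<^esub>l\<in>A. R.cls (f l))"
  using assms
proof (induction A rule: infinite_finite_induct)
  case (insert a A)
  have "sum f A \<in> carrier (free_galgebra (R_gens n))" "f a \<in> carrier (free_galgebra (R_gens n))"
    "\<And>l. l \<in> A \<Longrightarrow> f l \<in> carrier (free_galgebra (R_gens n))"
    using insert.prems keys_sum_subset[of A f] by (simp_all add: free_galgebra_simps)
  then show ?case using insert R.add_quot[of "f a" "sum f A"]
    by (subst R.Q.finsum_insert) (simp_all add: Pi_def free_galgebra_simps(5))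
qed (simp_all add: R.zero_quot free_galgebra_simps R.Q.finsum_infinite)

definition path_matrix :: "(nat \<times> arrow list \<times> nat \<Rightarrow>\<^sub>0 'f) \<Rightarrow> nat \<Rightarrow> nat \<Rightarrow> 'f R_elt" where
  "path_matrix x i j = R.cls (path_entry i j x)"

lemma path_entry_closed:
  "Poly_Mapping.keys x \<subseteq> paths n \<Longrightarrow> path_entry i j x \<in> carrier (free_galgebra (R_gens n))"
  using path_entry_keys[of x n "\<lambda>_. True" i j] by (auto simp: free_galgebra_simps)

lemma path_matrix_alg_hom:
  "path_matrix \<in> graded_alg_hom (path_galgebra (quiver n)) (mat_galgebra {0..n} (R_alg n q))"
proof -
  let ?P = "path_galgebra (quiver n) :: ('f, _) galgebra" and ?M = "mat_galgebra {0..n} (R_alg n q)"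
  have closed: "path_matrix x \<in> carrier ?M" if "Poly_Mapping.keys x \<subseteq> paths n" for x
    using path_entry_closed[OF that] path_entry_outside[OF that]
    by (auto simp: mat_galgebra_simps path_matrix_def R_alg_eq R.carrier_quot R.zero_quot free_galgebra_simps not_le)
  have "path_matrix \<in> ring_hom ?P ?M"
  proof (rule ring_hom_memI)
    fix x y :: "nat \<times> arrow list \<times> nat \<Rightarrow>\<^sub>0 'f"
    assume "x \<in> carrier ?P" "y \<in> carrier ?P"
    then have xy: "Poly_Mapping.keys x \<subseteq> paths n" "Poly_Mapping.keys y \<subseteq> paths n"
      by (simp_all add: path_galgebra_simps)
    note e = path_entry_closed[OF xy(1)] path_entry_closed[OF xy(2)]
    have m: "word_mult (path_entry i l x) (path_entry l j y) \<in> carrier (free_galgebra (R_gens n))" for i j l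
      using R.m_closed[OF e(1) e(2), of i l l j] by (simp add: free_galgebra_simps)
    show "path_matrix (x \<otimes>\<^bsub>?P\<^esub> y) = path_matrix x \<otimes>\<^bsub>?M\<^esub> path_matrix y"
    proof (intro ext)
      fix i j
      have "path_matrix (x \<otimes>\<^bsub>?P\<^esub> y) i j
          = R.cls (\<Sum>l\<in>{0..n}. word_mult (path_entry i l x) (path_entry l j y))"
        by (simp add: path_matrix_def path_galgebra_simps path_entry_mult[OF xy])
      also have "\<dots> = (\<Oplus>\<^bsub>R.quot\<^esub>l\<in>{0..n}. R.cls (word_mult (path_entry i l x) (path_entry l j y)))"
        by (rule R_cls_sum) (use m in \<open>simp add: free_galgebra_simps\<close>)
      also have "\<dots> = (\<Oplus>\<^bsub>R.quot\<^esub>l\<in>{0..n}. path_matrix x i l \<otimes>\<^bsub>R.quot\<^esub> path_matrix y l j)"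
        unfolding path_matrix_def R.mult_quot[OF e] by (simp add: free_galgebra_simps)
      finally show "path_matrix (x \<otimes>\<^bsub>?P\<^esub> y) i j = (path_matrix x \<otimes>\<^bsub>?M\<^esub> path_matrix y) i j"
        by (simp add: mat_galgebra_simps R_alg_eq)
    qed
    show "path_matrix (x \<oplus>\<^bsub>?P\<^esub> y) = path_matrix x \<oplus>\<^bsub>?M\<^esub> path_matrix y"
      using R.add_quot[OF e]
      by (simp add: fun_eq_iff path_matrix_def path_galgebra_simps path_entry_simps mat_galgebra_simps
          R_alg_eq free_galgebra_simps)
  next
    have "path_entry i j (\<Sum>v\<in>{0..n}. Poly_Mapping.single (v, [], v) (1::'f)) =
        (if i \<le> n \<and> i = j then Poly_Mapping.single [] 1 else 0)" for i j
    proof -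
      have "path_entry i j (\<Sum>v\<in>{0..n}. Poly_Mapping.single (v, [], v) (1::'f))
        = (\<Sum>v\<in>{0..n}. if i = v then (if i = j then Poly_Mapping.single [] 1 else 0) else 0)"
        unfolding additive.sum[OF additive_path_entry] by (rule sum.cong) (auto simp: path_entry_simps)
      then show ?thesis by simp
    qed
    then show "path_matrix \<one>\<^bsub>?P\<^esub> = \<one>\<^bsub>?M\<^esub>"
      by (simp add: fun_eq_iff path_matrix_def path_galgebra_simps mat_galgebra_simps verts_quiver
          R_alg_eq R.one_quot R.zero_quot free_galgebra_simps)
  qed (simp add: closed path_galgebra_simps)
  moreover have "path_matrix (c \<odot>\<^bsub>?P\<^esub> x) = c \<odot>\<^bsub>?M\<^esub> path_matrix x" if "x \<in> carrier ?P" for c x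
    using that path_entry_closed[of x]
    by (simp add: fun_eq_iff path_matrix_def path_galgebra_simps path_entry_scale mat_galgebra_simps
        R_alg_eq R.smult_quot) (simp add: free_galgebra_simps)
  moreover have "path_matrix x \<in> hcomp ?M d" if "x \<in> hcomp ?P d" for x d
  proof -
    have x: "Poly_Mapping.keys x \<subseteq> {(u, p, v). (u, p, v) \<in> paths n \<and> length p = d}"
      using that by (auto simp: path_galgebra_simps)
    then have "Poly_Mapping.keys x \<subseteq> paths n" by auto
    with closed path_entry_keys[OF x] show ?thesis
      by (auto simp: mat_galgebra_simps(7) R_alg_eq R.hcomp_quot free_galgebra_simps path_matrix_def)
  qed
  ultimately show ?thesis
    by (auto simp: graded_alg_hom_def alg_hom_def)
qed

lemma R_relation_cls:
  assumes "x - y \<in> R_rels n q"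
    "Poly_Mapping.keys x \<subseteq> lists (R_gens n)" "Poly_Mapping.keys y \<subseteq> lists (R_gens n)"
  shows "R.cls x = R.cls y"
proof -
  have c: "x \<in> carrier (free_galgebra (R_gens n))" "y \<in> carrier (free_galgebra (R_gens n))"
    "- y \<in> carrier (free_galgebra (R_gens n))"
    using assms by (simp_all add: free_galgebra_simps)
  have "\<ominus>\<^bsub>free_galgebra (R_gens n)\<^esub> y = - y"
    by (rule R.minus_equality) (use c in \<open>simp_all add: free_galgebra_simps\<close>)
  then have "x \<ominus>\<^bsub>free_galgebra (R_gens n)\<^esub> y = x - y"
    by (simp add: a_minus_def free_galgebra_simps)
  then show ?thesis
    using c R.cls_eq_iff[of x y] R.genideal_self[OF R.relations_closed] assms(1) by auto
qed

lemma R_rels_mem: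
  assumes "i \<le> n" "j \<le> n"
  shows "Poly_Mapping.single [GenA j, GenA i] 1 - Poly_Mapping.single [GenA i, GenA j] 1 \<in> R_rels n q"
    and "Poly_Mapping.single [GenABar j, GenABar i] 1 - Poly_Mapping.single [GenABar i, GenABar j] 1 \<in> R_rels n q"
    and "Poly_Mapping.single [GenABar j, GenA i] 1 - Poly_Mapping.single [GenA i, GenABar j] q \<in> R_rels n q"
    and "Poly_Mapping.single [GenA 0, GenABar 0] 1 - Poly_Mapping.single [GenA i, GenABar i] 1 \<in> R_rels n q"
  unfolding R_rels_def using assms
  by (intro UN_I[of i] UN_I[of j]; simp)+

text \<open>
  Modulo the relations, \<open>a\<^sub>i\<close>-bar times \<open>a\<^sub>i\<close> is \<open>q\<close> times \<open>a\<^sub>i a\<^sub>i\<close>-bar, and the latter product does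
  not depend on the index. For \<open>j = i + 1\<close> this is what the relation of \<open>\<Lambda>\<close> at vertex \<open>j\<close> demands.
\<close>

lemma R_arrow_relation:
  assumes i: "i \<le> n" and j: "j \<le> n"
  shows "R.cls (Poly_Mapping.single [GenABar i, GenA i] 1) =
    R.cls (Poly_Mapping.single [GenA j, GenABar j] q)"
proof -
  have m: "GenA l \<in> R_gens n" "GenABar l \<in> R_gens n" if "l \<le> n" for l
    using that by (auto simp: R_gens_def)
  have scale: "R.cls (Poly_Mapping.single w q) = q \<odot>\<^bsub>R.quot\<^esub> R.cls (Poly_Mapping.single w 1)"
    if "w \<in> lists (R_gens n)" for w
    using that R.smult_quot[of "Poly_Mapping.single w 1" q]
    by (simp add: free_galgebra_simps scale_single)
  have "R.cls (Poly_Mapping.single [GenA 0, GenABar 0] 1) = R.cls (Poly_Mapping.single [GenA l, GenABar l] 1)"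
    if "l \<le> n" for l
    by (rule R_relation_cls[OF R_rels_mem(4)]) (use that m in simp_all)
  from this[OF i] this[OF j]
  have "R.cls (Poly_Mapping.single [GenA j, GenABar j] 1) = R.cls (Poly_Mapping.single [GenA i, GenABar i] 1)"
    by simp
  then have "R.cls (Poly_Mapping.single [GenA j, GenABar j] q) = R.cls (Poly_Mapping.single [GenA i, GenABar i] q)"
    using scale[of "[GenA j, GenABar j]"] scale[of "[GenA i, GenABar i]"] m i j by simp
  also have "\<dots> = R.cls (Poly_Mapping.single [GenABar i, GenA i] 1)"
    by (rule R_relation_cls[symmetric, OF R_rels_mem(3)]) (use i m in simp_all)
  finally show ?thesis by simp
qed

lemma path_matrix_relations:
  assumes "s \<in> Lam_rels n q"
  shows "path_matrix s = \<zero>\<^bsub>mat_galgebra {0..n} (R_alg n q)\<^esub>"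
proof -
  obtain i where i: "i \<le> n" and s: "s = (let j = cyc_succ n i in
     Poly_Mapping.single (j, [AlphaBar i, Alpha i], j) 1
     - Poly_Mapping.single (j, [Alpha j, AlphaBar j], j) q)"
    using assms by (auto simp: Lam_rels_def)
  define j where "j = cyc_succ n i"
  have j: "j \<le> n" by (simp add: j_def)
  let ?x = "Poly_Mapping.single [GenABar i, GenA i] (1::'f)" and ?y = "Poly_Mapping.single [GenA j, GenABar j] q"
  have c: "?x \<in> carrier (free_galgebra (R_gens n))" "?y \<in> carrier (free_galgebra (R_gens n))"
      "- ?y \<in> carrier (free_galgebra (R_gens n))"
    using i j by (auto simp: R_gens_def free_galgebra_simps)
  have "R.cls (?x - ?y) = R.cls ?x \<oplus>\<^bsub>R.quot\<^esub> R.cls (- ?y)"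
    using R.add_quot[OF c(1,3)] by (simp add: free_galgebra_simps)
  also have "R.cls ?x = R.cls ?y" by (rule R_arrow_relation[OF i j])
  also have "R.cls ?y \<oplus>\<^bsub>R.quot\<^esub> R.cls (- ?y) = R.cls 0"
    using R.add_quot[OF c(2,3)] by (simp add: free_galgebra_simps)
  finally have "R.cls (?x - ?y) = R.cls 0" .
  then show ?thesis
    using R.zero_quot
    by (auto simp: fun_eq_iff path_matrix_def s Let_def j_def path_entry_simps mat_galgebra_simps
        R_alg_eq free_galgebra_simps)
qed

end

text \<open>
  The only tool for showing that something is nonzero in a quotient. Every element of the ideal is a
  sum of products of a relation with words on both sides; unless both words are empty, such a product
  only contains words of length greater than \<open>2\<close>. To formalise this without choosing such sums, the
  elements \<open>x\<close> for which \<open>f\<close> vanishes on all products \<open>a x b\<close> are seen to form an ideal.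
\<close>

lemma additive_kills_quadratic_ideal:
  fixes S :: "('x list \<Rightarrow>\<^sub>0 'f::comm_ring_1) set" and f :: "('x list \<Rightarrow>\<^sub>0 'f) \<Rightarrow> 'm::ab_group_add"
  assumes S: "\<And>s. s \<in> S \<Longrightarrow> Poly_Mapping.keys s \<subseteq> {w \<in> lists G. length w = 2}"
    and f: "additive f"
    and long: "\<And>w c. length w > 2 \<Longrightarrow> f (Poly_Mapping.single w c) = 0"
    and rel: "\<And>s c. s \<in> S \<Longrightarrow> f (coeff_map ((*) c) s) = 0"
    and x: "x \<in> Idl\<^bsub>free_galgebra G\<^esub> S"
  shows "f x = 0"
proof -
  interpret ground_algebra "free_galgebra G :: ('f, _) galgebra"
    by (rule ground_algebra_free)
  note fadd = additive.add[OF f] additive.zero[OF f]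
  \<comment> \<open>the largest two-sided ideal on which \<open>f\<close> vanishes\<close>
  let ?J = "{x \<in> carrier (free_galgebra G). \<forall>a\<in>carrier (free_galgebra G). \<forall>b\<in>carrier (free_galgebra G).
    f (word_mult a (word_mult x b)) = 0}"
  have assoc: "word_mult (word_mult a b) c = word_mult a (word_mult b c)"
    if "a \<in> carrier (free_galgebra G)" "b \<in> carrier (free_galgebra G)" "c \<in> carrier (free_galgebra G)"
    for a b c :: "'x list \<Rightarrow>\<^sub>0 'f"
    using m_assoc[OF that] by (simp add: free_galgebra_simps)
  have closed: "word_mult a b \<in> carrier (free_galgebra G)"
    if "a \<in> carrier (free_galgebra G)" "b \<in> carrier (free_galgebra G)" for a b :: "'x list \<Rightarrow>\<^sub>0 'f"
    using m_closed[OF that] by (simp add: free_galgebra_simps)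
  have "ideal ?J (free_galgebra G)"
  proof (rule idealI[OF ring_axioms])
    show "subgroup ?J (add_monoid (free_galgebra G))"
    proof (rule add.subgroupI)
      show "?J \<noteq> {}"
        by (rule ex_in_conv[THEN iffD1], rule exI[of _ 0])
          (simp add: free_galgebra_simps basis_mult_simps fadd)
    next
      fix x assume x: "x \<in> ?J"
      have "\<ominus>\<^bsub>free_galgebra G\<^esub> x = - x"
        by (rule minus_equality) (use x in \<open>simp_all add: free_galgebra_simps\<close>)
      then show "\<ominus>\<^bsub>free_galgebra G\<^esub> x \<in> ?J"
        using x by (simp add: free_galgebra_simps additive.minus[OF additive_basis_mult_left]
            additive.minus[OF additive_basis_mult_right] additive.minus[OF f])
    qed (auto simp: free_galgebra_simps basis_mult_simps fadd keys_add_subset)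
  next
    fix y x :: "'x list \<Rightarrow>\<^sub>0 'f"
    assume y: "y \<in> ?J" and x: "x \<in> carrier (free_galgebra G)"
    have "f (word_mult a (word_mult (word_mult x y) b)) = 0" "f (word_mult a (word_mult (word_mult y x) b)) = 0"
      if a: "a \<in> carrier (free_galgebra G)" and b: "b \<in> carrier (free_galgebra G)"
      for a b :: "'x list \<Rightarrow>\<^sub>0 'f"
    proof -
      have "word_mult a (word_mult (word_mult x y) b) = word_mult (word_mult a x) (word_mult y b)"
        using a b x y by (simp add: assoc closed)
      then show "f (word_mult a (word_mult (word_mult x y) b)) = 0"
        using closed[OF a x] y b by simp
      show "f (word_mult a (word_mult (word_mult y x) b)) = 0"
        using a b x y by (simp add: assoc closed)
    qed
    then show "x \<otimes>\<^bsub>free_galgebra G\<^esub> y \<in> ?J" "y \<otimes>\<^bsub>free_galgebra G\<^esub> x \<in> ?J"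
      using x y by (simp_all add: free_galgebra_simps(2) closed)
  qed
  moreover have "S \<subseteq> ?J"
  proof
    fix s assume s: "s \<in> S"
    have keys: "Poly_Mapping.keys s \<subseteq> {w. length w = 2}" using S[OF s] by auto
    have t: "f (word_mult (Poly_Mapping.single v r) (word_mult s (Poly_Mapping.single w r'))) = 0" for v w r r'
    proof (cases "v = [] \<and> w = []")
      case True
      have comm: "r * (c * r') = (r * r') * c" for c by (simp add: mult_ac)
      have "word_mult (Poly_Mapping.single [] r) (word_mult s (Poly_Mapping.single [] r')) = coeff_map ((*) (r * r')) s"
        by (rule additive_eq_on[OF _ _ keys])
          (simp_all add: additive_def basis_mult_simps basis_term_def scale_single comm
            additive.add[OF additive_scale])
      then show ?thesis using True rel[OF s] by simp
    next
      case False
      show ?thesis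
        by (rule additive_eq_on[OF _ _ keys, where g = "\<lambda>_. 0"])
          (use False in \<open>auto simp: additive_def basis_mult_simps fadd basis_term_def intro!: long\<close>)
    qed
    have "f (word_mult a (word_mult s b)) = 0" for a b
    proof (rule additive_eq_on[where x = a and B = UNIV and g = "\<lambda>_. 0"])
      fix v r
      show "f (word_mult (Poly_Mapping.single v r) (word_mult s b)) = 0"
        by (rule additive_eq_on[where x = b and B = UNIV and g = "\<lambda>_. 0"])
          (simp_all add: t additive_def basis_mult_simps fadd)
    qed (simp_all add: additive_def basis_mult_simps fadd)
    then show "s \<in> ?J" using S[OF s] by (auto simp: free_galgebra_simps)
  qed
  ultimately have "Idl\<^bsub>free_galgebra G\<^esub> S \<subseteq> ?J" by (rule genideal_minimal)
  with x have "x \<in> carrier (free_galgebra G)" and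
    *: "f (word_mult \<one>\<^bsub>free_galgebra G\<^esub> (word_mult x \<one>\<^bsub>free_galgebra G\<^esub>)) = 0"
    by auto
  then show ?thesis
    using r_one[of x] l_one[of x] by (simp add: free_galgebra_simps)
qed

context
  fixes n :: nat and q :: "'f::comm_ring_1"
begin

interpretation R: presented_algebra "free_galgebra (R_gens n)" "R_rels n q"
  by (rule presented_R)
interpretation L: presented_algebra "path_galgebra (quiver n)" "Lam_rels n q"
  by (rule presented_Lam)

definition iota_R :: "'f Lam_elt \<Rightarrow> nat \<Rightarrow> nat \<Rightarrow> 'f R_elt" where
  "iota_R = quot_lift (path_matrix n q)"

lemma ring_R_alg: "ring (R_alg n q)"
  unfolding R_alg_def by (rule R.ring_quot)

lemma ground_algebra_R: "ground_algebra (R_alg n q)"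
  unfolding R_alg_def by (rule R.Q.ground_algebra_axioms)

lemma iota_R_cls:
  assumes "Poly_Mapping.keys x \<subseteq> paths n"
  shows "iota_R (L.cls x) = path_matrix n q x"
  unfolding iota_R_def
  by (rule L.quot_lift_cls[OF ring_mat_galgebra[OF ring_R_alg] _ path_matrix_relations])
    (use path_matrix_alg_hom[of n q] assms in \<open>auto simp: graded_alg_hom_def alg_hom_def path_galgebra_simps\<close>)

lemma iota_R_hom: "iota_R \<in> graded_alg_hom (Lam_alg n q) (mat_galgebra {0..n} (R_alg n q))"
proof -
  have h: "path_matrix n q \<in> graded_alg_hom (path_galgebra (quiver n)) (mat_galgebra {0..n} (R_alg n q))"
    by (rule path_matrix_alg_hom)
  have "iota_R \<in> ring_hom L.quot (mat_galgebra {0..n} (R_alg n q))"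
    unfolding iota_R_def
    by (rule L.quot_lift_hom[OF ring_mat_galgebra[OF ring_R_alg] _ path_matrix_relations])
      (use h in \<open>auto simp: graded_alg_hom_def alg_hom_def\<close>)
  moreover have "iota_R (c \<odot>\<^bsub>L.quot\<^esub> X) = c \<odot>\<^bsub>mat_galgebra {0..n} (R_alg n q)\<^esub> iota_R X"
    if "X \<in> carrier L.quot" for c X
  proof -
    obtain x where x: "x \<in> carrier (path_galgebra (quiver n))" "X = L.cls x"
      using \<open>X \<in> carrier L.quot\<close> by (auto simp: L.carrier_quot)
    then show ?thesis
      using h L.smult_closed[OF x(1), of c]
      by (simp add: L.smult_quot graded_alg_hom_def alg_hom_def iota_R_cls path_galgebra_simps(1))
  qed
  moreover have "iota_R X \<in> hcomp (mat_galgebra {0..n} (R_alg n q)) d" if X: "X \<in> hcomp L.quot d" for X d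
  proof -
    obtain x where x: "x \<in> hcomp (path_galgebra (quiver n)) d" "X = L.cls x"
      using X by (auto simp: L.hcomp_quot)
    then have "iota_R X = path_matrix n q x"
      by (auto simp: path_galgebra_simps intro!: iota_R_cls)
    then show ?thesis using h x by (auto simp: graded_alg_hom_def)
  qed
  ultimately show ?thesis
    by (auto simp: graded_alg_hom_def alg_hom_def Lam_alg_def)
qed

lemma iota_R_single:
  assumes "(u, p, v) \<in> paths n"
  shows "iota_R (L.cls (Poly_Mapping.single (u, p, v) 1)) =
    mat_elem (R_alg n q) u v (R.cls (Poly_Mapping.single (map arrow_gen p) 1))"
  using assms R.zero_quot
  by (subst iota_R_cls) (auto simp: fun_eq_iff path_matrix_def mat_elem_def path_entry_simps R_alg_def free_galgebra_simps)

text \<open>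
  The relations of \<open>R\<close> are quadratic, so the coefficient of a word of length \<open>1\<close> is an invariant of
  the class.
\<close>

lemma R_gen_nonzero:
  assumes "x \<in> R_gens n" "(1::'f) \<noteq> 0"
  shows "R_gen n q x \<noteq> \<zero>\<^bsub>R_alg n q\<^esub>"
proof
  let ?x = "Poly_Mapping.single [x] (1::'f)"
  assume "R_gen n q x = \<zero>\<^bsub>R_alg n q\<^esub>"
  then have "R.cls ?x = R.cls \<zero>\<^bsub>free_galgebra (R_gens n)\<^esub>"
    by (simp add: R_gen_def R_alg_def R.zero_quot)
  moreover have "?x \<in> carrier (free_galgebra (R_gens n))"
    using assms by (simp add: free_galgebra_simps)
  ultimately have "?x \<in> Idl\<^bsub>free_galgebra (R_gens n)\<^esub> (R_rels n q)"
    by (simp add: R.cls_eq_iff a_minus_def)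
  then have "Poly_Mapping.lookup ?x [x] = 0"
  proof (rule additive_kills_quadratic_ideal[where f = "\<lambda>y. Poly_Mapping.lookup y [x]", rotated -1])
    fix s c assume "s \<in> R_rels n q"
    from R_rels_keys[OF this] have "Poly_Mapping.lookup s [x] = 0"
      by (auto simp: in_keys_iff)
    then show "Poly_Mapping.lookup (coeff_map ((*) c) s) [x] = 0"
      by (simp add: lookup_coeff_map)
  next
    fix s assume "s \<in> R_rels n q"
    then show "Poly_Mapping.keys s \<subseteq> {w \<in> lists (R_gens n). length w = 2}"
      by (rule R_rels_keys)
  qed (auto simp: additive_def lookup_add lookup_single when_def)
  then show False using assms(2) by simp
qed

lemma is_iota_R_iota_R:
  assumes "(1::'f) \<noteq> 0"
  shows "is_iota_R n q iota_R"
proof -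
  have arr: "iota_R (Lam_arrow n q x) =
      mat_elem (R_alg n q) (arrow_tail n x) (arrow_head n x) (R_gen n q (arrow_gen x))"
    if "x \<in> arcs (quiver n)" for x
    using iota_R_single[of "arrow_tail n x" "[x]" "arrow_head n x"] that arrow_ends[OF that]
    by (simp add: Lam_arrow_def R_gen_def mem_paths)
  have vert: "iota_R (Lam_vertex n q i) = mat_elem (R_alg n q) i i \<one>\<^bsub>R_alg n q\<^esub>" if "i \<in> {0..n}" for i
    using iota_R_single[of i "[]" i] that
    by (simp add: Lam_vertex_def mem_paths R_alg_def R.one_quot free_galgebra_simps)
  have "iota_R (Lam_arrow n q x) \<noteq> \<zero>\<^bsub>mat_galgebra {0..n} (R_alg n q)\<^esub>" if x: "x \<in> arcs (quiver n)" for x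
  proof
    assume "iota_R (Lam_arrow n q x) = \<zero>\<^bsub>mat_galgebra {0..n} (R_alg n q)\<^esub>"
    then have "iota_R (Lam_arrow n q x) (arrow_tail n x) (arrow_head n x) = \<zero>\<^bsub>R_alg n q\<^esub>"
      by (simp add: mat_galgebra_simps)
    moreover have "arrow_gen x \<in> R_gens n"
      using x by (auto simp: quiver_def R_gens_def)
    ultimately show False
      using R_gen_nonzero[OF _ assms] by (simp add: arr[OF x] mat_elem_def)
  qed
  moreover have "Alpha i \<in> arcs (quiver n)" "AlphaBar i \<in> arcs (quiver n)" if "i \<in> {0..n}" for i
    using that by (simp_all add: quiver_def)
  ultimately show ?thesis
    by (simp add: is_iota_R_def graded_rep_def iota_R_hom vert arr)
qed

end

section \<open>Specialisation\<close>

lemma laurent_eval_lin_ext: "laurent_eval t = lin_ext (\<lambda>m a. a * t powi m)"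
  by (simp add: laurent_eval_def lin_ext_def fun_eq_iff)

lemma additive_laurent_eval: "additive (laurent_eval t)"
  unfolding laurent_eval_lin_ext by (rule additive_lin_ext) (simp add: additive_def distrib_right)

lemma laurent_eval_single [simp]: "laurent_eval t (Poly_Mapping.single m a) = a * t powi m"
  by (simp add: laurent_eval_lin_ext lin_ext_single)

lemmas laurent_eval_simps = additive.add[OF additive_laurent_eval] additive.zero[OF additive_laurent_eval]
  additive.diff[OF additive_laurent_eval] laurent_eval_single

lemma laurent_eval_1: "laurent_eval t 1 = 1"
  using laurent_eval_single[of t 0 1] by simp

lemma laurent_eval_qvar: "laurent_eval t qvar = t"
  by (simp add: qvar_def)

lemma laurent_eval_mult:
  assumes "t \<noteq> (0::'k::field)"
  shows "laurent_eval t (c * d) = laurent_eval t c * laurent_eval t d"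
proof (rule additive_eq_on[where x = c and B = UNIV])
  fix m a
  show "laurent_eval t (Poly_Mapping.single m a * d) = laurent_eval t (Poly_Mapping.single m a) * laurent_eval t d"
    by (rule additive_eq_on[where x = d and B = UNIV])
      (simp_all add: additive_def laurent_eval_simps distrib_left mult_single power_int_add assms)
qed (simp_all add: additive_def laurent_eval_simps distrib_right)

text \<open>
  For exponents of either sign the divisibility follows from that of the neighbouring exponent closer
  to \<open>0\<close>. In the negative direction \<open>1/q - 1/t\<close> is a unit multiple of \<open>q - t\<close>; this uses \<open>t \<noteq> 0\<close>.
\<close>

lemma qvar_minus_dvd_monomial:
  fixes t :: "'k::field"
  assumes "t \<noteq> 0"
  shows "qvar - Poly_Mapping.single 0 t dvd Poly_Mapping.single m 1 - Poly_Mapping.single 0 (t powi m)"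
proof (induction m rule: int_induct[of _ 0])
  case base
  then show ?case by simp
next
  case (step1 m)
  have "Poly_Mapping.single (m + 1) (1::'k) - Poly_Mapping.single 0 (t powi (m + 1)) =
    qvar * (Poly_Mapping.single m 1 - Poly_Mapping.single 0 (t powi m)) +
    Poly_Mapping.single 0 (t powi m) * (qvar - Poly_Mapping.single 0 t)"
    by (simp add: qvar_def right_diff_distrib mult_single power_int_add assms add.commute mult.commute)
  then show ?case using step1(2) by (metis dvd_add dvd_mult dvd_refl)
next
  case (step2 m)
  have "Poly_Mapping.single (m - 1) (1::'k) - Poly_Mapping.single 0 (t powi (m - 1)) =
    Poly_Mapping.single (-1) 1 * (Poly_Mapping.single m 1 - Poly_Mapping.single 0 (t powi m)) +
    (- Poly_Mapping.single (-1) (t powi (m - 1))) * (qvar - Poly_Mapping.single 0 t)"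
    using assms
    by (simp add: qvar_def right_diff_distrib mult_single power_int_diff)
  then show ?case using step2(2) by (metis dvd_add dvd_mult dvd_refl)
qed

lemma laurent_eval_eq_0_imp_dvd:
  fixes t :: "'k::field"
  assumes "t \<noteq> 0" "laurent_eval t c = 0"
  shows "qvar - Poly_Mapping.single 0 t dvd c"
proof -
  have "qvar - Poly_Mapping.single 0 t dvd c - Poly_Mapping.single 0 (laurent_eval t c)"
    using subset_UNIV[of "Poly_Mapping.keys c"]
  proof (induction rule: keys_subset_induct)
    case (single m a)
    have "Poly_Mapping.single m a - Poly_Mapping.single 0 (laurent_eval t (Poly_Mapping.single m a)) =
      Poly_Mapping.single 0 a * (Poly_Mapping.single m 1 - Poly_Mapping.single 0 (t powi m))"
      by (simp add: right_diff_distrib mult_single)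
    then show ?case using dvd_mult[OF qvar_minus_dvd_monomial[OF assms(1), of m]] by metis
  next
    case (add x y)
    have "x + y - Poly_Mapping.single 0 (laurent_eval t (x + y)) =
      (x - Poly_Mapping.single 0 (laurent_eval t x)) + (y - Poly_Mapping.single 0 (laurent_eval t y))"
      by (simp add: laurent_eval_simps single_add)
    then show ?case using add by (metis dvd_add)
  qed (simp add: laurent_eval_simps)
  then show ?thesis using assms(2) by simp
qed

abbreviation spec :: "'k::field \<Rightarrow> ('b \<Rightarrow>\<^sub>0 'k laurent) \<Rightarrow> ('b \<Rightarrow>\<^sub>0 'k)" where
  "spec t \<equiv> coeff_map (laurent_eval t)"

lemmas additive_spec = additive_coeff_map[OF additive_laurent_eval]

lemma spec_single: "spec t (Poly_Mapping.single b c) = Poly_Mapping.single b (laurent_eval t c)"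
  by (rule poly_mapping_eqI) (simp add: lookup_coeff_map laurent_eval_simps lookup_single when_def)

lemmas spec_simps = additive.add[OF additive_spec] additive.zero[OF additive_spec]
  additive.diff[OF additive_spec] spec_single

lemma spec_basis_mult:
  assumes "t \<noteq> 0"
  shows "spec t (basis_mult p x y) = basis_mult p (spec t x) (spec t y)"
proof (rule additive_eq_on[where x = x and B = UNIV])
  fix b c
  show "spec t (basis_mult p (Poly_Mapping.single b c) y) = basis_mult p (spec t (Poly_Mapping.single b c)) (spec t y)"
    by (rule additive_eq_on[where x = y and B = UNIV])
      (simp_all add: additive_def spec_simps basis_mult_simps basis_term_def laurent_eval_mult assms split: option.split)
qed (simp_all add: additive_def spec_simps basis_mult_simps)

lemma spec_scale:
  assumes "t \<noteq> 0"
  shows "spec t (coeff_map ((*) c) x) = coeff_map ((*) (laurent_eval t c)) (spec t x)"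
  by (rule poly_mapping_eqI) (simp add: lookup_coeff_map laurent_eval_simps laurent_eval_mult assms)

lemma spec_lift:
  obtains y where "spec t y = x" "Poly_Mapping.keys y \<subseteq> Poly_Mapping.keys x"
proof
  show "spec t (coeff_map (Poly_Mapping.single 0) x) = x"
    by (rule poly_mapping_eqI) (simp add: lookup_coeff_map laurent_eval_simps)
qed (rule keys_coeff_map)

text \<open>
  A Laurent polynomial vanishing at \<open>t\<close> is a multiple of \<open>q - t\<close>, and the quotients for the finitely
  many coefficients are collected into one element.
\<close>

lemma spec_kernel:
  fixes t :: "'k::field"
  assumes "t \<noteq> 0" "spec t x = 0"
  obtains y where "x = coeff_map ((*) (qvar - Poly_Mapping.single 0 t)) y" "Poly_Mapping.keys y \<subseteq> Poly_Mapping.keys x"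
proof -
  \<comment> \<open>zero coefficients get the quotient zero, so that the quotients are finitely supported\<close>
  have "\<exists>d. Poly_Mapping.lookup x b = (qvar - Poly_Mapping.single 0 t) * d \<and> (Poly_Mapping.lookup x b = 0 \<longrightarrow> d = 0)" for b
  proof (cases "Poly_Mapping.lookup x b = 0")
    case False
    have "laurent_eval t (Poly_Mapping.lookup x b) = 0"
      using arg_cong[OF assms(2), of "\<lambda>z. Poly_Mapping.lookup z b"]
      by (simp add: lookup_coeff_map laurent_eval_simps)
    from laurent_eval_eq_0_imp_dvd[OF assms(1) this] show ?thesis using False by (auto elim: dvdE)
  qed simp
  then obtain d where d: "Poly_Mapping.lookup x b = (qvar - Poly_Mapping.single 0 t) * d b"
    "Poly_Mapping.lookup x b = 0 \<Longrightarrow> d b = 0" for b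
    by metis
  define y where "y = (\<Sum>b\<in>Poly_Mapping.keys x. Poly_Mapping.single b (d b))"
  have y: "Poly_Mapping.lookup y b = d b" for b
    using d(2)[of b] by (simp add: y_def lookup_sum lookup_single when_def in_keys_iff sum.delta)
  show thesis
  proof
    show "x = coeff_map ((*) (qvar - Poly_Mapping.single 0 t)) y"
      by (rule poly_mapping_eqI) (simp add: lookup_coeff_map y d(1))
    show "Poly_Mapping.keys y \<subseteq> Poly_Mapping.keys x"
      using d(2) by (auto simp: in_keys_iff y)
  qed
qed

text \<open>
  Base change commutes with presenting an algebra by relations. Evaluation of coefficients is onto,
  so the image of the ideal of relations over the Laurent polynomials is an ideal, and it contains the
  evaluated relations. Hence a class that evaluates to zero has a representative of which all
  coefficients vanish at \<open>t\<close>, and such an element is divisible by \<open>q - t\<close>.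
\<close>

lemma specialisation_quotient:
  fixes t :: "'k::field"
  assumes t: "t \<noteq> 0"
    and K: "presented_algebra (basis_galgebra B p e dg) S"
    and k: "presented_algebra (basis_galgebra B p e' dg) S'"
    and e: "spec t e = e'" and S: "spec t ` S = S'"
  defines "cls \<equiv> quot_class (basis_galgebra B p e' dg) S'"
    and "clsK \<equiv> quot_class (basis_galgebra B p e dg) S"
  shows "quot_lift (cls \<circ> spec t) \<in>
      specialisation t (quot_galgebra (basis_galgebra B p e dg) S) (quot_galgebra (basis_galgebra B p e' dg) S')"
    and "Poly_Mapping.keys x \<subseteq> B \<Longrightarrow> quot_lift (cls \<circ> spec t) (clsK x) = cls (spec t x)"
proof -
  let ?K = "basis_galgebra B p e dg" and ?k = "basis_galgebra B p e' dg"
  interpret K: presented_algebra ?K S by (rule K)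
  interpret k: presented_algebra ?k S' by (rule k)
  have closed: "spec t x \<in> carrier ?k" if "x \<in> carrier ?K" for x
    using that keys_coeff_map[of "laurent_eval t" x] by (auto simp: basis_galgebra_simps)
  have lift: "\<exists>y\<in>carrier ?K. spec t y = x" if "x \<in> carrier ?k" for x
    using that by (rule_tac spec_lift[of t x]) (auto simp: basis_galgebra_simps)
  have spec_hom: "spec t \<in> ring_hom ?K ?k"
    by (rule ring_hom_memI)
      (simp_all add: closed, simp_all add: basis_galgebra_simps spec_basis_mult t spec_simps e)
  have "k.cls \<in> ring_hom ?k k.quot"
    using k.cls_hom by (simp add: alg_hom_def)
  with spec_hom have hom: "k.cls \<circ> spec t \<in> ring_hom ?K k.quot"
    by (rule ring_hom_trans)
  have zero: "(k.cls \<circ> spec t) s = \<zero>\<^bsub>k.quot\<^esub>" if "s \<in> S" for s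
  proof -
    have "spec t s \<in> Idl\<^bsub>?k\<^esub> S'" "spec t s \<in> carrier ?k"
      using S that k.genideal_self[OF k.relations_closed] k.relations_closed by auto
    then show ?thesis
      by (simp add: k.zero_quot k.cls_eq_iff a_minus_def)
  qed
  let ?s = "quot_lift (k.cls \<circ> spec t)"
  have val: "?s (K.cls x) = k.cls (spec t x)" if "x \<in> carrier ?K" for x
    using K.quot_lift_cls[OF k.ring_quot hom zero that] by (simp add: comp_def)
  then show "Poly_Mapping.keys x \<subseteq> B \<Longrightarrow> quot_lift (cls \<circ> spec t) (clsK x) = cls (spec t x)"
    by (simp add: basis_galgebra_simps cls_def clsK_def)
  have 1: "?s \<in> ring_hom K.quot k.quot"
    by (rule K.quot_lift_hom[OF k.ring_quot hom zero])
  have smult: "?s (c \<odot>\<^bsub>K.quot\<^esub> X) = laurent_eval t c \<odot>\<^bsub>k.quot\<^esub> ?s X" if X: "X \<in> carrier K.quot" for c X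
  proof -
    obtain x where x: "x \<in> carrier ?K" "X = K.cls x" using X by (auto simp: K.carrier_quot)
    have "spec t (c \<odot>\<^bsub>?K\<^esub> x) = laurent_eval t c \<odot>\<^bsub>?k\<^esub> spec t x"
      by (simp add: basis_galgebra_simps spec_scale t)
    then show ?thesis
      using x K.smult_closed[OF x(1), of c] closed[OF x(1)]
      by (simp add: K.smult_quot k.smult_quot val)
  qed
  have carrier: "?s ` carrier K.quot = carrier k.quot"
    unfolding K.carrier_quot k.carrier_quot
  proof (intro equalityI subsetI)
    fix X assume "X \<in> k.cls ` carrier ?k"
    then obtain x where "x \<in> carrier ?K" "X = k.cls (spec t x)" using lift by blast
    then show "X \<in> ?s ` K.cls ` carrier ?K" using val by (metis imageI)
  qed (use val closed in auto)
  have hcomp: "?s ` hcomp K.quot d = hcomp k.quot d" for d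
    unfolding K.hcomp_quot k.hcomp_quot
  proof (intro equalityI subsetI)
    fix X assume "X \<in> k.cls ` hcomp ?k d"
    then obtain x where x: "Poly_Mapping.keys x \<subseteq> {b \<in> B. dg b = d}" "X = k.cls x"
      by (auto simp: basis_galgebra_simps)
    obtain y where y: "spec t y = x" "Poly_Mapping.keys y \<subseteq> Poly_Mapping.keys x" by (rule spec_lift)
    then have "y \<in> hcomp ?K d" "y \<in> carrier ?K" using x by (auto simp: basis_galgebra_simps)
    then show "X \<in> ?s ` K.cls ` hcomp ?K d" using val[of y] y(1) x(2) by (metis imageI)
  next
    fix X assume "X \<in> ?s ` K.cls ` hcomp ?K d"
    then obtain x where x: "x \<in> hcomp ?K d" "X = ?s (K.cls x)" by blast
    then have "x \<in> carrier ?K" by (auto simp: basis_galgebra_simps)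
    then have "X = k.cls (spec t x)" using val x by simp
    moreover have "spec t x \<in> hcomp ?k d"
      using x keys_coeff_map[of "laurent_eval t" x] by (auto simp: basis_galgebra_simps)
    ultimately show "X \<in> k.cls ` hcomp ?k d" by blast
  qed
  let ?c = "qvar - Poly_Mapping.single 0 t"
  interpret spec: ring_hom_ring ?K ?k "spec t"
    by (rule ring_hom_ringI2[OF K.ring_axioms k.ring_axioms spec_hom])
  have "ideal (spec t ` (Idl\<^bsub>?K\<^esub> S)) ?k"
  proof (rule idealI[OF k.ring_axioms])
    show "subgroup (spec t ` (Idl\<^bsub>?K\<^esub> S)) (add_monoid ?k)"
      using spec.img_is_add_subgroup K.I.a_subgroup by blast
  next
    fix a x assume "a \<in> spec t ` (Idl\<^bsub>?K\<^esub> S)" and x: "x \<in> carrier ?k"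
    then obtain b where b: "b \<in> Idl\<^bsub>?K\<^esub> S" "a = spec t b" by blast
    obtain y where y: "y \<in> carrier ?K" "spec t y = x" using lift[OF x] by blast
    have "spec t (y \<otimes>\<^bsub>?K\<^esub> b) = x \<otimes>\<^bsub>?k\<^esub> a" "spec t (b \<otimes>\<^bsub>?K\<^esub> y) = a \<otimes>\<^bsub>?k\<^esub> x"
      using b y by (simp_all add: basis_galgebra_simps spec_basis_mult t)
    then show "x \<otimes>\<^bsub>?k\<^esub> a \<in> spec t ` (Idl\<^bsub>?K\<^esub> S)" "a \<otimes>\<^bsub>?k\<^esub> x \<in> spec t ` (Idl\<^bsub>?K\<^esub> S)"
      using K.I.I_l_closed[OF b(1) y(1)] K.I.I_r_closed[OF b(1) y(1)] by (metis imageI)+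
  qed
  moreover have "S' \<subseteq> spec t ` (Idl\<^bsub>?K\<^esub> S)"
    using S K.genideal_self[OF K.relations_closed] by blast
  \<comment> \<open>relations over the field lift to relations over the Laurent polynomials\<close>
  ultimately have ideal: "Idl\<^bsub>?k\<^esub> S' \<subseteq> spec t ` (Idl\<^bsub>?K\<^esub> S)"
    by (rule k.genideal_minimal)
  have "X \<in> (\<lambda>X. ?c \<odot>\<^bsub>K.quot\<^esub> X) ` carrier K.quot"
    if X: "X \<in> carrier K.quot" "?s X = \<zero>\<^bsub>k.quot\<^esub>" for X
  proof -
    obtain x where x: "x \<in> carrier ?K" "X = K.cls x" using X by (auto simp: K.carrier_quot)
    then have "k.cls (spec t x) = k.cls \<zero>\<^bsub>?k\<^esub>" using X val by (simp add: k.zero_quot)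
    then have "spec t x \<in> Idl\<^bsub>?k\<^esub> S'"
      using closed[OF x(1)] by (simp add: k.cls_eq_iff a_minus_def)
    then obtain z where z: "z \<in> Idl\<^bsub>?K\<^esub> S" "spec t x = spec t z" using ideal by blast
    have zc: "z \<in> carrier ?K" using z(1) by (rule K.I.Icarr)
    have "spec t (x - z) = 0" using z(2) by (simp add: spec_simps)
    then obtain y where y: "x - z = coeff_map ((*) ?c) y" "Poly_Mapping.keys y \<subseteq> Poly_Mapping.keys (x - z)"
      by (rule spec_kernel[OF t])
    have "y \<in> carrier ?K"
      using y(2) keys_diff_subset[of x B z] x(1) zc by (auto simp: basis_galgebra_simps)
    moreover have "x = (?c \<odot>\<^bsub>?K\<^esub> y) \<oplus>\<^bsub>?K\<^esub> z"
      using y(1) by (simp add: basis_galgebra_simps algebra_simps)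
    moreover have "K.cls z = K.cls \<zero>\<^bsub>?K\<^esub>"
      using z(1) zc by (simp add: K.cls_eq_iff a_minus_def)
    ultimately have "X = ?c \<odot>\<^bsub>K.quot\<^esub> K.cls y \<oplus>\<^bsub>K.quot\<^esub> \<zero>\<^bsub>K.quot\<^esub>" "K.cls y \<in> carrier K.quot"
      using x zc K.add_quot[of "?c \<odot>\<^bsub>?K\<^esub> y" z] K.smult_closed[of y ?c]
      by (simp_all add: K.smult_quot K.zero_quot)
    then show ?thesis by (metis K.Q.r_zero K.Q.smult_closed imageI)
  qed
  moreover have "?c \<odot>\<^bsub>K.quot\<^esub> X \<in> carrier K.quot \<and> ?s (?c \<odot>\<^bsub>K.quot\<^esub> X) = \<zero>\<^bsub>k.quot\<^esub>"
    if X: "X \<in> carrier K.quot" for X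
  proof -
    obtain x where x: "x \<in> carrier ?k" "?s X = k.cls x"
      using carrier X unfolding k.carrier_quot by blast
    have "laurent_eval t ?c = 0" by (simp add: laurent_eval_simps laurent_eval_qvar)
    moreover have "coeff_map ((*) 0) x = 0"
      by (rule poly_mapping_eqI) (simp add: lookup_coeff_map)
    ultimately show ?thesis
      using smult[OF X, of ?c] x X
      by (simp add: k.smult_quot k.zero_quot basis_galgebra_simps)
  qed
  ultimately have "a_kernel K.quot k.quot ?s = (\<lambda>X. ?c \<odot>\<^bsub>K.quot\<^esub> X) ` carrier K.quot"
    unfolding a_kernel_def' by blast
  with 1 smult carrier hcomp show "quot_lift (cls \<circ> spec t) \<in> specialisation t K.quot k.quot"
    unfolding specialisation_def cls_def by blast
qed

lemma Lam_rels_spec: "spec t ` Lam_rels n qvar = Lam_rels n t"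
  unfolding Lam_rels_def image_image
  by (simp add: Let_def spec_simps laurent_eval_1 laurent_eval_qvar)

lemma R_rels_spec: "spec t ` R_rels n qvar = R_rels n t"
  unfolding R_rels_def image_UN
  by (simp add: spec_simps laurent_eval_1 laurent_eval_qvar)

lemma spec_path_entry: "spec t (path_entry i j x) = path_entry i j (spec t x)"
  by (rule additive_eq_on[where x = x and B = UNIV])
    (auto simp: additive_def path_entry_simps spec_simps)

text \<open>
  Evaluating coefficients commutes with reading off the entries of the matrix of a path.
\<close>

lemma specialises_to_iota_R:
  fixes t :: "'k::field"
  assumes t: "t \<noteq> 0"
  shows "specialises_to n t (iota_R n qvar) (iota_R n t)"
proof -
  let ?s = "quot_lift (quot_class (path_galgebra (quiver n)) (Lam_rels n t) \<circ> spec t)"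
  let ?r = "quot_lift (quot_class (free_galgebra (R_gens n)) (R_rels n t) \<circ> spec t)"
  interpret LK: presented_algebra "path_galgebra (quiver n)" "Lam_rels n (qvar :: 'k laurent)"
    by (rule presented_Lam)
  have eP: "spec t (\<Sum>v\<in>verts (quiver n). Poly_Mapping.single (v, [], v) 1) =
      (\<Sum>v\<in>verts (quiver n). Poly_Mapping.single (v, [], v) 1)"
    by (simp add: additive.sum[OF additive_spec] spec_simps laurent_eval_1)
  have eF: "spec t (Poly_Mapping.single [] 1) = Poly_Mapping.single [] 1"
    by (simp add: spec_simps laurent_eval_1)
  note s = specialisation_quotient[OF t
      presented_Lam[of n qvar, unfolded path_galgebra_def]
      presented_Lam[of n t, unfolded path_galgebra_def] eP Lam_rels_spec]
  note r = specialisation_quotient[OF t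
      presented_R[of n qvar, unfolded free_galgebra_def]
      presented_R[of n t, unfolded free_galgebra_def] eF R_rels_spec]
  have s1: "?s \<in> specialisation t (Lam_alg n qvar) (Lam_alg n t)"
    using s(1) unfolding path_galgebra_def paths_def Lam_alg_def .
  have s2: "?s (quot_class (path_galgebra (quiver n)) (Lam_rels n qvar) x) =
      quot_class (path_galgebra (quiver n)) (Lam_rels n t) (spec t x)"
    if "Poly_Mapping.keys x \<subseteq> paths n" for x
    using s(2) that unfolding path_galgebra_def paths_def by blast
  have r1: "?r \<in> specialisation t (R_alg n qvar) (R_alg n t)"
    using r(1) unfolding free_galgebra_def R_alg_def .
  have r2: "?r (quot_class (free_galgebra (R_gens n)) (R_rels n qvar) x) =
      quot_class (free_galgebra (R_gens n)) (R_rels n t) (spec t x)"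
    if "Poly_Mapping.keys x \<subseteq> lists (R_gens n)" for x
    using r(2) that unfolding free_galgebra_def by blast
  have intertwine: "iota_R n t (?s X) = mat_map ?r (iota_R n qvar X)" if "X \<in> carrier (Lam_alg n qvar)" for X
  proof -
    obtain x where X: "X = LK.cls x" and x: "Poly_Mapping.keys x \<subseteq> paths n"
      using \<open>X \<in> carrier (Lam_alg n qvar)\<close> by (auto simp: Lam_alg_def LK.carrier_quot path_galgebra_simps)
    have "Poly_Mapping.keys (spec t x) \<subseteq> paths n"
      by (rule subset_trans[OF keys_coeff_map x])
    then have "iota_R n t (?s X) = path_matrix n t (spec t x)"
      by (simp add: X s2[OF x] iota_R_cls)
    moreover have "Poly_Mapping.keys (path_entry i j x) \<subseteq> lists (R_gens n)" for i j
      using path_entry_closed[OF x] by (simp add: free_galgebra_simps)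
    then have "mat_map ?r (iota_R n qvar X) = path_matrix n t (spec t x)"
      by (simp add: X iota_R_cls[OF x] fun_eq_iff mat_map_def path_matrix_def r2 spec_path_entry)
    ultimately show ?thesis by simp
  qed
  have vertex: "?s (Lam_vertex n qvar i) = Lam_vertex n t i" if "i \<in> {0..n}" for i
    using s2[of "Poly_Mapping.single (i, [], i) 1"] that
    by (simp add: Lam_vertex_def mem_paths spec_simps laurent_eval_1)
  have arrow: "?s (Lam_arrow n qvar x) = Lam_arrow n t x" if "x \<in> arcs (quiver n)" for x
    using s2[of "Poly_Mapping.single (arrow_tail n x, [x], arrow_head n x) 1"] that arrow_ends[OF that]
    by (simp add: Lam_arrow_def mem_paths spec_simps laurent_eval_1)
  have gen: "?r (R_gen n qvar x) = R_gen n t x" if "x \<in> R_gens n" for x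
    using r2[of "Poly_Mapping.single [x] 1"] that
    by (simp add: R_gen_def spec_simps laurent_eval_1)
  show ?thesis
    unfolding specialises_to_def
    by (intro bexI[OF _ s1] bexI[OF _ r1] conjI ballI intertwine vertex arrow gen)
qed

section \<open>Generators\<close>

lemma R_alg_induct [consumes 1, case_names one gen add mult smult]:
  fixes q :: "'f::comm_ring_1"
  assumes X: "X \<in> carrier (R_alg n q)"
    and one: "P \<one>\<^bsub>R_alg n q\<^esub>"
    and gen: "\<And>x. x \<in> R_gens n \<Longrightarrow> P (R_gen n q x)"
    and add: "\<And>X Y. X \<in> carrier (R_alg n q) \<Longrightarrow> Y \<in> carrier (R_alg n q) \<Longrightarrow> P X \<Longrightarrow> P Y \<Longrightarrow> P (X \<oplus>\<^bsub>R_alg n q\<^esub> Y)"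
    and mult: "\<And>X Y. X \<in> carrier (R_alg n q) \<Longrightarrow> Y \<in> carrier (R_alg n q) \<Longrightarrow> P X \<Longrightarrow> P Y \<Longrightarrow> P (X \<otimes>\<^bsub>R_alg n q\<^esub> Y)"
    and smult: "\<And>c X. X \<in> carrier (R_alg n q) \<Longrightarrow> P X \<Longrightarrow> P (c \<odot>\<^bsub>R_alg n q\<^esub> X)"
  shows "P X"
proof -
  interpret R: presented_algebra "free_galgebra (R_gens n)" "R_rels n q"
    by (rule presented_R)
  have word: "P (R.cls (Poly_Mapping.single w 1))" if "w \<in> lists (R_gens n)" for w
    using that
  proof (induction w)
    case Nil
    then show ?case using one by (simp add: R_alg_def R.one_quot free_galgebra_simps)
  next
    case (Cons x w)
    have c: "Poly_Mapping.single [x] (1::'f) \<in> carrier (free_galgebra (R_gens n))"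
      "Poly_Mapping.single w (1::'f) \<in> carrier (free_galgebra (R_gens n))"
      using Cons.hyps by (simp_all add: free_galgebra_simps)
    have "P (R.cls (Poly_Mapping.single [x] 1) \<otimes>\<^bsub>R_alg n q\<^esub> R.cls (Poly_Mapping.single w 1))"
      by (rule mult) (use c gen[of x] Cons in \<open>simp_all add: R_alg_def R_gen_def\<close>)
    then show ?case
      using R.mult_quot[OF c] by (simp add: R_alg_def free_galgebra_simps word_mult_single)
  qed
  have monomial: "P (R.cls (Poly_Mapping.single w c))" if "w \<in> lists (R_gens n)" for w c
  proof -
    have k: "Poly_Mapping.single w (1::'f) \<in> carrier (free_galgebra (R_gens n))"
      using that by (simp add: free_galgebra_simps)
    have "P (c \<odot>\<^bsub>R_alg n q\<^esub> R.cls (Poly_Mapping.single w 1))"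
      by (rule smult) (use k word[OF that] in \<open>simp_all add: R_alg_def\<close>)
    then show ?thesis
      using R.smult_quot[OF k, of c] by (simp add: R_alg_def free_galgebra_simps scale_single)
  qed
  have "P (R.cls x)" if "Poly_Mapping.keys x \<subseteq> lists (R_gens n)" for x
    using that
  proof (induction rule: keys_subset_induct)
    case zero
    then show ?case using monomial[of "[]" 0] by simp
  next
    case (add x y)
    then have c: "x \<in> carrier (free_galgebra (R_gens n))" "y \<in> carrier (free_galgebra (R_gens n))"
      by (simp_all add: free_galgebra_simps)
    have "P (R.cls x \<oplus>\<^bsub>R_alg n q\<^esub> R.cls y)"
      by (rule assms(4)) (use add c in \<open>simp_all add: R_alg_def\<close>)
    then show ?case using R.add_quot[OF c] by (simp add: R_alg_def free_galgebra_simps)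
  qed (rule monomial)
  then show ?thesis using X by (auto simp: R_alg_def R.carrier_quot free_galgebra_simps)
qed

text \<open>
  Every path is a product of arrows, or is trivial, and all classes are combinations of paths.
\<close>

lemma Lam_alg_induct [consumes 1, case_names vertex arrow add mult smult]:
  fixes q :: "'f::comm_ring_1"
  assumes X: "X \<in> carrier (Lam_alg n q)"
    and vertex: "\<And>i. i \<le> n \<Longrightarrow> P (Lam_vertex n q i)"
    and arrow: "\<And>x. x \<in> arcs (quiver n) \<Longrightarrow> P (Lam_arrow n q x)"
    and add: "\<And>X Y. X \<in> carrier (Lam_alg n q) \<Longrightarrow> Y \<in> carrier (Lam_alg n q) \<Longrightarrow> P X \<Longrightarrow> P Y \<Longrightarrow> P (X \<oplus>\<^bsub>Lam_alg n q\<^esub> Y)"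
    and mult: "\<And>X Y. X \<in> carrier (Lam_alg n q) \<Longrightarrow> Y \<in> carrier (Lam_alg n q) \<Longrightarrow> P X \<Longrightarrow> P Y \<Longrightarrow> P (X \<otimes>\<^bsub>Lam_alg n q\<^esub> Y)"
    and smult: "\<And>c X. X \<in> carrier (Lam_alg n q) \<Longrightarrow> P X \<Longrightarrow> P (c \<odot>\<^bsub>Lam_alg n q\<^esub> X)"
  shows "P X"
proof -
  interpret L: presented_algebra "path_galgebra (quiver n)" "Lam_rels n q"
    by (rule presented_Lam)
  have path: "P (L.cls (Poly_Mapping.single (u, p, v) 1))" if "(u, p, v) \<in> paths n" for u p v
    using that
  proof (induction p arbitrary: u)
    case Nil
    then show ?case using vertex[of u] by (simp add: mem_paths Lam_vertex_def)
  next
    case (Cons x p)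
    then have x: "x \<in> arcs (quiver n)" "arrow_tail n x = u" "(arrow_head n x, p, v) \<in> paths n"
      by (simp_all add: mem_paths)
    have c: "Poly_Mapping.single (u, [x], arrow_head n x) (1::'f) \<in> carrier (path_galgebra (quiver n))"
      "Poly_Mapping.single (arrow_head n x, p, v) (1::'f) \<in> carrier (path_galgebra (quiver n))"
      using x arrow_ends[of x n] by (simp_all add: path_galgebra_simps mem_paths)
    have "P (L.cls (Poly_Mapping.single (u, [x], arrow_head n x) 1) \<otimes>\<^bsub>Lam_alg n q\<^esub>
        L.cls (Poly_Mapping.single (arrow_head n x, p, v) 1))"
      by (rule mult) (use c x arrow[of x] Cons.IH[OF x(3)] in \<open>simp_all add: Lam_alg_def Lam_arrow_def\<close>)
    then show ?case
      using L.mult_quot[OF c] by (simp add: Lam_alg_def path_galgebra_simps basis_mult_single basis_term_def)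
  qed
  have monomial: "P (L.cls (Poly_Mapping.single b c))" if "b \<in> paths n" for b c
  proof -
    obtain u p v where b: "b = (u, p, v)" by (cases b)
    have k: "Poly_Mapping.single b (1::'f) \<in> carrier (path_galgebra (quiver n))"
      using that by (simp add: path_galgebra_simps)
    have "P (c \<odot>\<^bsub>Lam_alg n q\<^esub> L.cls (Poly_Mapping.single b 1))"
      by (rule smult) (use k path[of u p v] that b in \<open>simp_all add: Lam_alg_def\<close>)
    then show ?thesis
      using L.smult_quot[OF k, of c] by (simp add: Lam_alg_def path_galgebra_simps scale_single)
  qed
  have "P (L.cls x)" if "Poly_Mapping.keys x \<subseteq> paths n" for x
    using that
  proof (induction rule: keys_subset_induct)
    case zero
    then show ?case using monomial[of "(0, [], 0)" 0] by (simp add: mem_paths)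
  next
    case (add x y)
    then have c: "x \<in> carrier (path_galgebra (quiver n))" "y \<in> carrier (path_galgebra (quiver n))"
      by (simp_all add: path_galgebra_simps)
    have "P (L.cls x \<oplus>\<^bsub>Lam_alg n q\<^esub> L.cls y)"
      by (rule assms(4)) (use add c in \<open>simp_all add: Lam_alg_def\<close>)
    then show ?case using L.add_quot[OF c] by (simp add: Lam_alg_def path_galgebra_simps)
  qed (rule monomial)
  then show ?thesis using X by (auto simp: Lam_alg_def L.carrier_quot path_galgebra_simps)
qed

section \<open>The quantum plane in low degree\<close>

definition linear_form :: "'f::comm_ring_1 \<Rightarrow> 'f \<Rightarrow> (agen list \<Rightarrow>\<^sub>0 'f)" where
  "linear_form a b = Poly_Mapping.single [GenU] a + Poly_Mapping.single [GenV] b"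

lemma linear_form_carrier: "linear_form a b \<in> carrier (free_galgebra UNIV)"
  by (simp add: free_galgebra_simps)

lemma linear_form_eq_lookup:
  assumes "Poly_Mapping.keys x \<subseteq> {w. length w = 1}"
  shows "x = linear_form (Poly_Mapping.lookup x [GenU]) (Poly_Mapping.lookup x [GenV])"
proof (rule poly_mapping_eqI)
  fix w
  show "Poly_Mapping.lookup x w =
    Poly_Mapping.lookup (linear_form (Poly_Mapping.lookup x [GenU]) (Poly_Mapping.lookup x [GenV])) w"
  proof (cases "length w = 1")
    case True
    then obtain g where "w = [g]" by (auto simp: length_Suc_conv)
    then show ?thesis by (cases g) (simp_all add: linear_form_def lookup_add lookup_single)
  next
    case False
    then have "Poly_Mapping.lookup x w = 0" using assms by (auto simp: in_keys_iff)
    then show ?thesis using False by (auto simp: linear_form_def lookup_add lookup_single when_def)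
  qed
qed

lemma linear_form_mult:
  "word_mult (linear_form a b) (linear_form c d) =
    Poly_Mapping.single [GenU, GenU] (a * c) + Poly_Mapping.single [GenU, GenV] (a * d) +
    Poly_Mapping.single [GenV, GenU] (b * c) + Poly_Mapping.single [GenV, GenV] (b * d)"
  by (simp add: linear_form_def basis_mult_simps basis_term_def)

text \<open>
  In degree two, reducing \<open>v u\<close> to \<open>q u v\<close> leaves the basis \<open>u\<^sup>2\<close>, \<open>u v\<close>, \<open>v\<^sup>2\<close>. These are the three
  coordinates in that basis; all of them vanish on the relation.
\<close>

lemma A_ideal_coefficients:
  assumes "x \<in> Idl\<^bsub>free_galgebra UNIV\<^esub> {A_rel (q::'f::comm_ring_1)}"
  shows "Poly_Mapping.lookup x [GenU, GenU] = 0"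
    and "Poly_Mapping.lookup x [GenV, GenV] = 0"
    and "Poly_Mapping.lookup x [GenU, GenV] + q * Poly_Mapping.lookup x [GenV, GenU] = 0"
proof -
  have keys: "Poly_Mapping.keys s \<subseteq> {w \<in> lists UNIV. length w = 2}" if "s \<in> {A_rel q}" for s
    using that keys_binomial[of "[GenV, GenU]" 1 "[GenU, GenV]" q] by auto
  note kills = additive_kills_quadratic_ideal[OF keys _ _ _ assms]
  show "Poly_Mapping.lookup x [GenU, GenU] = 0" "Poly_Mapping.lookup x [GenV, GenV] = 0"
    by (rule kills; auto simp: additive_def lookup_add lookup_minus lookup_single lookup_coeff_map when_def)+
  show "Poly_Mapping.lookup x [GenU, GenV] + q * Poly_Mapping.lookup x [GenV, GenU] = 0"
  proof (rule kills[where f = "\<lambda>x. Poly_Mapping.lookup x [GenU, GenV] + q * Poly_Mapping.lookup x [GenV, GenU]"])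
    fix s c assume "s \<in> {A_rel q}"
    then have s: "s = A_rel q" by simp
    show "Poly_Mapping.lookup (coeff_map ((*) c) s) [GenU, GenV] + q * Poly_Mapping.lookup (coeff_map ((*) c) s) [GenV, GenU] = 0"
      unfolding s by (simp add: lookup_coeff_map lookup_minus lookup_single)
  qed (auto simp: additive_def lookup_add lookup_single when_def distrib_left)
qed

context
  fixes q :: "'f::comm_ring_1"
begin

interpretation A: presented_algebra "free_galgebra UNIV" "{A_rel q}"
  by (rule presented_A)

definition A_linear :: "'f \<Rightarrow> 'f \<Rightarrow> 'f A_elt" where
  "A_linear a b = A.cls (linear_form a b)"

lemma ground_algebra_A: "ground_algebra (A_alg q)"
  unfolding A_alg_def by (rule A.Q.ground_algebra_axioms)

lemma A_linear_carrier: "A_linear a b \<in> carrier (A_alg q)"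
  by (simp add: A_linear_def A_alg_def linear_form_carrier)

lemma A_linear_0: "A_linear 0 0 = \<zero>\<^bsub>A_alg q\<^esub>"
  by (simp add: A_linear_def A_alg_def A.zero_quot linear_form_def free_galgebra_simps)

lemma A_degree_one:
  assumes "X \<in> hcomp (A_alg q) 1"
  shows "\<exists>a b. X = A_linear a b"
proof -
  obtain x where x: "X = A.cls x" "x \<in> hcomp (free_galgebra UNIV) 1"
    using assms unfolding A_alg_def A.hcomp_quot by blast
  then have "Poly_Mapping.keys x \<subseteq> {w. length w = 1}"
    by (auto simp: free_galgebra_simps)
  from linear_form_eq_lookup[OF this] show ?thesis
    unfolding x(1) A_linear_def by metis
qed

text \<open>
  Comparison of the coordinates at \<open>u\<^sup>2\<close>, \<open>v\<^sup>2\<close> and \<open>u v\<close> of the two sides. The coefficient of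
  \<open>v u\<close> enters the third one with a factor \<open>q\<close>.
\<close>

lemma A_quadratic_relation:
  assumes "A_linear c d \<otimes>\<^bsub>A_alg q\<^esub> A_linear a b =
    q \<odot>\<^bsub>A_alg q\<^esub> (A_linear a' b' \<otimes>\<^bsub>A_alg q\<^esub> A_linear c' d')"
  shows "c * a = q * (a' * c')" "d * b = q * (b' * d')"
    "c * b + q * (d * a) = q * (a' * d' + q * (b' * c'))"
proof -
  let ?F = "free_galgebra UNIV :: ('f, agen list \<Rightarrow>\<^sub>0 'f) galgebra"
  let ?x = "word_mult (linear_form c d) (linear_form a b)"
  let ?y = "coeff_map ((*) q) (word_mult (linear_form a' b') (linear_form c' d'))"
  have k: "x \<in> carrier ?F" for x by (simp add: free_galgebra_simps)
  have "\<ominus>\<^bsub>?F\<^esub> y = - y" for y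
    by (rule A.minus_equality) (simp_all add: k, simp add: free_galgebra_simps)
  then have minus: "x \<ominus>\<^bsub>?F\<^esub> y = x - y" for x y
    by (simp add: a_minus_def free_galgebra_simps)
  have "A.cls ?x = A.cls ?y"
    using assms A.mult_quot[OF k k, of "linear_form c d" "linear_form a b"]
      A.mult_quot[OF k k, of "linear_form a' b'" "linear_form c' d'"]
      A.smult_quot[OF k, of q "word_mult (linear_form a' b') (linear_form c' d')"]
    by (simp add: A_linear_def A_alg_def free_galgebra_simps)
  then have "?x - ?y \<in> Idl\<^bsub>?F\<^esub> {A_rel q}"
    using A.cls_eq_iff[OF k k, of ?x ?y] minus by simp
  from A_ideal_coefficients[OF this]
  show "c * a = q * (a' * c')" "d * b = q * (b' * d')"
    "c * b + q * (d * a) = q * (a' * d' + q * (b' * c'))"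
    by (simp_all add: linear_form_mult lookup_minus lookup_add lookup_single lookup_coeff_map algebra_simps)
qed

fun rgen_letter :: "rgen \<Rightarrow> agen" where
  "rgen_letter (GenA i) = GenU"
| "rgen_letter (GenABar i) = GenV"

fun rgen_coeff :: "(nat \<Rightarrow> 'f) \<Rightarrow> (nat \<Rightarrow> 'f) \<Rightarrow> rgen \<Rightarrow> 'f" where
  "rgen_coeff a d (GenA i) = a i"
| "rgen_coeff a d (GenABar i) = d i"

text \<open>
  The substitution of the multiple \<open>a i\<close> of \<open>u\<close> for the generator with index \<open>i\<close>, and of the multiple
  \<open>d i\<close> of \<open>v\<close> for the barred one. It sends words to multiples of words.
\<close>

definition substitution :: "(nat \<Rightarrow> 'f) \<Rightarrow> (nat \<Rightarrow> 'f) \<Rightarrow> (rgen list \<Rightarrow>\<^sub>0 'f) \<Rightarrow> (agen list \<Rightarrow>\<^sub>0 'f)" where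
  "substitution a d = lin_ext (\<lambda>w c. Poly_Mapping.single (map rgen_letter w) (c * prod_list (map (rgen_coeff a d) w)))"

lemma additive_substitution: "additive (substitution a d)"
  unfolding substitution_def by (rule additive_lin_ext) (simp add: additive_def distrib_right single_add)

lemma substitution_single:
  "substitution a d (Poly_Mapping.single w c) =
    Poly_Mapping.single (map rgen_letter w) (c * prod_list (map (rgen_coeff a d) w))"
  by (simp add: substitution_def lin_ext_single)

lemmas substitution_simps = additive.add[OF additive_substitution] additive.zero[OF additive_substitution]
  additive.diff[OF additive_substitution] substitution_single

lemma substitution_mult:
  "substitution a d (word_mult x y) = word_mult (substitution a d x) (substitution a d y)"
proof (rule additive_eq_on[where x = x and B = UNIV])
  fix v r
  show "substitution a d (word_mult (Poly_Mapping.single v r) y) =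
      word_mult (substitution a d (Poly_Mapping.single v r)) (substitution a d y)"
    by (rule additive_eq_on[where x = y and B = UNIV])
      (simp_all add: additive_def basis_mult_simps basis_term_def substitution_simps mult.assoc mult.left_commute)
qed (simp_all add: additive_def basis_mult_simps substitution_simps)

lemma substitution_scale:
  "substitution a d (coeff_map ((*) c) x) = coeff_map ((*) c) (substitution a d x)"
  by (rule additive_eq_on[where x = x and B = UNIV])
    (simp_all add: additive_def substitution_simps additive.add[OF additive_scale] scale_single mult.assoc)

text \<open>
  Multiples of \<open>u\<close> commute, so do multiples of \<open>v\<close>, and \<open>v u = q u v\<close> gives the mixed relation. The
  remaining relations say that \<open>(a\<^sub>i u) (d\<^sub>i v)\<close> does not depend on \<open>i\<close>, which is the hypothesis.
\<close>

lemma substitution_alg_hom: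
  assumes ad: "\<And>i. i \<le> n \<Longrightarrow> a i * d i = a 0 * d 0"
  shows "\<exists>\<phi>\<in>alg_hom (R_alg n q) (A_alg q).
    (\<forall>i\<le>n. \<phi> (R_gen n q (GenA i)) = A_linear (a i) 0 \<and> \<phi> (R_gen n q (GenABar i)) = A_linear 0 (d i))"
proof -
  let ?F = "free_galgebra (R_gens n) :: ('f, rgen list \<Rightarrow>\<^sub>0 'f) galgebra"
  interpret R: presented_algebra ?F "R_rels n q" by (rule presented_R)
  have k: "x \<in> carrier (free_galgebra UNIV)" for x by (simp add: free_galgebra_simps)
  let ?f = "\<lambda>x. A.cls (substitution a d x)"
  have hom: "?f \<in> ring_hom ?F A.quot"
  proof (rule ring_hom_memI)
    fix x y
    show "?f (x \<otimes>\<^bsub>?F\<^esub> y) = ?f x \<otimes>\<^bsub>A.quot\<^esub> ?f y"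
      using A.mult_quot[OF k k] by (simp add: free_galgebra_simps substitution_mult)
    show "?f (x \<oplus>\<^bsub>?F\<^esub> y) = ?f x \<oplus>\<^bsub>A.quot\<^esub> ?f y"
      using A.add_quot[OF k k] by (simp add: free_galgebra_simps substitution_simps)
    show "?f \<one>\<^bsub>?F\<^esub> = \<one>\<^bsub>A.quot\<^esub>"
      by (simp add: A.one_quot free_galgebra_simps substitution_simps)
  qed (simp add: k)
  have rel: "A.cls (coeff_map ((*) c) (A_rel q)) = \<zero>\<^bsub>A.quot\<^esub>" for c
  proof -
    have "A_rel q \<in> Idl\<^bsub>free_galgebra UNIV\<^esub> {A_rel q}" by (rule A.genideal_self') (rule k)
    then have "coeff_map ((*) c) (A_rel q) \<in> Idl\<^bsub>free_galgebra UNIV\<^esub> {A_rel q}"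
      using A.ideal_smult[of "A_rel q" c] by (simp add: free_galgebra_simps)
    then show ?thesis using A.cls_eq_zero_iff[OF k] by blast
  qed
  have "\<exists>c. substitution a d s = coeff_map ((*) c) (A_rel q)" if "s \<in> R_rels n q" for s
  proof -
    have zero: "coeff_map ((*) 0) (A_rel q) = 0"
      by (rule poly_mapping_eqI) (simp add: lookup_coeff_map)
    have scaled: "coeff_map ((*) c) (A_rel q) =
        Poly_Mapping.single [GenV, GenU] c - Poly_Mapping.single [GenU, GenV] (c * q)" for c
      by (simp add: additive.diff[OF additive_scale] scale_single)
    from that obtain i j where ij: "i \<le> n" "j \<le> n" and
      "s = Poly_Mapping.single [GenA j, GenA i] 1 - Poly_Mapping.single [GenA i, GenA j] 1 \<or>
       s = Poly_Mapping.single [GenABar j, GenABar i] 1 - Poly_Mapping.single [GenABar i, GenABar j] 1 \<or>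
       s = Poly_Mapping.single [GenABar j, GenA i] 1 - Poly_Mapping.single [GenA i, GenABar j] q \<or>
       s = Poly_Mapping.single [GenA 0, GenABar 0] 1 - Poly_Mapping.single [GenA i, GenABar i] 1"
      unfolding R_rels_def by auto
    then show ?thesis
    proof (elim disjE)
      assume "s = Poly_Mapping.single [GenABar j, GenA i] 1 - Poly_Mapping.single [GenA i, GenABar j] q"
      then have "substitution a d s = coeff_map ((*) (d j * a i)) (A_rel q)"
        by (simp add: substitution_simps scaled mult_ac)
      then show ?thesis ..
    next
      assume "s = Poly_Mapping.single [GenA 0, GenABar 0] 1 - Poly_Mapping.single [GenA i, GenABar i] 1"
      then have "substitution a d s = coeff_map ((*) 0) (A_rel q)"
        unfolding zero using ad[OF ij(1)] by (simp add: substitution_simps)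
      then show ?thesis ..
    next
      assume "s = Poly_Mapping.single [GenA j, GenA i] 1 - Poly_Mapping.single [GenA i, GenA j] 1"
      then have "substitution a d s = coeff_map ((*) 0) (A_rel q)"
        unfolding zero by (simp add: substitution_simps mult.commute)
      then show ?thesis ..
    next
      assume "s = Poly_Mapping.single [GenABar j, GenABar i] 1 - Poly_Mapping.single [GenABar i, GenABar j] 1"
      then have "substitution a d s = coeff_map ((*) 0) (A_rel q)"
        unfolding zero by (simp add: substitution_simps mult.commute)
      then show ?thesis ..
    qed
  qed
  then have kills: "?f s = \<zero>\<^bsub>A.quot\<^esub>" if "s \<in> R_rels n q" for s
    using that rel by metis
  let ?\<phi> = "quot_lift ?f"
  have val: "?\<phi> (R.cls x) = ?f x" if "x \<in> carrier ?F" for x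
    by (rule R.quot_lift_cls[OF A.ring_quot hom kills that])
  have "?\<phi> \<in> ring_hom R.quot A.quot"
    by (rule R.quot_lift_hom[OF A.ring_quot hom kills])
  moreover have "?\<phi> (c \<odot>\<^bsub>R.quot\<^esub> X) = c \<odot>\<^bsub>A.quot\<^esub> ?\<phi> X" if X: "X \<in> carrier R.quot" for c X
  proof -
    obtain x where x: "x \<in> carrier ?F" "X = R.cls x" using X by (auto simp: R.carrier_quot)
    have "?f (c \<odot>\<^bsub>?F\<^esub> x) = c \<odot>\<^bsub>A.quot\<^esub> ?f x"
      using A.smult_quot[OF k] by (simp add: free_galgebra_simps substitution_scale)
    then show ?thesis using x R.smult_closed[OF x(1)] by (simp add: R.smult_quot val)
  qed
  moreover have "?\<phi> (R_gen n q (GenA i)) = A_linear (a i) 0" "?\<phi> (R_gen n q (GenABar i)) = A_linear 0 (d i)"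
    if "i \<le> n" for i
    using that val[of "Poly_Mapping.single [GenA i] 1"] val[of "Poly_Mapping.single [GenABar i] 1"]
    by (auto simp: R_gen_def R_gens_def A_linear_def linear_form_def substitution_simps free_galgebra_simps)
  ultimately show ?thesis
    by (intro bexI[of _ ?\<phi>]) (auto simp: alg_hom_def R_alg_def A_alg_def)
qed

end

section \<open>A cyclic system of equations\<close>

lemma cyc_succ_surj:
  assumes "j \<le> n"
  obtains i where "i \<le> n" "cyc_succ n i = j"
proof (cases j)
  case 0
  then show ?thesis using that[of n] by (simp add: cyc_succ_def)
next
  case (Suc i)
  then show ?thesis using that[of i] assms by (simp add: cyc_succ_def)
qed

lemma cyclic_product:
  fixes g :: "nat \<Rightarrow> 'f::comm_monoid_mult"
  assumes "\<And>i. i \<le> n \<Longrightarrow> g i = w i * g (cyc_succ n i)"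
  shows "g 0 = (\<Prod>i\<le>n. w i) * g 0"
proof -
  have "g 0 = (\<Prod>i<k. w i) * g k" if "k \<le> n" for k
    using that
  proof (induction k)
    case (Suc k)
    then have "g k = w k * g (Suc k)" using assms[of k] by (simp add: cyc_succ_def)
    then show ?case using Suc by (simp add: mult.assoc)
  qed simp
  from this[of n] assms[of n] show ?thesis
    by (simp add: cyc_succ_def mult.assoc flip: lessThan_Suc_atMost)
qed

lemma cyclic_constant:
  assumes "\<And>i. i \<le> n \<Longrightarrow> g i = g (cyc_succ n i)" "i \<le> n"
  shows "g i = g 0"
  using assms(2)
proof (induction i)
  case (Suc i)
  then show ?case using assms(1)[of i] by (simp add: cyc_succ_def)
qed simp

lemma cyclic_scaled_zero:
  fixes g :: "nat \<Rightarrow> 'f::idom"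
  assumes g: "\<And>i. i \<le> n \<Longrightarrow> g i = q * g (cyc_succ n i)"
    and q: "q \<noteq> 0" "\<And>m. m > 0 \<Longrightarrow> q ^ m \<noteq> 1" and i: "i \<le> n"
  shows "g i = 0"
proof -
  have "g 0 = q ^ Suc n * g 0" using cyclic_product[of n g "\<lambda>_. q", OF g] by simp
  then have "g 0 = 0" using q(2)[of "Suc n"] by (metis mult_cancel_right1 zero_less_Suc)
  from i show ?thesis
  proof (induction i)
    case (Suc i)
    then show ?case using g[of i] q(1) by (simp add: cyc_succ_def)
  qed (rule \<open>g 0 = 0\<close>)
qed

text \<open>
  The heart of the universal property. By the first two equations \<open>a\<^sub>i c\<^sub>i\<close> and \<open>b\<^sub>i d\<^sub>i\<close> are rescaled
  by \<open>q\<close> at each step around the cycle, so they are zero as \<open>q\<close> is not a root of unity. Hence for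
  each \<open>i\<close> either \<open>b\<^sub>i = c\<^sub>i = 0\<close> (straight) or \<open>a\<^sub>i = d\<^sub>i = 0\<close> (swapped). The left-hand side \<open>h\<^sub>i\<close>
  of the third equation is then nonzero, and the right-hand side is \<open>h\<^sub>j\<close> for \<open>j = i + 1\<close>, up to an
  additional factor \<open>q\<^sup>2\<close> if \<open>j\<close> is swapped. Once around the cycle, \<open>h\<^sub>0\<close> is multiplied by
  \<open>q\<close> to the power twice the number of swapped indices, so there are none; then \<open>h\<close> is
  constant.
\<close>

lemma cyclic_system_solution:
  fixes a b c d :: "nat \<Rightarrow> 'f::idom"
  assumes q: "q \<noteq> 0" "\<And>m. m > 0 \<Longrightarrow> q ^ m \<noteq> 1"
    and uu: "\<And>i. i \<le> n \<Longrightarrow> c i * a i = q * (a (cyc_succ n i) * c (cyc_succ n i))"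
    and vv: "\<And>i. i \<le> n \<Longrightarrow> d i * b i = q * (b (cyc_succ n i) * d (cyc_succ n i))"
    and uv: "\<And>i. i \<le> n \<Longrightarrow> c i * b i + q * (d i * a i) =
        q * (a (cyc_succ n i) * d (cyc_succ n i) + q * (b (cyc_succ n i) * c (cyc_succ n i)))"
    and ab: "\<And>i. i \<le> n \<Longrightarrow> a i \<noteq> 0 \<or> b i \<noteq> 0"
    and cd: "\<And>i. i \<le> n \<Longrightarrow> c i \<noteq> 0 \<or> d i \<noteq> 0"
    and i: "i \<le> n"
  shows "b i = 0" "c i = 0" "a i * d i = a 0 * d 0"
proof -
  have ac: "a i * c i = 0" "b i * d i = 0" if "i \<le> n" for i
  proof -
    show "a i * c i = 0"
      by (rule cyclic_scaled_zero[of n "\<lambda>i. a i * c i" q, OF _ q that])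
        (metis uu mult.commute)
    show "b i * d i = 0"
      by (rule cyclic_scaled_zero[of n "\<lambda>i. b i * d i" q, OF _ q that])
        (metis vv mult.commute)
  qed
  \<comment> \<open>the exponent of \<open>q\<close> that is picked up on arriving at vertex \<open>i\<close>\<close>
  define k where "k i = (if b i = 0 then 0 else 2 :: nat)" for i
  define h where "h i = c i * b i + q * (d i * a i)" for i
  have straight: "c i = 0 \<and> a i \<noteq> 0 \<and> d i \<noteq> 0" if "b i = 0" "i \<le> n" for i
    using that ac[of i] ab[of i] cd[of i] by auto
  have swapped: "d i = 0 \<and> a i = 0 \<and> c i \<noteq> 0" if "b i \<noteq> 0" "i \<le> n" for i
    using that ac[of i] ab[of i] cd[of i] by auto
  have h: "h i = q ^ k (cyc_succ n i) * h (cyc_succ n i)" if "i \<le> n" for i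
    using uv[OF that] straight[of "cyc_succ n i"] swapped[of "cyc_succ n i"]
    by (cases "b (cyc_succ n i) = 0") (simp_all add: h_def k_def power2_eq_square mult_ac)
  have "h 0 \<noteq> 0"
    using straight[of 0] swapped[of 0] q(1) by (cases "b 0 = 0") (simp_all add: h_def)
  moreover have "h 0 = (\<Prod>i\<le>n. q ^ k (cyc_succ n i)) * h 0"
    by (rule cyclic_product[where g = h]) (rule h)
  ultimately have "q ^ (\<Sum>i\<le>n. k (cyc_succ n i)) = 1"
    by (simp add: power_sum)
  then have "(\<Sum>i\<le>n. k (cyc_succ n i)) = 0"
    using q(2) by blast
  then have k0: "k j = 0" if "j \<le> n" for j
    using cyc_succ_surj[OF that] by (metis atMost_iff finite_atMost sum_eq_0_iff)
  have b: "b j = 0" if "j \<le> n" for j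
    using k0[OF that] by (simp add: k_def split: if_splits)
  show "b i = 0" "c i = 0" using b straight i by blast+
  have "h i = h 0"
  proof (rule cyclic_constant[OF _ i])
    fix j assume "j \<le> n"
    from h[OF this] show "h j = h (cyc_succ n j)" by (simp add: k0)
  qed
  then show "a i * d i = a 0 * d 0"
    using b[OF i] b[of 0] q(1) by (simp add: h_def mult.commute)
qed

section \<open>Matrix entries of a representation\<close>

lemma mat_elem_mult:
  assumes "ring \<Gamma>" "finite J" "j \<in> J" "x \<in> carrier \<Gamma>" "y \<in> carrier \<Gamma>"
  shows "mat_elem \<Gamma> i j x \<otimes>\<^bsub>mat_galgebra J \<Gamma>\<^esub> mat_elem \<Gamma> j k y = mat_elem \<Gamma> i k (x \<otimes>\<^bsub>\<Gamma>\<^esub> y)"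
proof -
  interpret ring \<Gamma> by fact
  have "(\<Oplus>\<^bsub>\<Gamma>\<^esub>l\<in>J. mat_elem \<Gamma> i j x i' l \<otimes>\<^bsub>\<Gamma>\<^esub> mat_elem \<Gamma> j k y l k') = mat_elem \<Gamma> i k (x \<otimes>\<^bsub>\<Gamma>\<^esub> y) i' k'" for i' k'
    using assms by (subst finsum_single[of j]) (auto simp: mat_elem_def)
  then show ?thesis by (simp add: mat_galgebra_simps)
qed

lemma mat_elem_corner:
  assumes "ring \<Gamma>" "finite J" "i \<in> J" "j \<in> J" and M: "M \<in> carrier (mat_galgebra J \<Gamma>)"
    and l: "mat_elem \<Gamma> i i \<one>\<^bsub>\<Gamma>\<^esub> \<otimes>\<^bsub>mat_galgebra J \<Gamma>\<^esub> M = M"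
    and r: "M \<otimes>\<^bsub>mat_galgebra J \<Gamma>\<^esub> mat_elem \<Gamma> j j \<one>\<^bsub>\<Gamma>\<^esub> = M"
  shows "M = mat_elem \<Gamma> i j (M i j)"
proof -
  interpret ring \<Gamma> by fact
  have e: "M k l \<in> carrier \<Gamma>" for k l
    using M by (simp add: mat_galgebra_simps) (metis zero_closed)
  have "M k l = \<zero>\<^bsub>\<Gamma>\<^esub>" if "k \<noteq> i" for k l
  proof -
    have "M k l = (mat_elem \<Gamma> i i \<one>\<^bsub>\<Gamma>\<^esub> \<otimes>\<^bsub>mat_galgebra J \<Gamma>\<^esub> M) k l"
      unfolding l ..
    also have "\<dots> = (\<Oplus>\<^bsub>\<Gamma>\<^esub>m\<in>J. mat_elem \<Gamma> i i \<one>\<^bsub>\<Gamma>\<^esub> k m \<otimes>\<^bsub>\<Gamma>\<^esub> M m l)"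
      by (simp add: mat_galgebra_simps)
    also have "\<dots> = \<zero>\<^bsub>\<Gamma>\<^esub>"
      by (rule add.finprod_one_eqI) (use that e in \<open>simp add: mat_elem_def\<close>)
    finally show ?thesis .
  qed
  moreover have "M k l = \<zero>\<^bsub>\<Gamma>\<^esub>" if "l \<noteq> j" for k l
  proof -
    have "M k l = (M \<otimes>\<^bsub>mat_galgebra J \<Gamma>\<^esub> mat_elem \<Gamma> j j \<one>\<^bsub>\<Gamma>\<^esub>) k l"
      unfolding r ..
    also have "\<dots> = (\<Oplus>\<^bsub>\<Gamma>\<^esub>m\<in>J. M k m \<otimes>\<^bsub>\<Gamma>\<^esub> mat_elem \<Gamma> j j \<one>\<^bsub>\<Gamma>\<^esub> m l)"
      by (simp add: mat_galgebra_simps)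
    also have "\<dots> = \<zero>\<^bsub>\<Gamma>\<^esub>"
      by (rule add.finprod_one_eqI) (use that e in \<open>simp add: mat_elem_def\<close>)
    finally show ?thesis .
  qed
  ultimately show ?thesis by (auto simp: fun_eq_iff mat_elem_def)
qed

context
  fixes n :: nat and q :: "'f::comm_ring_1"
begin

interpretation L: presented_algebra "path_galgebra (quiver n)" "Lam_rels n q"
  by (rule presented_Lam)

lemma Lam_vertex_carrier: "i \<le> n \<Longrightarrow> Lam_vertex n q i \<in> carrier (Lam_alg n q)"
  unfolding Lam_vertex_def Lam_alg_def
  by (rule L.cls_closed) (simp add: path_galgebra_simps mem_paths)

lemma arrow_path: "x \<in> arcs (quiver n) \<Longrightarrow> (arrow_tail n x, [x], arrow_head n x) \<in> paths n"
  using arrow_ends[of x n] by (simp add: mem_paths)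

lemma Lam_arrow_hcomp:
  assumes "x \<in> arcs (quiver n)"
  shows "Lam_arrow n q x \<in> hcomp (Lam_alg n q) 1"
  unfolding Lam_arrow_def Lam_alg_def L.hcomp_quot
  using arrow_path[OF assms] by (intro imageI) (simp add: path_galgebra_simps)

lemma Lam_arrow_carrier:
  assumes "x \<in> arcs (quiver n)"
  shows "Lam_arrow n q x \<in> carrier (Lam_alg n q)"
  unfolding Lam_arrow_def Lam_alg_def
  by (rule L.cls_closed) (use arrow_path[OF assms] in \<open>simp add: path_galgebra_simps\<close>)

lemma Lam_vertex_mult_arrow:
  assumes "x \<in> arcs (quiver n)"
  shows "Lam_vertex n q (arrow_tail n x) \<otimes>\<^bsub>Lam_alg n q\<^esub> Lam_arrow n q x = Lam_arrow n q x"
    and "Lam_arrow n q x \<otimes>\<^bsub>Lam_alg n q\<^esub> Lam_vertex n q (arrow_head n x) = Lam_arrow n q x"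
proof -
  have c: "Poly_Mapping.single (arrow_tail n x, [x], arrow_head n x) (1::'f) \<in> carrier (path_galgebra (quiver n))"
    "Poly_Mapping.single (arrow_tail n x, [], arrow_tail n x) (1::'f) \<in> carrier (path_galgebra (quiver n))"
    "Poly_Mapping.single (arrow_head n x, [], arrow_head n x) (1::'f) \<in> carrier (path_galgebra (quiver n))"
    using arrow_path[OF assms] arrow_ends[OF assms] by (simp_all add: path_galgebra_simps mem_paths(1))
  show "Lam_vertex n q (arrow_tail n x) \<otimes>\<^bsub>Lam_alg n q\<^esub> Lam_arrow n q x = Lam_arrow n q x"
    unfolding Lam_vertex_def Lam_arrow_def Lam_alg_def L.mult_quot[OF c(2,1)]
    by (simp add: path_galgebra_simps basis_mult_single basis_term_def)
  show "Lam_arrow n q x \<otimes>\<^bsub>Lam_alg n q\<^esub> Lam_vertex n q (arrow_head n x) = Lam_arrow n q x"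
    unfolding Lam_vertex_def Lam_arrow_def Lam_alg_def L.mult_quot[OF c(1,3)]
    by (simp add: path_galgebra_simps basis_mult_single basis_term_def)
qed

text \<open>
  The defining relation, as an identity between products of classes of arrows, to which a
  representation can be applied.
\<close>

lemma Lam_relation:
  assumes i: "i \<le> n"
  defines "j \<equiv> cyc_succ n i"
  shows "Lam_arrow n q (AlphaBar i) \<otimes>\<^bsub>Lam_alg n q\<^esub> Lam_arrow n q (Alpha i) =
    q \<odot>\<^bsub>Lam_alg n q\<^esub> (Lam_arrow n q (Alpha j) \<otimes>\<^bsub>Lam_alg n q\<^esub> Lam_arrow n q (AlphaBar j))"
proof -
  let ?P = "path_galgebra (quiver n) :: ('f, _) galgebra"
  have j: "j \<le> n" by (simp add: j_def)
  have arcs: "Alpha l \<in> arcs (quiver n)" "AlphaBar l \<in> arcs (quiver n)" if "l \<le> n" for l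
    using that by (simp_all add: quiver_def)
  let ?e = "\<lambda>x. Poly_Mapping.single (arrow_tail n x, [x], arrow_head n x) (1::'f)"
  let ?l = "Poly_Mapping.single (j, [AlphaBar i, Alpha i], j) (1::'f)"
  let ?r = "Poly_Mapping.single (j, [Alpha j, AlphaBar j], j) q"
  have c: "?e x \<in> carrier ?P" if "x \<in> arcs (quiver n)" for x
    using arrow_path[OF that] by (simp add: path_galgebra_simps)
  have k: "?l \<in> carrier ?P" "?r \<in> carrier ?P" "- ?r \<in> carrier ?P"
    "Poly_Mapping.single (j, [Alpha j, AlphaBar j], j) 1 \<in> carrier ?P"
    using arcs i j by (simp_all add: path_galgebra_simps mem_paths j_def[symmetric])
  have "\<ominus>\<^bsub>?P\<^esub> ?r = - ?r"
    by (rule L.minus_equality) (use k in \<open>simp_all add: path_galgebra_simps\<close>)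
  then have "?l \<ominus>\<^bsub>?P\<^esub> ?r = ?l - ?r"
    by (simp add: a_minus_def path_galgebra_simps)
  moreover have "?l - ?r \<in> Lam_rels n q"
    using i by (auto simp: Lam_rels_def Let_def j_def)
  ultimately have "L.cls ?l = L.cls ?r"
    using L.cls_eq_iff[OF k(1,2)] L.genideal_self[OF L.relations_closed] by auto
  moreover have "Lam_arrow n q (AlphaBar i) \<otimes>\<^bsub>Lam_alg n q\<^esub> Lam_arrow n q (Alpha i) = L.cls ?l"
    unfolding Lam_arrow_def Lam_alg_def L.mult_quot[OF c[OF arcs(2)[OF i]] c[OF arcs(1)[OF i]]]
    by (simp add: path_galgebra_simps basis_mult_single basis_term_def j_def)
  moreover have "Lam_arrow n q (Alpha j) \<otimes>\<^bsub>Lam_alg n q\<^esub> Lam_arrow n q (AlphaBar j) =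
      L.cls (Poly_Mapping.single (j, [Alpha j, AlphaBar j], j) 1)"
    unfolding Lam_arrow_def Lam_alg_def L.mult_quot[OF c[OF arcs(1)[OF j]] c[OF arcs(2)[OF j]]]
    by (simp add: path_galgebra_simps basis_mult_single basis_term_def)
  moreover have "q \<odot>\<^bsub>Lam_alg n q\<^esub> L.cls (Poly_Mapping.single (j, [Alpha j, AlphaBar j], j) 1) = L.cls ?r"
    unfolding Lam_alg_def L.smult_quot[OF k(4)] by (simp add: path_galgebra_simps scale_single)
  ultimately show ?thesis by simp
qed

text \<open>
  An arrow is fixed by the idempotents at its ends, so its image is concentrated in one matrix
  entry.
\<close>

lemma graded_rep_arrow:
  assumes rep: "graded_rep n q \<Gamma> \<iota>" and \<Gamma>: "ring \<Gamma>" and x: "x \<in> arcs (quiver n)"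
  obtains y where "\<iota> (Lam_arrow n q x) = mat_elem \<Gamma> (arrow_tail n x) (arrow_head n x) y"
    "y \<in> carrier \<Gamma>" "y \<in> hcomp \<Gamma> 1" "y \<noteq> \<zero>\<^bsub>\<Gamma>\<^esub>"
proof
  let ?M = "mat_galgebra {0..n} \<Gamma>" and ?X = "\<iota> (Lam_arrow n q x)"
  let ?t = "arrow_tail n x" and ?h = "arrow_head n x"
  have hom: "\<iota> \<in> ring_hom (Lam_alg n q) ?M" and hc: "\<iota> ` hcomp (Lam_alg n q) 1 \<subseteq> hcomp ?M 1"
    and vert: "\<And>i. i \<le> n \<Longrightarrow> \<iota> (Lam_vertex n q i) = mat_elem \<Gamma> i i \<one>\<^bsub>\<Gamma>\<^esub>"
    and nz: "?X \<noteq> \<zero>\<^bsub>?M\<^esub>"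
    using rep x by (auto simp: graded_rep_def graded_alg_hom_def alg_hom_def)
  note ends = arrow_ends[OF x]
  have X: "?X \<in> carrier ?M"
    by (rule ring_hom_closed[OF hom Lam_arrow_carrier[OF x]])
  have "mat_elem \<Gamma> ?t ?t \<one>\<^bsub>\<Gamma>\<^esub> \<otimes>\<^bsub>?M\<^esub> ?X = ?X"
    using ring_hom_mult[OF hom Lam_vertex_carrier[OF ends(1)] Lam_arrow_carrier[OF x]]
    by (simp add: Lam_vertex_mult_arrow[OF x] vert[OF ends(1)])
  moreover have "?X \<otimes>\<^bsub>?M\<^esub> mat_elem \<Gamma> ?h ?h \<one>\<^bsub>\<Gamma>\<^esub> = ?X"
    using ring_hom_mult[OF hom Lam_arrow_carrier[OF x] Lam_vertex_carrier[OF ends(2)]]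
    by (simp add: Lam_vertex_mult_arrow[OF x] vert[OF ends(2)])
  ultimately show corner: "?X = mat_elem \<Gamma> ?t ?h (?X ?t ?h)"
    using ends by (intro mat_elem_corner[OF \<Gamma> _ _ _ X]) simp_all
  show "?X ?t ?h \<in> carrier \<Gamma>"
    using X ends by (simp add: mat_galgebra_simps)
  show "?X ?t ?h \<in> hcomp \<Gamma> 1"
    using hc Lam_arrow_hcomp[OF x] ends by (auto simp: mat_galgebra_simps(7))
  show "?X ?t ?h \<noteq> \<zero>\<^bsub>\<Gamma>\<^esub>"
  proof
    assume "?X ?t ?h = \<zero>\<^bsub>\<Gamma>\<^esub>"
    with corner have "?X = (\<lambda>i j. \<zero>\<^bsub>\<Gamma>\<^esub>)" by (simp add: mat_elem_def fun_eq_iff)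
    then show False using nz by (simp add: mat_galgebra_simps)
  qed
qed

end

section \<open>Universality\<close>

text \<open>
  The arrows go to linear forms \<open>x\<^sub>i = a\<^sub>i u + b\<^sub>i v\<close> and \<open>y\<^sub>i = c\<^sub>i u + d\<^sub>i v\<close>, which are nonzero. The
  relation of \<open>\<Lambda>\<close> at vertex \<open>i + 1\<close> becomes \<open>y\<^sub>i x\<^sub>i = q x\<^sub>j y\<^sub>j\<close> with \<open>j = i + 1\<close>, and comparison of
  coefficients yields the cyclic system.
\<close>

lemma graded_A_representation:
  fixes q :: "'f::idom"
  assumes q: "q \<noteq> 0" "\<And>m. m > 0 \<Longrightarrow> q ^ m \<noteq> 1"
    and rep: "graded_rep n q (A_alg q) \<iota>"
  shows "\<exists>a d. \<forall>i\<le>n.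
    \<iota> (Lam_arrow n q (Alpha i)) = mat_elem (A_alg q) i (cyc_succ n i) (A_linear q (a i) 0) \<and>
    \<iota> (Lam_arrow n q (AlphaBar i)) = mat_elem (A_alg q) (cyc_succ n i) i (A_linear q 0 (d i)) \<and>
    a i * d i = a 0 * d 0"
proof -
  interpret A: ground_algebra "A_alg q" by (rule ground_algebra_A)
  let ?M = "mat_galgebra {0..n} (A_alg q)"
  have hom: "\<iota> \<in> ring_hom (Lam_alg n q) ?M"
    and smult: "\<And>c X. X \<in> carrier (Lam_alg n q) \<Longrightarrow> \<iota> (c \<odot>\<^bsub>Lam_alg n q\<^esub> X) = c \<odot>\<^bsub>?M\<^esub> \<iota> X"
    using rep by (auto simp: graded_rep_def graded_alg_hom_def alg_hom_def)
  have arcs: "Alpha i \<in> arcs (quiver n)" "AlphaBar i \<in> arcs (quiver n)" if "i \<le> n" for i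
    using that by (simp_all add: quiver_def)
  have lin: "\<exists>a b. \<iota> (Lam_arrow n q x) = mat_elem (A_alg q) (arrow_tail n x) (arrow_head n x) (A_linear q a b) \<and>
      (a \<noteq> 0 \<or> b \<noteq> 0)" if x: "x \<in> arcs (quiver n)" for x
  proof -
    obtain y where y: "\<iota> (Lam_arrow n q x) = mat_elem (A_alg q) (arrow_tail n x) (arrow_head n x) y"
      "y \<in> hcomp (A_alg q) 1" "y \<noteq> \<zero>\<^bsub>A_alg q\<^esub>"
      by (rule graded_rep_arrow[OF rep A.ring_axioms x])
    obtain a b where "y = A_linear q a b" using A_degree_one[OF y(2)] by blast
    then show ?thesis using y A_linear_0[of q] by metis
  qed
  obtain a b where ab: "\<And>i. i \<le> n \<Longrightarrow> \<iota> (Lam_arrow n q (Alpha i)) =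
      mat_elem (A_alg q) i (cyc_succ n i) (A_linear q (a i) (b i))"
    "\<And>i. i \<le> n \<Longrightarrow> a i \<noteq> 0 \<or> b i \<noteq> 0"
    using lin[OF arcs(1)] by simp metis
  obtain c d where cd: "\<And>i. i \<le> n \<Longrightarrow> \<iota> (Lam_arrow n q (AlphaBar i)) =
      mat_elem (A_alg q) (cyc_succ n i) i (A_linear q (c i) (d i))"
    "\<And>i. i \<le> n \<Longrightarrow> c i \<noteq> 0 \<or> d i \<noteq> 0"
    using lin[OF arcs(2)] by simp metis
  have rel: "A_linear q (c i) (d i) \<otimes>\<^bsub>A_alg q\<^esub> A_linear q (a i) (b i) =
      q \<odot>\<^bsub>A_alg q\<^esub> (A_linear q (a j) (b j) \<otimes>\<^bsub>A_alg q\<^esub> A_linear q (c j) (d j))"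
    if i: "i \<le> n" and j: "j = cyc_succ n i" for i j
  proof -
    have "j \<le> n" using j by simp
    note ij = i \<open>j \<le> n\<close>
    have "\<iota> (Lam_arrow n q (AlphaBar i) \<otimes>\<^bsub>Lam_alg n q\<^esub> Lam_arrow n q (Alpha i)) =
        mat_elem (A_alg q) j j (A_linear q (c i) (d i) \<otimes>\<^bsub>A_alg q\<^esub> A_linear q (a i) (b i))"
      using ring_hom_mult[OF hom Lam_arrow_carrier Lam_arrow_carrier, OF arcs(2) arcs(1), OF i i]
      by (simp add: ab cd i mat_elem_mult[OF A.ring_axioms] A_linear_carrier flip: j)
    moreover have "\<iota> (Lam_arrow n q (Alpha j) \<otimes>\<^bsub>Lam_alg n q\<^esub> Lam_arrow n q (AlphaBar j)) =
        mat_elem (A_alg q) j j (A_linear q (a j) (b j) \<otimes>\<^bsub>A_alg q\<^esub> A_linear q (c j) (d j))"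
      using ring_hom_mult[OF hom Lam_arrow_carrier Lam_arrow_carrier, OF arcs(1) arcs(2), OF ij(2) ij(2)]
      by (simp add: ab cd ij(2) mat_elem_mult[OF A.ring_axioms] A_linear_carrier)
    moreover have "Lam_arrow n q (Alpha j) \<otimes>\<^bsub>Lam_alg n q\<^esub> Lam_arrow n q (AlphaBar j) \<in> carrier (Lam_alg n q)"
      using presented_algebra.ring_quot[OF presented_Lam[of n q]] ij(2) arcs
      unfolding Lam_alg_def[symmetric] by (intro ring.ring_simprules Lam_arrow_carrier)
    ultimately have "mat_elem (A_alg q) j j (A_linear q (c i) (d i) \<otimes>\<^bsub>A_alg q\<^esub> A_linear q (a i) (b i)) =
      q \<odot>\<^bsub>?M\<^esub> mat_elem (A_alg q) j j (A_linear q (a j) (b j) \<otimes>\<^bsub>A_alg q\<^esub> A_linear q (c j) (d j))"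
      using Lam_relation[OF i, of q] smult j by metis
    from fun_cong[OF fun_cong[OF this, of j], of j] show ?thesis
      by (simp add: mat_elem_def mat_galgebra_simps)
  qed
  note eqs = A_quadratic_relation[OF rel[OF _ refl]]
  have sol: "b i = 0" "c i = 0" "a i * d i = a 0 * d 0" if "i \<le> n" for i
    using cyclic_system_solution[where a = a and b = b and c = c and d = d, OF q eqs ab(2) cd(2) that]
    by simp_all
  show ?thesis
  proof (intro exI allI impI conjI)
    fix i assume i: "i \<le> n"
    show "\<iota> (Lam_arrow n q (Alpha i)) = mat_elem (A_alg q) i (cyc_succ n i) (A_linear q (a i) 0)"
      using ab(1)[OF i] sol(1)[OF i] by simp
    show "\<iota> (Lam_arrow n q (AlphaBar i)) = mat_elem (A_alg q) (cyc_succ n i) i (A_linear q 0 (d i))"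
      using cd(1)[OF i] sol(2)[OF i] by simp
    show "a i * d i = a 0 * d 0"
      by (rule sol(3)[OF i])
  qed
qed

lemma alg_hom_unique_on_generators:
  assumes f: "f \<in> alg_hom (R_alg n q) \<Delta>" and g: "g \<in> alg_hom (R_alg n q) \<Delta>"
    and gen: "\<And>x. x \<in> R_gens n \<Longrightarrow> f (R_gen n q x) = g (R_gen n q x)"
    and X: "X \<in> carrier (R_alg n q)"
  shows "f X = g X"
proof -
  have h: "f \<in> ring_hom (R_alg n q) \<Delta>" "g \<in> ring_hom (R_alg n q) \<Delta>"
    using f g by (simp_all add: alg_hom_def)
  show ?thesis
    using X
  proof (induction rule: R_alg_induct)
    case one
    show ?case using h by (simp add: ring_hom_one)
  next
    case (gen x)
    then show ?case by (rule assms(3))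
  next
    case (add X Y)
    then show ?case using ring_hom_add[OF h(1)] ring_hom_add[OF h(2)] by simp
  next
    case (mult X Y)
    then show ?case using ring_hom_mult[OF h(1)] ring_hom_mult[OF h(2)] by simp
  next
    case (smult c X)
    then show ?case using f g by (simp add: alg_hom_def)
  qed
qed

lemma mat_map_ring_hom:
  assumes "ring \<Gamma>" "ring \<Delta>" and h: "h \<in> ring_hom \<Gamma> \<Delta>"
    and M: "M \<in> carrier (mat_galgebra J \<Gamma>)" and N: "N \<in> carrier (mat_galgebra J \<Gamma>)"
  shows "mat_map h (M \<oplus>\<^bsub>mat_galgebra J \<Gamma>\<^esub> N) = mat_map h M \<oplus>\<^bsub>mat_galgebra J \<Delta>\<^esub> mat_map h N"
    and "mat_map h (M \<otimes>\<^bsub>mat_galgebra J \<Gamma>\<^esub> N) = mat_map h M \<otimes>\<^bsub>mat_galgebra J \<Delta>\<^esub> mat_map h N"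
proof -
  interpret G: ring \<Gamma> by fact
  have e: "M k l \<in> carrier \<Gamma>" "N k l \<in> carrier \<Gamma>" for k l
    using M N by (simp_all add: mat_galgebra_simps) (metis G.zero_closed)+
  show "mat_map h (M \<oplus>\<^bsub>mat_galgebra J \<Gamma>\<^esub> N) = mat_map h M \<oplus>\<^bsub>mat_galgebra J \<Delta>\<^esub> mat_map h N"
    by (simp add: fun_eq_iff mat_map_def mat_galgebra_simps ring_hom_add[OF h] e)
  have "h (\<Oplus>\<^bsub>\<Gamma>\<^esub>l\<in>J. M i l \<otimes>\<^bsub>\<Gamma>\<^esub> N l j) = (\<Oplus>\<^bsub>\<Delta>\<^esub>l\<in>J. h (M i l) \<otimes>\<^bsub>\<Delta>\<^esub> h (N l j))" for i j
    using e by (subst ring_hom_finsum[OF assms(1-3)]) (simp_all add: Pi_def ring_hom_mult[OF h])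
  then show "mat_map h (M \<otimes>\<^bsub>mat_galgebra J \<Gamma>\<^esub> N) = mat_map h M \<otimes>\<^bsub>mat_galgebra J \<Delta>\<^esub> mat_map h N"
    by (simp add: fun_eq_iff mat_map_def mat_galgebra_simps)
qed

lemma mat_map_mat_elem: "h \<zero>\<^bsub>\<Gamma>\<^esub> = \<zero>\<^bsub>\<Delta>\<^esub> \<Longrightarrow> mat_map h (mat_elem \<Gamma> i j x) = mat_elem \<Delta> i j (h x)"
  by (auto simp: fun_eq_iff mat_map_def mat_elem_def)

text \<open>
  Both sides are homomorphisms from \<open>\<Lambda>\<close>, so they agree as soon as they agree on vertices and arrows.
\<close>

lemma representation_factorisation:
  assumes \<Delta>: "ring \<Delta>" and R: "is_iota_R n q \<iota>R" and rep: "graded_rep n q \<Delta> \<iota>"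
    and \<phi>: "\<phi> \<in> alg_hom (R_alg n q) \<Delta>"
    and arrows: "\<And>i. i \<le> n \<Longrightarrow> \<iota> (Lam_arrow n q (Alpha i)) =
        mat_elem \<Delta> i (cyc_succ n i) (\<phi> (R_gen n q (GenA i)))"
      "\<And>i. i \<le> n \<Longrightarrow> \<iota> (Lam_arrow n q (AlphaBar i)) =
        mat_elem \<Delta> (cyc_succ n i) i (\<phi> (R_gen n q (GenABar i)))"
    and X: "X \<in> carrier (Lam_alg n q)"
  shows "mat_map \<phi> (\<iota>R X) = \<iota> X"
proof -
  have Rring: "ring (R_alg n q)" by (rule ring_R_alg)
  have hR: "\<iota>R \<in> alg_hom (Lam_alg n q) (mat_galgebra {0..n} (R_alg n q))"
    and h: "\<iota> \<in> alg_hom (Lam_alg n q) (mat_galgebra {0..n} \<Delta>)"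
    using R rep by (simp_all add: is_iota_R_def graded_rep_def graded_alg_hom_def)
  then have rR: "\<iota>R \<in> ring_hom (Lam_alg n q) (mat_galgebra {0..n} (R_alg n q))"
    and r: "\<iota> \<in> ring_hom (Lam_alg n q) (mat_galgebra {0..n} \<Delta>)"
    and s: "\<phi> \<in> ring_hom (R_alg n q) \<Delta>"
    using \<phi> by (simp_all add: alg_hom_def)
  have zero: "\<phi> \<zero>\<^bsub>R_alg n q\<^esub> = \<zero>\<^bsub>\<Delta>\<^esub>"
    by (rule ring_hom_zero[OF s Rring \<Delta>])
  have elem: "mat_map \<phi> (mat_elem (R_alg n q) i j x) = mat_elem \<Delta> i j (\<phi> x)" for i j x
    by (rule mat_map_mat_elem) (rule zero)
  show ?thesis
    using X
  proof (induction rule: Lam_alg_induct)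
    case (vertex i)
    then show ?case
      using R rep s by (simp add: is_iota_R_def graded_rep_def elem ring_hom_one)
  next
    case (arrow x)
    then show ?case
      using R arrows by (auto simp: quiver_def is_iota_R_def elem)
  next
    case (add X Y)
    then show ?case
      using mat_map_ring_hom(1)[OF Rring \<Delta> s ring_hom_closed[OF rR] ring_hom_closed[OF rR]]
      by (simp add: ring_hom_add[OF rR] ring_hom_add[OF r])
  next
    case (mult X Y)
    then show ?case
      using mat_map_ring_hom(2)[OF Rring \<Delta> s ring_hom_closed[OF rR] ring_hom_closed[OF rR]]
      by (simp add: ring_hom_mult[OF rR] ring_hom_mult[OF r])
  next
    case (smult c X)
    have e: "\<iota>R X k l \<in> carrier (R_alg n q)" for k l
      using ring_hom_closed[OF rR smult(1)] ring.ring_simprules(2)[OF Rring]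
      by (simp add: mat_galgebra_simps) metis
    have "mat_map \<phi> (c \<odot>\<^bsub>mat_galgebra {0..n} (R_alg n q)\<^esub> \<iota>R X) = c \<odot>\<^bsub>mat_galgebra {0..n} \<Delta>\<^esub> mat_map \<phi> (\<iota>R X)"
      using \<phi> e by (simp add: fun_eq_iff mat_map_def mat_galgebra_simps alg_hom_def)
    then show ?case using smult hR h by (simp add: alg_hom_def)
  qed
qed

text \<open>
  Existence is the substitution found from the representation. For uniqueness, each generator of
  \<open>R\<close> is the only nonzero entry of the image of an arrow, so its image is prescribed.
\<close>

lemma universal_for_A_iota_R:
  fixes q :: "'f::idom"
  assumes q: "q \<noteq> 0" "\<And>m. m > 0 \<Longrightarrow> q ^ m \<noteq> 1" and R: "is_iota_R n q \<iota>R"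
  shows "universal_for_A n q \<iota>R"
  unfolding universal_for_A_def
proof (intro allI impI)
  fix \<iota>A assume rep: "graded_rep n q (A_alg q) \<iota>A"
  interpret A: ground_algebra "A_alg q" by (rule ground_algebra_A)
  obtain a d where arrows:
    "\<And>i. i \<le> n \<Longrightarrow> \<iota>A (Lam_arrow n q (Alpha i)) = mat_elem (A_alg q) i (cyc_succ n i) (A_linear q (a i) 0)"
    "\<And>i. i \<le> n \<Longrightarrow> \<iota>A (Lam_arrow n q (AlphaBar i)) = mat_elem (A_alg q) (cyc_succ n i) i (A_linear q 0 (d i))"
    and ad: "\<And>i. i \<le> n \<Longrightarrow> a i * d i = a 0 * d 0"
    using graded_A_representation[OF q rep] by blast
  obtain \<phi> where \<phi>: "\<phi> \<in> alg_hom (R_alg n q) (A_alg q)"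
    and gens: "\<And>i. i \<le> n \<Longrightarrow> \<phi> (R_gen n q (GenA i)) = A_linear q (a i) 0"
      "\<And>i. i \<le> n \<Longrightarrow> \<phi> (R_gen n q (GenABar i)) = A_linear q 0 (d i)"
    using substitution_alg_hom[of n a d q] ad by blast
  have Rring: "ring (R_alg n q)" by (rule ring_R_alg)
  have rR: "\<iota>R \<in> ring_hom (Lam_alg n q) (mat_galgebra {0..n} (R_alg n q))"
    using R by (simp add: is_iota_R_def graded_rep_def graded_alg_hom_def alg_hom_def)
  have entry: "\<iota>R X k l \<in> carrier (R_alg n q)" if "X \<in> carrier (Lam_alg n q)" for X k l
    using ring_hom_closed[OF rR that] ring.ring_simprules(2)[OF Rring]
    by (simp add: mat_galgebra_simps) metis
  have factor: "mat_map \<phi> (\<iota>R X) = \<iota>A X" if "X \<in> carrier (Lam_alg n q)" for X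
    by (rule representation_factorisation[OF A.ring_axioms R rep \<phi> _ _ that]) (simp_all add: arrows gens)
  \<comment> \<open>homomorphisms are compared as extensional functions, so \<open>\<phi>\<close> is cut off outside the carrier\<close>
  let ?\<psi> = "restrict \<phi> (carrier (R_alg n q))"
  interpret Rg: ground_algebra "R_alg n q"
    by (rule ground_algebra_R)
  have \<psi>: "?\<psi> \<in> alg_hom (R_alg n q) (A_alg q)"
    using \<phi> Rg.ring_hom_restrict[of \<phi> "A_alg q" ?\<psi>] by (simp add: alg_hom_def)
  show "\<exists>!\<phi>. \<phi> \<in> alg_hom (R_alg n q) (A_alg q) \<and> \<phi> \<in> extensional (carrier (R_alg n q)) \<and>
      (\<forall>x\<in>carrier (Lam_alg n q). mat_map \<phi> (\<iota>R x) = \<iota>A x)"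
  proof (rule ex1I[of _ ?\<psi>])
    show "?\<psi> \<in> alg_hom (R_alg n q) (A_alg q) \<and> ?\<psi> \<in> extensional (carrier (R_alg n q)) \<and>
      (\<forall>x\<in>carrier (Lam_alg n q). mat_map ?\<psi> (\<iota>R x) = \<iota>A x)"
      using \<psi> factor entry by (simp add: mat_map_def fun_eq_iff)
  next
    fix \<chi> assume \<chi>: "\<chi> \<in> alg_hom (R_alg n q) (A_alg q) \<and> \<chi> \<in> extensional (carrier (R_alg n q)) \<and>
      (\<forall>x\<in>carrier (Lam_alg n q). mat_map \<chi> (\<iota>R x) = \<iota>A x)"
    have "\<chi> (R_gen n q x) = ?\<psi> (R_gen n q x)" if "x \<in> R_gens n" for x
    proof -
      obtain y where y: "y \<in> arcs (quiver n)" "arrow_gen y = x"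
        using \<open>x \<in> R_gens n\<close> by (auto simp: R_gens_def quiver_def intro: arrow_gen.simps)
      have e: "\<iota>R (Lam_arrow n q y) (arrow_tail n y) (arrow_head n y) = R_gen n q x"
        using R y by (auto simp: is_iota_R_def quiver_def mat_elem_def)
      note c = Lam_arrow_carrier[OF y(1), of q]
      have "mat_map \<chi> (\<iota>R (Lam_arrow n q y)) = mat_map \<phi> (\<iota>R (Lam_arrow n q y))"
        using \<chi> factor c by simp
      from fun_cong[OF fun_cong[OF this]] have "\<chi> (R_gen n q x) = \<phi> (R_gen n q x)"
        by (metis e mat_map_def)
      then show ?thesis using entry[OF c, of "arrow_tail n y" "arrow_head n y"] by (simp add: e)
    qed
    then have "\<chi> X = ?\<psi> X" if "X \<in> carrier (R_alg n q)" for X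
      using alg_hom_unique_on_generators[OF _ \<psi> _ that, of \<chi>] \<chi> by blast
    then show "\<chi> = ?\<psi>"
      using \<chi> by (intro extensionalityI[of _ "carrier (R_alg n q)"]) auto
  qed
qed

lemma qvar_power: "(qvar :: 'k::field laurent) ^ m = Poly_Mapping.single (int m) 1"
  by (induction m) (simp_all add: qvar_def mult_single single_one[symmetric] del: single_one)

lemma qvar_nonzero: "(qvar :: 'k::field laurent) \<noteq> 0"
  by (metis laurent_eval_qvar laurent_eval_simps(2) zero_neq_one)

lemma qvar_not_root_of_unity:
  assumes "m > 0"
  shows "(qvar :: 'k::field laurent) ^ m \<noteq> 1"
proof
  assume "(qvar :: 'k laurent) ^ m = 1"
  then have "Poly_Mapping.lookup (Poly_Mapping.single (int m) (1::'k)) 0 = Poly_Mapping.lookup 1 0"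
    by (simp add: qvar_power)
  then show False using assms by (simp add: lookup_single)
qed

theorem theorem4p2p4:
  fixes n :: nat
  assumes "n \<ge> 2"
  shows "\<exists>(\<iota>K :: 'k::{alg_closed_field, field_char_0} laurent Lam_elt \<Rightarrow> nat \<Rightarrow> nat \<Rightarrow> 'k laurent R_elt)
           (\<iota> :: 'k \<Rightarrow> 'k Lam_elt \<Rightarrow> nat \<Rightarrow> nat \<Rightarrow> 'k R_elt).
      is_iota_R n qvar \<iota>K \<and>
      (\<forall>q. q \<noteq> 0 \<longrightarrow> is_iota_R n q (\<iota> q) \<and> specialises_to n q \<iota>K (\<iota> q)) \<and>
      universal_for_A n qvar \<iota>K \<and>
      (\<forall>q. q \<noteq> 0 \<and> (\<forall>m>0. q ^ m \<noteq> 1) \<longrightarrow> universal_for_A n q (\<iota> q))"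
proof (intro exI conjI allI impI)
  show K: "is_iota_R n qvar (iota_R n (qvar :: 'k laurent))"
    by (rule is_iota_R_iota_R) simp
  show k: "is_iota_R n q (iota_R n q)" for q :: 'k
    by (rule is_iota_R_iota_R) simp
  show "specialises_to n q (iota_R n qvar) (iota_R n q)" if "q \<noteq> 0" for q :: 'k
    by (rule specialises_to_iota_R[OF that])
  show "universal_for_A n qvar (iota_R n (qvar :: 'k laurent))"
    by (rule universal_for_A_iota_R[OF qvar_nonzero qvar_not_root_of_unity K])
  show "universal_for_A n q (iota_R n q)" if "q \<noteq> 0 \<and> (\<forall>m>0. q ^ m \<noteq> 1)" for q :: 'k
    by (rule universal_for_A_iota_R[OF _ _ k]) (use that in auto)
qed

end
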